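(* Let $\mathcal V^\bullet$ be a $\mathbb Z$-graded vector space. Then $\Psi$ is a homomorphism from the graded Lie algebra $(\mathbf C^\bullet(\mathcal V^\bullet,\mathcal V^\bullet),\llbracket\cdot,\cdot\rrbracket)$ to the graded Lie algebra $\big(\mathbf{CL}^\bullet(s(\mathcal V^\bullet\otimes\mathcal V^\bullet),s(\mathcal V^\bullet\otimes\mathcal V^\bullet)),[\cdot,\cdot]_{\mathsf B}\big)$. Consequently, a homotopy Nambu algebra $(\mathcal V^\bullet,\{\Theta_{2k-1}\}_{k=1}^{+\infty})$ naturally gives rise to a Leibniz$_\infty$-algebra $(s(\mathcal V^\bullet\otimes\mathcal V^\bullet),\{\theta_i\}_{i=1}^{+\infty})$, where $\theta_i$ is given, for homogeneous $\mathcal X_l=x_l\otimes y_l\in\mathcal V^\bullet\otimes\mathcal V^\bullet$ (the suspension $s$ being suppressed from the notation), by $$\theta_i(\mathcal X_1,\dots,\mathcal X_i)=\Theta_{2i-1}(\mathcal X_1,\dots,\mathcal X_{i-1},x_i)\otimes y_i+(-1)^{x_i(\mathcal X_1+\cdots+\mathcal X_{i-1}+i)}x_i\otimes\Theta_{2i-1}(\mathcal X_1,\dots,\mathcal X_{i-1},y_i).$$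
   Context: In exponents of $-1$, a homogeneous element stands for its degree. $\mathrm{Hom}^n$ denotes linear maps of degree $n$. $\mathbb S_{(a,b)}$ is the set of permutations $\sigma$ of $\{1,\dots,a+b\}$ with $\sigma(1)<\cdots<\sigma(a)$, $\sigma(a+1)<\cdots<\sigma(a+b)$; $\varepsilon(\sigma)$ is the Koszul sign of $\sigma$ on the arguments being permuted. $s$ is the suspension, $|sw|=|w|+1$. A Maurer-Cartan element of a graded Lie algebra is a degree $1$ element $\pi$ with $[\pi,\pi]=0$. **Graded Balavoine bracket.** For a graded vector space $\mathcal W^\bullet$ let $\bar{\mathsf T}(\mathcal W^\bullet)=\oplus_{i\ge1}\otimes^i\mathcal W^\bullet$, $\mathbf{CL}^n(\mathcal W^\bullet,\mathcal W^\bullet)=\mathrm{Hom}^n(\bar{\mathsf T}(\mathcal W^\bullet),\mathcal W^\bullet)$, $\mathbf{CL}^\bullet=\oplus_{n\in\mathbb Z}\mathbf{CL}^n$; write $f=\sum_{i\ge1}f_i$ with $f_i:\otimes^i\mathcal W^\bullet\to\mathcal W^\bullet$. For $f\in\mathbf{CL}^m$, $g\in\mathbf{CL}^n$, $$[f,g]_{\mathsf B}=f\,\bar\circ\, g-(-1)^{mn}g\,\bar\circ\, f,\qquad f\,\bar\circ\, g=\sum_{r\ge1}\ \sum_{i+j=r+1}\ \sum_{k=1}^i f_i\,\bar\circ_k\, g_j,$$ $$(f_i\,\bar\circ_k\, g_j)(v_1,\dots,v_r)=\sum_{\sigma\in\mathbb S_{(k-1,j-1)}}(-1)^{\beta_k}\varepsilon(\sigma)f_i\big(v_{\sigma(1)},\dots,v_{\sigma(k-1)},g_j(v_{\sigma(k)},\dots,v_{\sigma(k+j-2)},v_{k+j-1}),v_{k+j},\dots,v_r\big),$$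 with $r=i+j-1$ and $\beta_k=n(v_{\sigma(1)}+\cdots+v_{\sigma(k-1)})$. This makes $\mathbf{CL}^\bullet(\mathcal W^\bullet,\mathcal W^\bullet)$ a graded Lie algebra. **Leibniz$_\infty$-algebra.** A $\mathbb Z$-graded vector space $\mathfrak G^\bullet$ with linear maps $\theta_k:\otimes^k\mathfrak G^\bullet\to\mathfrak G^\bullet$ ($k\ge1$) of degree $1$ such that $\sum_{k\ge1}\theta_k$ is a Maurer-Cartan element of $(\mathbf{CL}^\bullet(\mathfrak G^\bullet,\mathfrak G^\bullet),[\cdot,\cdot]_{\mathsf B})$. **The map $\Psi$.** Let $\mathbf C^n(\mathcal V^\bullet,\mathcal V^\bullet)=\oplus_{p=1}^{+\infty}\mathrm{Hom}^{n+p-1}\big(\otimes^{p-1}(\mathcal V^\bullet\otimes\mathcal V^\bullet)\otimes\mathcal V^\bullet,\mathcal V^\bullet\big)$, whose elements are written as (possibly infinite) sums $f=\sum_{p=1}^{+\infty}f_{2p-1}$, and $\mathbf C^\bullet=\oplus_{n\in\mathbb Z}\mathbf C^n$. Define $\Psi:\mathbf C^n(\mathcal V^\bullet,\mathcal V^\bullet)\to\mathbf{CL}^n\big(s(\mathcal V^\bullet\otimes\mathcal V^\bullet),s(\mathcal V^\bullet\otimes\mathcal V^\bullet)\big)$ by $$(\Psi f_{2p-1})(s\mathcal X_1,\dots,s\mathcal X_{p-1},s(x\otimes y))=(-1)^{\frac{p(p-1)}2}s\Big(f_{2p-1}(\mathcal X_1,\dots,\mathcal X_{p-1},x)\otimes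 y+(-1)^{x(\mathcal X_1+\cdots+\mathcal X_{p-1}+n+p-1)}x\otimes f_{2p-1}(\mathcal X_1,\dots,\mathcal X_{p-1},y)\Big).$$ $\Psi$ is injective and its image is a graded Lie subalgebra. **The bracket $\llbracket\cdot,\cdot\rrbracket$.** The graded Lie bracket on $\mathbf C^\bullet(\mathcal V^\bullet,\mathcal V^\bullet)$ is $\llbracket f,g\rrbracket=\Psi^{-1}([\Psi(f),\Psi(g)]_{\mathsf B})$. More precisely, writing $f_i$, $g_j$ for the components of $f\in\mathbf C^m$, $g\in\mathbf C^n$ on $\otimes^{i-1}(\mathcal V^\bullet\otimes\mathcal V^\bullet)\otimes\mathcal V^\bullet$ and $\otimes^{j-1}(\mathcal V^\bullet\otimes\mathcal V^\bullet)\otimes\mathcal V^\bullet$, one has $\llbracket f,g\rrbracket=f\circ g-(-1)^{\deg(f)\deg(g)}g\circ f$ with $f\circ g=\sum_{r\ge0}\sum_{i+j=r+2}\sum_{k=1}^if_i\circ_kg_j$, where for $k=1,\dots,i-1$ $$\begin{aligned}(f_i\circ_kg_j)(\mathcal X_1,\dots,\mathcal X_r,x)=&\sum_{\sigma\in\mathbb S_{(k-1,j-1)}}(-1)^{\beta_k}\varepsilon(\sigma)f_i\big(\mathcal X_{\sigma(1)},\dots,\mathcal X_{\sigma(k-1)},g_j(\mathcal X_{\sigma(k)},\dots,\mathcal X_{\sigma(k+j-2)},x_{k+j-1})\otimes y_{k+j-1},\mathcal X_{k+j},\dots,\mathcal X_r,x\big)\\&+\sum_{\sigma\in\mathbb S_{(k-1,j-1)}}(-1)^{\beta_k+\gamma_k}\varepsilon(\sigma)f_i\big(\mathcal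 X_{\sigma(1)},\dots,\mathcal X_{\sigma(k-1)},x_{k+j-1}\otimes g_j(\mathcal X_{\sigma(k)},\dots,\mathcal X_{\sigma(k+j-2)},y_{k+j-1}),\mathcal X_{k+j},\dots,\mathcal X_r,x\big),\end{aligned}$$ $$(f_i\circ_ig_j)(\mathcal X_1,\dots,\mathcal X_r,x)=\sum_{\sigma\in\mathbb S_{(i-1,j-1)}}(-1)^{\beta_i}\varepsilon(\sigma)f_i\big(\mathcal X_{\sigma(1)},\dots,\mathcal X_{\sigma(i-1)},g_j(\mathcal X_{\sigma(i)},\dots,\mathcal X_{\sigma(r)},x)\big),$$ with $\beta_k=(n+j-1)(\mathcal X_{\sigma(1)}+\cdots+\mathcal X_{\sigma(k-1)})$ and $\gamma_k=x_{k+j-1}(\mathcal X_{\sigma(k)}+\cdots+\mathcal X_{\sigma(k+j-2)}+n+j-1)$. **Homotopy Nambu algebra.** A $\mathbb Z$-graded vector space $\mathcal V^\bullet$ with linear maps $\Theta_{2k-1}:\otimes^{2k-1}\mathcal V^\bullet\to\mathcal V^\bullet$ of degree $k$ ($k\ge1$), so that $\Theta_{2k-1}\in\mathbf C^1(\mathcal V^\bullet,\mathcal V^\bullet)$, such that $\sum_{k\ge1}\Theta_{2k-1}$ is a Maurer-Cartan element of $(\mathbf C^\bullet(\mathcal V^\bullet,\mathcal V^\bullet),\llbracket\cdot,\cdot\rrbracket)$. More precisely, for all homogeneous $\mathcal X_1,\dots,\mathcal X_{n-1}\in\mathcal V^\bullet\otimes\mathcal V^\bullet$, $x\in\mathcal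 V^\bullet$, $$\begin{aligned}&\sum_{i=1}^{n}\sum_{k=1}^{n-i}\sum_{\sigma\in\mathbb S_{(k-1,i-1)}}(-1)^{\gamma_k}\varepsilon(\sigma)\Theta_{2n-2i+1}\big(\mathcal X_{\sigma(1)},\dots,\mathcal X_{\sigma(k-1)},\theta_i(\mathcal X_{\sigma(k)},\dots,\mathcal X_{\sigma(k+i-2)},\mathcal X_{k+i-1}),\mathcal X_{k+i},\dots,\mathcal X_{n-1},x\big)\\&+\sum_{i=1}^{n}\sum_{\sigma\in\mathbb S_{(n-i,i-1)}}(-1)^{\gamma_{n-i+1}}\varepsilon(\sigma)\Theta_{2n-2i+1}\big(\mathcal X_{\sigma(1)},\dots,\mathcal X_{\sigma(n-i)},\Theta_{2i-1}(\mathcal X_{\sigma(n-i+1)},\dots,\mathcal X_{\sigma(n-1)},x)\big)=0,\end{aligned}$$ where here $\gamma_k=i(\mathcal X_{\sigma(1)}+\cdots+\mathcal X_{\sigma(k-1)})$ for $k=1,\dots,n-i+1$, and $\theta_i$ is given by the formula in the claim.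
   Formalization: The Leibniz-infinity operations on s(V⊗V) are (-1)^{i(i-1)/2} s θ_i = Ψ(Θ)_i, with θ_i as displayed (without this sign the claim fails); the field has characteristic not 2 so that Ψ is injective, and the bracket is Ψ^{-1}[Ψf,Ψg], not its explicit expansion. *)

theory Defs
  imports Complex_Main "HOL-Library.Function_Algebras" "HOL-Combinatorics.Permutations"
begin

section \<open>Graded vector spaces and graded Lie algebras\<close>

locale graded_vector_space = vector_space scale
  for scale :: "'k::field \<Rightarrow> 'v::ab_group_add \<Rightarrow> 'v" +
  fixes V :: "int \<Rightarrow> 'v set"
  assumes subspace_grading: "subspace (V n)"
    and direct_sum: "\<exists>!c. (\<forall>n. c n \<in> V n) \<and> finite {n. c n \<noteq> 0} \<and> v = (\<Sum>n | c n \<noteq> 0. c n)"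

text \<open>
  A graded Lie algebra is given by its homogeneous components \<open>L n\<close>, which are subspaces of one
  ambient vector space, and by the restrictions \<open>br m n\<close> of the bracket to \<open>L m\<close> and \<open>L n\<close>.
\<close>

locale graded_lie_algebra = vector_space scale
  for scale :: "'k::field \<Rightarrow> 'a::ab_group_add \<Rightarrow> 'a" +
  fixes L :: "int \<Rightarrow> 'a set"
    and br :: "int \<Rightarrow> int \<Rightarrow> 'a \<Rightarrow> 'a \<Rightarrow> 'a"
  assumes subspace_component: "subspace (L n)"
    and closed: "\<lbrakk>f \<in> L m; g \<in> L n\<rbrakk> \<Longrightarrow> br m n f g \<in> L (m + n)"
    and add_left: "\<lbrakk>f \<in> L m; f' \<in> L m; g \<in> L n\<rbrakk> \<Longrightarrow> br m n (f + f') g = br m n f g + br m n f' g"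
    and scale_left: "\<lbrakk>f \<in> L m; g \<in> L n\<rbrakk> \<Longrightarrow> br m n (scale c f) g = scale c (br m n f g)"
    and add_right: "\<lbrakk>f \<in> L m; g \<in> L n; g' \<in> L n\<rbrakk> \<Longrightarrow> br m n f (g + g') = br m n f g + br m n f g'"
    and scale_right: "\<lbrakk>f \<in> L m; g \<in> L n\<rbrakk> \<Longrightarrow> br m n f (scale c g) = scale c (br m n f g)"
    and antisymmetry: "\<lbrakk>f \<in> L m; g \<in> L n\<rbrakk> \<Longrightarrow> br m n f g = - scale ((-1) powi (m * n)) (br n m g f)"
    and jacobi: "\<lbrakk>f \<in> L m; g \<in> L n; h \<in> L p\<rbrakk> \<Longrightarrow>
      br m (n + p) f (br n p g h) =
      br (m + n) p (br m n f g) h + scale ((-1) powi (m * n)) (br n (m + p) g (br m p f h))"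

locale graded_lie_algebra_hom =
  source: graded_lie_algebra scale L br + target: graded_lie_algebra scale' L' br'
  for scale :: "'k::field \<Rightarrow> 'a::ab_group_add \<Rightarrow> 'a" and L br
    and scale' :: "'k \<Rightarrow> 'b::ab_group_add \<Rightarrow> 'b" and L' br' +
  fixes \<phi> :: "int \<Rightarrow> 'a \<Rightarrow> 'b"
  assumes degree: "f \<in> L n \<Longrightarrow> \<phi> n f \<in> L' n"
    and add: "\<lbrakk>f \<in> L n; g \<in> L n\<rbrakk> \<Longrightarrow> \<phi> n (f + g) = \<phi> n f + \<phi> n g"
    and scale: "f \<in> L n \<Longrightarrow> \<phi> n (scale c f) = scale' c (\<phi> n f)"
    and bracket: "\<lbrakk>f \<in> L m; g \<in> L n\<rbrakk> \<Longrightarrow> \<phi> (m + n) (br m n f g) = br' m n (\<phi> m f) (\<phi> n g)"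

definition maurer_cartan ::
    "(int \<Rightarrow> 'a::ab_group_add set) \<Rightarrow> (int \<Rightarrow> int \<Rightarrow> 'a \<Rightarrow> 'a \<Rightarrow> 'a) \<Rightarrow> 'a \<Rightarrow> bool" where
  "maurer_cartan L br \<pi> \<longleftrightarrow> \<pi> \<in> L 1 \<and> br 1 1 \<pi> \<pi> = 0"

text \<open>\<open>homogeneous V ds vs\<close>: the vectors in the list \<open>vs\<close> are homogeneous, with degrees \<open>ds\<close>.\<close>

definition homogeneous :: "(int \<Rightarrow> 'v set) \<Rightarrow> int list \<Rightarrow> 'v list \<Rightarrow> bool" where
  "homogeneous V ds vs \<longleftrightarrow> list_all2 (\<lambda>d v. v \<in> V d) ds vs"

text \<open>Suspension: \<open>s\<close> is the identity on underlying vectors and raises degrees by one.\<close>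

definition suspension :: "(int \<Rightarrow> 'v set) \<Rightarrow> int \<Rightarrow> 'v set" where
  "suspension V n = V (n - 1)"


section \<open>The graded Balavoine bracket\<close>

text \<open>
  A linear map on the sum of the tensor powers of \<open>W\<close> of exponent at least one is a function on
  non-empty lists that is multilinear on the lists of each length; its component \<open>f\<^sub>i\<close> is the
  restriction to lists of length \<open>i\<close>. The value at the empty list is fixed to be \<open>0\<close>.
\<close>

definition multilinear :: "('k::field \<Rightarrow> 'w::ab_group_add \<Rightarrow> 'w) \<Rightarrow> ('w list \<Rightarrow> 'w) \<Rightarrow> bool" where
  "multilinear scale f \<longleftrightarrow>
     f [] = 0 \<and> (\<forall>us vs. Vector_Spaces.linear scale scale (\<lambda>w. f (us @ w # vs)))"

definition CL ::
    "('k::field \<Rightarrow> 'w::ab_group_add \<Rightarrow> 'w) \<Rightarrow> (int \<Rightarrow> 'w set) \<Rightarrow> int \<Rightarrow> ('w list \<Rightarrow> 'w) set" where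
  "CL scale W n = {f. multilinear scale f \<and>
     (\<forall>ds ws. ws \<noteq> [] \<longrightarrow> homogeneous W ds ws \<longrightarrow> f ws \<in> W (sum_list ds + n))}"

text \<open>
  Unshuffles and Koszul signs, with positions counted from \<open>0\<close>. For homogeneous \<open>v\<^sub>0, \<dots>, v\<^sub>n\<^sub>-\<^sub>1\<close> of
  degrees \<open>ds\<close>, the Koszul sign of \<open>v\<^sub>0 \<cdots> v\<^sub>n\<^sub>-\<^sub>1 \<mapsto> v\<^bsub>\<sigma> 0\<^esub> \<cdots> v\<^bsub>\<sigma> (n-1)\<^esub>\<close> is \<open>-1\<close> to the power
  \<open>koszul_exponent n \<sigma> ds\<close>.
\<close>

definition unshuffles :: "nat \<Rightarrow> nat \<Rightarrow> (nat \<Rightarrow> nat) set" where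
  "unshuffles a b = {\<sigma>. \<sigma> permutes {..<a + b} \<and>
     strict_mono_on {..<a} \<sigma> \<and> strict_mono_on {a..<a + b} \<sigma>}"

definition koszul_exponent :: "nat \<Rightarrow> (nat \<Rightarrow> nat) \<Rightarrow> int list \<Rightarrow> int" where
  "koszul_exponent n \<sigma> ds = (\<Sum>(p, q) | p < q \<and> q < n \<and> \<sigma> p > \<sigma> q. ds ! \<sigma> p * ds ! \<sigma> q)"

text \<open>
  The value of \<open>f \<circ>\<^sub>k g\<close> on the vectors \<open>vs\<close> of degrees \<open>ds\<close>, for \<open>g\<close> of degree \<open>n\<close>, with \<open>g\<close>
  applied to \<open>j\<close> arguments.
\<close>

definition insertion ::
    "('k::field \<Rightarrow> 'w::ab_group_add \<Rightarrow> 'w) \<Rightarrow> int \<Rightarrow> ('w list \<Rightarrow> 'w) \<Rightarrow> ('w list \<Rightarrow> 'w) \<Rightarrow>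
     nat \<Rightarrow> nat \<Rightarrow> int list \<Rightarrow> 'w list \<Rightarrow> 'w" where
  "insertion scale n f g k j ds vs =
     (\<Sum>\<sigma>\<in>unshuffles (k - 1) (j - 1).
        scale ((-1) powi (n * (\<Sum>l<k - 1. ds ! \<sigma> l) + koszul_exponent (k + j - 2) \<sigma> ds))
          (f (map (\<lambda>l. vs ! \<sigma> l) [0..<k - 1] @
              g (map (\<lambda>l. vs ! \<sigma> l) [k - 1..<k + j - 2] @ [vs ! (k + j - 2)]) #
              drop (k + j - 1) vs)))"

text \<open>The formula involves degrees, so it prescribes the values on homogeneous vectors.\<close>

definition balavoine_circ ::
    "('k::field \<Rightarrow> 'w::ab_group_add \<Rightarrow> 'w) \<Rightarrow> (int \<Rightarrow> 'w set) \<Rightarrow> int \<Rightarrow>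
     ('w list \<Rightarrow> 'w) \<Rightarrow> ('w list \<Rightarrow> 'w) \<Rightarrow> 'w list \<Rightarrow> 'w" where
  "balavoine_circ scale W n f g =
     (THE h. multilinear scale h \<and>
       (\<forall>ds vs. homogeneous W ds vs \<longrightarrow>
          h vs = (\<Sum>(i, j) | 1 \<le> i \<and> 1 \<le> j \<and> i + j = length vs + 1.
                    \<Sum>k = 1..i. insertion scale n f g k j ds vs)))"

definition balavoine_bracket ::
    "('k::field \<Rightarrow> 'w::ab_group_add \<Rightarrow> 'w) \<Rightarrow> (int \<Rightarrow> 'w set) \<Rightarrow> int \<Rightarrow> int \<Rightarrow>
     ('w list \<Rightarrow> 'w) \<Rightarrow> ('w list \<Rightarrow> 'w) \<Rightarrow> 'w list \<Rightarrow> 'w" where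
  "balavoine_bracket scale W m n f g = (\<lambda>vs.
     balavoine_circ scale W n f g vs - scale ((-1) powi (m * n)) (balavoine_circ scale W m g f vs))"

definition leibniz_infinity ::
    "('k::field \<Rightarrow> 'w::ab_group_add \<Rightarrow> 'w) \<Rightarrow> (int \<Rightarrow> 'w set) \<Rightarrow> ('w list \<Rightarrow> 'w) \<Rightarrow> bool" where
  "leibniz_infinity scale W \<theta> \<longleftrightarrow> graded_vector_space scale W \<and>
     maurer_cartan (CL scale W) (balavoine_bracket scale W) \<theta>"


section \<open>Tensor products\<close>

definition bilinear_map ::
    "('k::field \<Rightarrow> 'v::ab_group_add \<Rightarrow> 'v) \<Rightarrow> ('k \<Rightarrow> 'w::ab_group_add \<Rightarrow> 'w) \<Rightarrow>
     ('k \<Rightarrow> 'z::ab_group_add \<Rightarrow> 'z) \<Rightarrow> ('v \<Rightarrow> 'w \<Rightarrow> 'z) \<Rightarrow> bool" where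
  "bilinear_map scaleV scaleW scaleZ b \<longleftrightarrow>
     (\<forall>y. Vector_Spaces.linear scaleV scaleZ (\<lambda>x. b x y)) \<and>
     (\<forall>x. Vector_Spaces.linear scaleW scaleZ (b x))"

text \<open>
  \<open>tens\<close> exhibits \<open>'t\<close> as the tensor square of \<open>'v\<close>. A locale assumption cannot quantify over the
  target type of the universal property, so only the ground field occurs as target; over a field this
  is enough, see \<open>universal_property\<close> below for an arbitrary target.
\<close>

locale tensor_square = V: vector_space scaleV + T: vector_space scaleT
  for scaleV :: "'k::field \<Rightarrow> 'v::ab_group_add \<Rightarrow> 'v"
    and scaleT :: "'k \<Rightarrow> 't::ab_group_add \<Rightarrow> 't" +
  fixes tens :: "'v \<Rightarrow> 'v \<Rightarrow> 't"
  assumes bilinear_tens: "bilinear_map scaleV scaleV scaleT tens"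
    and universal: "bilinear_map scaleV scaleV (*) b \<Longrightarrow>
      \<exists>!l. Vector_Spaces.linear scaleT (*) l \<and> (\<forall>x y. l (tens x y) = b x y)"

theorem (in tensor_square) universal_property:
  fixes scaleZ :: "'k \<Rightarrow> 'z::ab_group_add \<Rightarrow> 'z"
  assumes "vector_space scaleZ" and b: "bilinear_map scaleV scaleV scaleZ b"
  shows "\<exists>!l. Vector_Spaces.linear scaleT scaleZ l \<and> (\<forall>x y. l (tens x y) = b x y)"
proof -
  interpret Z: vector_space scaleZ by fact
  interpret K: vector_space "(*) :: 'k \<Rightarrow> 'k \<Rightarrow> 'k"
    by unfold_locales (auto simp: algebra_simps)
  interpret TK: vector_space_pair scaleT "(*) :: 'k \<Rightarrow> 'k \<Rightarrow> 'k" ..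
  interpret ZK: vector_space_pair scaleZ "(*) :: 'k \<Rightarrow> 'k \<Rightarrow> 'k" ..
  interpret TZ: vector_space_pair scaleT scaleZ ..
  have unique: "m = m'" if "Vector_Spaces.linear scaleT (*) m" "Vector_Spaces.linear scaleT (*) m'"
    "\<And>x y. m (tens x y) = m' (tens x y)" for m m' :: "'t \<Rightarrow> 'k"
  proof -
    have "bilinear_map scaleV scaleV (*) (\<lambda>x y. m (tens x y))"
      using bilinear_tens Vector_Spaces.linear_compose[OF _ that(1)]
      unfolding bilinear_map_def o_def by auto
    from universal[OF this] show ?thesis using that by metis
  qed
  obtain C where C: "C \<subseteq> range (case_prod tens)" "T.independent C" "range (case_prod tens) \<subseteq> T.span C"
    using T.maximal_independent_subset by blast
  have span_C: "T.span C = UNIV"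
  proof (rule ccontr)
    assume "T.span C \<noteq> UNIV"
    then obtain t where t: "t \<notin> T.span C" by blast
    have indep: "T.independent (insert t C)" and "t \<notin> C"
      using t C(2) T.independent_insertI T.span_base by blast+
    from TK.linear_independent_extend[OF indep, of "\<lambda>c. if c = t then 1 else 0"]
    obtain m where m: "Vector_Spaces.linear scaleT (*) m"
      "\<forall>c\<in>insert t C. m c = (if c = t then 1 else (0::'k))" by blast
    have "m c = 0" if "c \<in> T.span C" for c
      by (rule TK.linear_eq_0_on_span[OF m(1) _ that]) (use m(2) \<open>t \<notin> C\<close> in auto)
    then have "m (tens x y) = (\<lambda>_. 0) (tens x y)" for x y using C(3) by auto
    then have "m = (\<lambda>_. 0)"
      by (intro unique m(1) TK.module_hom_zero) auto
    then show False using m(2) by auto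
  qed
  have separate: "z = z'" if "\<And>\<phi>. Vector_Spaces.linear scaleZ (*) \<phi> \<Longrightarrow> \<phi> z = (\<phi> z' :: 'k)" for z z'
  proof (rule ccontr)
    assume "z \<noteq> z'"
    then have "Z.independent {z - z'}" by simp
    from ZK.linear_independent_extend[OF this, of "\<lambda>_. 1"]
    obtain \<phi> where \<phi>: "Vector_Spaces.linear scaleZ (*) \<phi>" "\<phi> (z - z') = (1::'k)" by auto
    then show False using that[OF \<phi>(1)] ZK.linear_diff[OF \<phi>(1)] by auto
  qed
  from TZ.linear_independent_extend[OF C(2), of "\<lambda>c. case_prod b (inv (case_prod tens) c)"]
  obtain l where l: "Vector_Spaces.linear scaleT scaleZ l"
    "\<And>c. c \<in> C \<Longrightarrow> l c = case_prod b (inv (case_prod tens) c)" by blast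
  have "l (tens x y) = b x y" for x y
  proof (rule separate)
    fix \<phi> :: "'z \<Rightarrow> 'k"
    assume \<phi>: "Vector_Spaces.linear scaleZ (*) \<phi>"
    have "bilinear_map scaleV scaleV (*) (\<lambda>x y. \<phi> (b x y))"
      using b Vector_Spaces.linear_compose[OF _ \<phi>]
      unfolding bilinear_map_def o_def by auto
    from universal[OF this] obtain m where m: "Vector_Spaces.linear scaleT (*) m"
      "\<And>x y. m (tens x y) = \<phi> (b x y)" by blast
    have "\<phi> (l c) = m c" if "c \<in> C" for c
    proof -
      have "c = case_prod tens (inv (case_prod tens) c)"
        using C(1) that by (metis f_inv_into_f subsetD)
      then have "m c = \<phi> (case_prod b (inv (case_prod tens) c))"
        by (metis m(2) case_prod_beta)
      then show ?thesis using l(2)[OF that] by simp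
    qed
    moreover have "Vector_Spaces.linear scaleT (*) (\<lambda>t. \<phi> (l t))"
      using Vector_Spaces.linear_compose[OF l(1) \<phi>] by (simp add: o_def)
    ultimately have "\<phi> (l t) = m t" for t
      using TK.linear_eq_on[OF _ m(1), of "\<lambda>t. \<phi> (l t)" t C] span_C by auto
    then show "\<phi> (l (tens x y)) = \<phi> (b x y)" using m(2) by simp
  qed
  moreover have "l' = l''" if "Vector_Spaces.linear scaleT scaleZ l'" "\<forall>x y. l' (tens x y) = b x y"
    "Vector_Spaces.linear scaleT scaleZ l''" "\<forall>x y. l'' (tens x y) = b x y" for l' l''
  proof
    fix t
    have "l' c = l'' c" if "c \<in> C" for c
      using C(1) that \<open>\<forall>x y. l' (tens x y) = b x y\<close> \<open>\<forall>x y. l'' (tens x y) = b x y\<close> by auto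
    then show "l' t = l'' t"
      using TZ.linear_eq_on[OF that(1,3), of t C] span_C by auto
  qed
  ultimately show ?thesis using l(1) by blast
qed

definition tensor_grading ::
    "('k::field \<Rightarrow> 't::ab_group_add \<Rightarrow> 't) \<Rightarrow> ('v \<Rightarrow> 'v \<Rightarrow> 't) \<Rightarrow> (int \<Rightarrow> 'v set) \<Rightarrow> int \<Rightarrow> 't set" where
  "tensor_grading scaleT tens V n =
     module.span scaleT {tens x y | x y a b. x \<in> V a \<and> y \<in> V b \<and> a + b = n}"


section \<open>Homotopy Nambu algebras\<close>

text \<open>
  An element \<open>f\<close> is a function of \<open>\<X>\<^sub>1, \<dots>, \<X>\<^sub>p\<^sub>-\<^sub>1\<close> and \<open>x\<close>, linear in each of them; its component
  \<open>f\<^bsub>2p-1\<^esub>\<close> is the restriction to lists \<open>[\<X>\<^sub>1, \<dots>, \<X>\<^sub>p\<^sub>-\<^sub>1]\<close> of length \<open>p - 1\<close> and has degree \<open>n + p - 1\<close>.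
\<close>

definition Cn ::
    "('k::field \<Rightarrow> 'v::ab_group_add \<Rightarrow> 'v) \<Rightarrow> ('k \<Rightarrow> 't::ab_group_add \<Rightarrow> 't) \<Rightarrow> ('v \<Rightarrow> 'v \<Rightarrow> 't) \<Rightarrow>
     (int \<Rightarrow> 'v set) \<Rightarrow> int \<Rightarrow> ('t list \<Rightarrow> 'v \<Rightarrow> 'v) set" where
  "Cn scaleV scaleT tens V n = {f.
     (\<forall>Xs Ys x. Vector_Spaces.linear scaleT scaleV (\<lambda>X. f (Xs @ X # Ys) x)) \<and>
     (\<forall>Xs. Vector_Spaces.linear scaleV scaleV (f Xs)) \<and>
     (\<forall>ds Xs a x. homogeneous (tensor_grading scaleT tens V) ds Xs \<longrightarrow> x \<in> V a \<longrightarrow>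
        f Xs x \<in> V (sum_list ds + a + n + int (length Xs)))}"

text \<open>
  The formula for \<open>\<Psi>\<close>, with \<open>p = length Xs + 1\<close>; it prescribes the values on homogeneous arguments.
\<close>

definition Psi ::
    "('k::field \<Rightarrow> 't::ab_group_add \<Rightarrow> 't) \<Rightarrow> ('v \<Rightarrow> 'v \<Rightarrow> 't) \<Rightarrow> (int \<Rightarrow> 'v set) \<Rightarrow> int \<Rightarrow>
     ('t list \<Rightarrow> 'v \<Rightarrow> 'v) \<Rightarrow> 't list \<Rightarrow> 't" where
  "Psi scaleT tens V n f =
     (THE F. multilinear scaleT F \<and>
       (\<forall>ds Xs a x b y. homogeneous (tensor_grading scaleT tens V) ds Xs \<longrightarrow> x \<in> V a \<longrightarrow> y \<in> V b \<longrightarrow>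
          (let p = length Xs + 1 in
           F (Xs @ [tens x y]) =
             scaleT ((-1) ^ (p * (p - 1) div 2))
               (tens (f Xs x) y +
                scaleT ((-1) powi (a * (sum_list ds + n + int p - 1))) (tens x (f Xs y))))))"

text \<open>
  The bracket transported along \<open>\<Psi>\<close>. Away from characteristic two \<open>\<Psi>\<close> is injective; in
  characteristic two it kills the scalar operators \<open>x \<mapsto> c x\<close>.
\<close>

definition nambu_bracket ::
    "('k::field \<Rightarrow> 'v::ab_group_add \<Rightarrow> 'v) \<Rightarrow> ('k \<Rightarrow> 't::ab_group_add \<Rightarrow> 't) \<Rightarrow> ('v \<Rightarrow> 'v \<Rightarrow> 't) \<Rightarrow>
     (int \<Rightarrow> 'v set) \<Rightarrow> int \<Rightarrow> int \<Rightarrow>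
     ('t list \<Rightarrow> 'v \<Rightarrow> 'v) \<Rightarrow> ('t list \<Rightarrow> 'v \<Rightarrow> 'v) \<Rightarrow> 't list \<Rightarrow> 'v \<Rightarrow> 'v" where
  "nambu_bracket scaleV scaleT tens V m n f g =
     the_inv_into (Cn scaleV scaleT tens V (m + n)) (Psi scaleT tens V (m + n))
       (balavoine_bracket scaleT (suspension (tensor_grading scaleT tens V)) m n
         (Psi scaleT tens V m f) (Psi scaleT tens V n g))"

definition homotopy_nambu ::
    "('k::field \<Rightarrow> 'v::ab_group_add \<Rightarrow> 'v) \<Rightarrow> ('k \<Rightarrow> 't::ab_group_add \<Rightarrow> 't) \<Rightarrow> ('v \<Rightarrow> 'v \<Rightarrow> 't) \<Rightarrow>
     (int \<Rightarrow> 'v set) \<Rightarrow> ('t list \<Rightarrow> 'v \<Rightarrow> 'v) \<Rightarrow> bool" where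
  "homotopy_nambu scaleV scaleT tens V \<Theta> \<longleftrightarrow> graded_vector_space scaleV V \<and>
     maurer_cartan (Cn scaleV scaleT tens V) (nambu_bracket scaleV scaleT tens V) \<Theta>"

text \<open>
  Operations \<open>\<theta>\<^sub>i\<close> on a graded space and the operations they induce on its suspension, with the sign
  \<open>(s\<inverse>)\<^sup>\<otimes>\<^sup>i \<circ> s\<^sup>\<otimes>\<^sup>i = (-1)\<^bsup>i(i-1)/2\<^esup>\<close> that also enters the definition of \<open>\<Psi>\<close>. This is the
  identification that is meant when \<open>s\<close> is suppressed from the notation.
\<close>

definition suspended ::
    "('k::field \<Rightarrow> 'w::ab_group_add \<Rightarrow> 'w) \<Rightarrow> ('w list \<Rightarrow> 'w) \<Rightarrow> 'w list \<Rightarrow> 'w" where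
  "suspended scale \<theta> = (\<lambda>ws. let i = length ws in scale ((-1) ^ (i * (i - 1) div 2)) (\<theta> ws))"

end

(*
  Graded lists (lists of pairs of a degree and a vector) turn the Balavoine product into a plain
  recursion, plug: the first argument of the composite either stays outside of the inner map, or is
  its last argument, or is one of its earlier arguments. For this recursion the graded pre-Lie
  identity is an induction on the list of arguments, and the Jacobi identity is a formal consequence.

  With respect to the suspended degrees of the first arguments, and after absorbing the sign
  (-1)^(p(p-1)/2) into f, the map Psi f extends the operators f(X_1, ..., X_(p-1), -) on V to graded
  derivations of the tensor square. In the bracket of two such maps the terms in which the inner map
  takes the last argument combine into graded commutators of derivations, which are again derivations.
  Hence the image of Psi is closed under the bracket, and everything is transported along Psi.
*)
theory Submission
  imports Defs
begin

section \<open>Signs and multilinear functions of graded lists\<close>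

text \<open>The compositions and \<open>Psi\<close> are prescribed on homogeneous arguments only, by
  formulas whose signs involve degrees. A vector does not determine its degree (0 lies in every
  component), so the degree has to travel with it. That multilinear maps with the prescribed values
  exist is a genuine obligation; it is met because signs see degrees modulo 2 only. A component of
  an element of \<open>Cn\<close> has degree n + p - 1 on unsuspended arguments, which is degree n
  once its p - 1 arguments from the tensor square are counted with suspended degrees; this removes
  the component index from the exponents. No identity is checked directly for the bracket on
  \<open>Cn\<close>: it is the pullback of the Balavoine bracket, so closure of the image and
  injectivity suffice. Injectivity is where 2 must be nonzero: multiplication by a scalar c, an
  operator of degree 0, extends to the derivation 2c.\<close>

definition sg :: "int \<Rightarrow> 'a::ab_group_add \<Rightarrow> 'a" where
  "sg k v = (if even k then v else - v)"

text \<open>A sign depends on the parity of its exponent alone. \<open>sg\<close> states it in the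
  additive group, without a scalar, so it commutes with every additive map and sign identities
  reduce to parity cases.\<close>

lemma (in vector_space) scale_powi: "scale ((-1) powi k) v = sg k v"
  by (cases "even k") (simp_all add: sg_def power_int_minus_left)

lemma sg_add: "sg k (u + v) = sg k u + sg k v"
  and sg_diff: "sg k (u - v) = sg k u - sg k v"
  and sg_zero [simp]: "sg k 0 = 0"
  and sg_0 [simp]: "sg 0 v = v"
  and sg_sg: "sg j (sg k v) = sg (j + k) v"
  by (auto simp: sg_def)

lemma sg_sum: "sg k (sum F A) = (\<Sum>x\<in>A. sg k (F x))"
  by (simp add: sg_def sum_negf)

lemma sg_fun: "sg k f x = sg k (f x)"
  by (simp add: sg_def)

lemmas lin_add = module_hom.add[OF module_hom_linearI]
  and lin_diff = module_hom.diff[OF module_hom_linearI]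
  and lin_neg = module_hom.neg[OF module_hom_linearI]
  and lin_zero = module_hom.zero[OF module_hom_linearI]
  and lin_scale = module_hom.scale[OF module_hom_linearI]
  and lin_sum = module_hom.sum[OF module_hom_linearI]

text \<open>Linearity in each vector with all degree labels held fixed; labels need not match the
  vectors. Domain and target are separate because an outer map may take values in \<open>V\<close>
  while its arguments lie in the tensor square.\<close>

definition dmultilinear :: "('k::field \<Rightarrow> 'w::ab_group_add \<Rightarrow> 'w) \<Rightarrow> ('k \<Rightarrow> 'a::ab_group_add \<Rightarrow> 'a) \<Rightarrow>
    ((int \<times> 'w) list \<Rightarrow> 'a) \<Rightarrow> bool" where
  "dmultilinear s s' h \<longleftrightarrow> (\<forall>us d vs. Vector_Spaces.linear s s' (\<lambda>w. h (us @ (d, w) # vs)))"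

section \<open>The pre-Lie identity for insertions\<close>

text \<open>
  The value of \<open>h \<circ> g\<close> for \<open>g\<close> of degree \<open>n\<close>. The three summands are the cases that the first argument
  is not an argument of \<open>g\<close>, is its last one, or is one of its earlier ones; in the last case \<open>g\<close>
  is replaced by a partial application, of degree \<open>n + d\<close>, which accounts for the Koszul sign.
\<close>

fun plug :: "int \<Rightarrow> ((int \<times> 'w) list \<Rightarrow> 'w) \<Rightarrow> ((int \<times> 'w) list \<Rightarrow> 'a) \<Rightarrow> (int \<times> 'w) list \<Rightarrow>
    'a::ab_group_add" where
  "plug n g h [] = 0"
| "plug n g h ((d, w) # zs) =
     sg (n * d) (plug n g (\<lambda>ys. h ((d, w) # ys)) zs) + h ((n + d, g [(d, w)]) # zs) +
     plug (n + d) (\<lambda>ys. g ((d, w) # ys)) h zs"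

lemma dmultilinearD: "dmultilinear s s' h \<Longrightarrow> Vector_Spaces.linear s s' (\<lambda>w. h (us @ (d, w) # vs))"
  by (simp add: dmultilinear_def)

lemma dmultilinear_append: "dmultilinear s s' h \<Longrightarrow> dmultilinear s s' (\<lambda>ys. h (us @ ys @ us'))"
  using dmultilinearD[of s s' h "us @ vs" for vs] by (simp add: dmultilinear_def)

lemma dmultilinear_Cons: "dmultilinear s s' h \<Longrightarrow> dmultilinear s s' (\<lambda>ys. h (z # ys))"
  using dmultilinear_append[of s s' h "[z]" "[]"] by simp

lemma dmultilinear_hd: "dmultilinear s s' h \<Longrightarrow> Vector_Spaces.linear s s' (\<lambda>w. h ((d, w) # vs))"
  using dmultilinearD[of s s' h "[]"] by simp

lemma dmultilinear_add: "dmultilinear s s' h \<Longrightarrow> h ((d, v + w) # zs) = h ((d, v) # zs) + h ((d, w) # zs)"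
  using lin_add[OF dmultilinear_hd] by blast

lemma dmultilinear_sg: "dmultilinear s s' h \<Longrightarrow> h ((d, sg k v) # zs) = sg k (h ((d, v) # zs))"
  using lin_neg[OF dmultilinear_hd] by (fastforce simp: sg_def)

lemma plug_outer_add: "plug n g (\<lambda>ys. h ys + h' ys) zs = plug n g h zs + plug n g h' zs"
  by (induction n g h zs arbitrary: h' rule: plug.induct) (simp_all add: sg_add)

lemma plug_outer_sg: "plug n g (\<lambda>ys. sg k (h ys)) zs = sg k (plug n g h zs)"
  by (induction n g h zs rule: plug.induct) (simp_all add: sg_add sg_sg add.commute)

text \<open>The value of the inner map is an argument of \<open>h\<close>, so additivity in the
  inner map rests on additivity of \<open>h\<close> in that slot.\<close>

lemma plug_inner_add:
  "dmultilinear s s' h \<Longrightarrow> plug n (\<lambda>ys. g ys + g' ys) h zs = plug n g h zs + plug n g' h zs"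
  by (induction n g h zs arbitrary: g' rule: plug.induct)
    (simp_all add: sg_add dmultilinear_Cons dmultilinear_add)

lemma plug_inner_sg: "dmultilinear s s' h \<Longrightarrow> plug n (\<lambda>ys. sg k (g ys)) h zs = sg k (plug n g h zs)"
  by (induction n g h zs rule: plug.induct)
    (simp_all add: sg_add sg_sg add.commute dmultilinear_Cons dmultilinear_sg)

text \<open>The associator of \<open>h\<close>, \<open>f\<close>, \<open>g\<close> retains only the
  terms in which the values of \<open>f\<close> and \<open>g\<close> are two different arguments of
  \<open>h\<close>; exchanging the two maps there costs the sign (-1)^(m n).\<close>

lemma plug_pre_lie:
  assumes "dmultilinear s s' h"
  shows "plug n g (plug m f h) zs - plug (m + n) (plug n g f) h zs =
    sg (m * n) (plug m f (plug n g h) zs - plug (m + n) (plug m f g) h zs)"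
  using assms
proof (induction zs arbitrary: m n f g h)
  case Nil
  then show ?case by simp
next
  case (Cons z zs)
  obtain d w where z: "z = (d, w)" by fastforce
  \<comment> \<open>The associator on the tail of the argument list. The maps and degrees stay
    variable because partial applications to \<open>z\<close> occur below.\<close>
  define Q where "Q m n f g h = plug n g (plug m f h) zs - plug (m + n) (plug n g f) h zs" for m n f g and h :: "(int \<times> 'b) list \<Rightarrow> 'c"
  have Q: "Q m n f g h = sg (m * n) (Q n m g f h)" if "dmultilinear s s' h" for m n f g h
    using Cons.IH[OF that, of n g m f] by (simp add: Q_def add.commute)
  \<comment> \<open>The three associators are the cases that \<open>z\<close> stays with
    \<open>h\<close>, or is an earlier argument of \<open>f\<close> or of \<open>g\<close>. In the
    last two terms \<open>z\<close> is the last argument of \<open>f\<close> or of \<open>g\<close>,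
    whose value becomes the first argument of \<open>h\<close>; exchanging \<open>f\<close> and
    \<open>g\<close> swaps them. The terms in which \<open>g [z]\<close> enters \<open>f\<close>
    occur in both composites and cancel.\<close>
  have step: "plug n g (plug m f h) (z # zs) - plug (m + n) (plug n g f) h (z # zs) =
     sg ((m + n) * d) (Q m n f g (\<lambda>ys. h (z # ys))) + sg (n * d) (Q (m + d) n (\<lambda>ys. f (z # ys)) g h)
     + Q m (n + d) f (\<lambda>ys. g (z # ys)) h
     + sg (n * d) (plug n g (\<lambda>ys. h ((m + d, f [z]) # ys)) zs)
     + sg (m * (n + d)) (plug m f (\<lambda>ys. h ((n + d, g [z]) # ys)) zs)" for m n f g
  proof -
    have 1: "plug n g (plug m f h) (z # zs) =
      sg (n * d) (sg (m * d) (plug n g (plug m f (\<lambda>ys. h (z # ys))) zs)) +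
      sg (n * d) (plug n g (\<lambda>ys. h ((m + d, f [z]) # ys)) zs) +
      sg (n * d) (plug n g (plug (m + d) (\<lambda>ys. f (z # ys)) h) zs) +
      sg (m * (n + d)) (plug m f (\<lambda>ys. h ((n + d, g [z]) # ys)) zs) +
      h ((m + (n + d), f [(n + d, g [z])]) # zs) +
      plug (m + (n + d)) (\<lambda>ys. f ((n + d, g [z]) # ys)) h zs +
      plug (n + d) (\<lambda>ys. g (z # ys)) (plug m f h) zs"
      unfolding z by (simp add: plug_outer_add plug_outer_sg sg_add add.assoc)
    have 2: "plug (m + n) (plug n g f) h (z # zs) =
      sg ((m + n) * d) (plug (m + n) (plug n g f) (\<lambda>ys. h (z # ys)) zs) +
      h ((m + (n + d), f [(n + d, g [z])]) # zs) +
      sg (n * d) (plug (m + n + d) (plug n g (\<lambda>ys. f (z # ys))) h zs) +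
      plug (m + (n + d)) (\<lambda>ys. f ((n + d, g [z]) # ys)) h zs +
      plug (m + n + d) (plug (n + d) (\<lambda>ys. g (z # ys)) f) h zs"
      unfolding z
      by (simp add: plug_inner_add[OF Cons.prems] plug_inner_sg[OF Cons.prems] add.assoc)
    have 3: "m + n + d = m + d + n" "m + (n + d) = m + d + n" by simp_all
    show ?thesis
      unfolding 1 2 Q_def 3 sg_sg distrib_right sg_diff by (simp add: algebra_simps)
  qed
  have Q1: "Q m n f g (\<lambda>ys. h (z # ys)) = sg (m * n) (Q n m g f (\<lambda>ys. h (z # ys)))"
    by (rule Q[OF dmultilinear_Cons[OF Cons.prems]])
  have Q2: "Q (m + d) n (\<lambda>ys. f (z # ys)) g h = sg ((m + d) * n) (Q n (m + d) g (\<lambda>ys. f (z # ys)) h)"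
    by (rule Q[OF Cons.prems])
  have Q3: "Q m (n + d) f (\<lambda>ys. g (z # ys)) h = sg (m * (n + d)) (Q (n + d) m (\<lambda>ys. g (z # ys)) f h)"
    by (rule Q[OF Cons.prems])
  show ?case
    unfolding step[of n g m f] step[of m f n g, unfolded add.commute[of n m]] Q1 Q2 Q3
    by (simp add: sg_def)
qed

section \<open>Linearity, homogeneous lists and congruence for \<open>plug\<close>\<close>

lemma linear_plus: "Vector_Spaces.linear s s' f \<Longrightarrow> Vector_Spaces.linear s s' g \<Longrightarrow>
    Vector_Spaces.linear s s' (\<lambda>x. f x + g x)"
  unfolding Vector_Spaces.linear_iff vector_space_def by (auto simp: algebra_simps)

lemma linear_uminus: "Vector_Spaces.linear s s' f \<Longrightarrow> Vector_Spaces.linear s s' (\<lambda>x. - f x)"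
  unfolding Vector_Spaces.linear_iff by (auto simp: vector_space.vector_space_assms module.scale_minus_right module_iff_vector_space)

lemma linear_minus: "Vector_Spaces.linear s s' f \<Longrightarrow> Vector_Spaces.linear s s' g \<Longrightarrow>
    Vector_Spaces.linear s s' (\<lambda>x. f x - g x)"
  using linear_plus[OF _ linear_uminus, of s s' f g] by simp

lemma linear_sg: "Vector_Spaces.linear s s' f \<Longrightarrow> Vector_Spaces.linear s s' (\<lambda>x. sg k (f x))"
  using linear_uminus[of s s' f] by (cases "even k") (simp_all add: sg_def)

text \<open>The linearity predicate contains the vector space axioms of both sides, so any linear
  map between them supplies what the zero map needs.\<close>

lemma linear_const_zero: "Vector_Spaces.linear s s' f \<Longrightarrow> Vector_Spaces.linear s s' (\<lambda>x. 0)"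
  using linear_plus[OF _ linear_uminus, of s s' f f] by simp

lemma linear_comp: "Vector_Spaces.linear s s' f \<Longrightarrow> Vector_Spaces.linear s' s'' g \<Longrightarrow>
    Vector_Spaces.linear s s'' (\<lambda>x. g (f x))"
  unfolding Vector_Spaces.linear_iff by auto

definition total :: "(int \<times> 'w) list \<Rightarrow> int" where
  "total zs = sum_list (map fst zs)"

lemma total_simps [simp]: "total [] = 0" "total (z # zs) = fst z + total zs"
    "total (us @ vs) = total us + total vs"
  by (simp_all add: total_def)

definition hom_list :: "(int \<Rightarrow> 'w set) \<Rightarrow> (int \<times> 'w) list \<Rightarrow> bool" where
  "hom_list W zs \<longleftrightarrow> (\<forall>(d, w)\<in>set zs. w \<in> W d)"

lemma hom_list_simps [simp]: "hom_list W []" "hom_list W (z # zs) \<longleftrightarrow> snd z \<in> W (fst z) \<and> hom_list W zs"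
    "hom_list W (us @ vs) \<longleftrightarrow> hom_list W us \<and> hom_list W vs"
  by (auto simp: hom_list_def split: prod.splits)

lemma homogeneous_iff: "homogeneous W ds vs \<longleftrightarrow> (\<exists>zs. hom_list W zs \<and> ds = map fst zs \<and> vs = map snd zs)"
proof
  assume "homogeneous W ds vs"
  then have "list_all2 (\<lambda>d v. v \<in> W d) ds vs" by (simp add: homogeneous_def)
  then show "\<exists>zs. hom_list W zs \<and> ds = map fst zs \<and> vs = map snd zs"
  proof (induction rule: list_all2_induct)
    case (Cons d ds v vs)
    then obtain zs where "hom_list W zs" "ds = map fst zs" "vs = map snd zs" by blast
    with Cons show ?case by (intro exI[of _ "(d, v) # zs"]) simp
  qed simp
qed (auto simp: homogeneous_def hom_list_def list.rel_map split_beta intro!: list.rel_refl_strong)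

lemma linear_plug_outer:
  assumes "\<And>ys. Vector_Spaces.linear s s' (\<lambda>w. H w ys)"
  shows "Vector_Spaces.linear s s' (\<lambda>w. plug n g (H w) zs)"
  using assms
proof (induction zs arbitrary: n g H)
  case Nil
  then show ?case using linear_const_zero by fastforce
next
  case (Cons z zs)
  then show ?case by (cases z) (auto intro!: linear_plus linear_sg)
qed

lemma linear_plug_inner:
  assumes "dmultilinear s s' h" "\<And>ys. Vector_Spaces.linear t s (\<lambda>w. G w ys)"
  shows "Vector_Spaces.linear t s' (\<lambda>w. plug n (G w) h zs)"
  using assms
proof (induction zs arbitrary: n G h)
  case Nil
  then show ?case using linear_const_zero[OF linear_comp[OF Nil(2) dmultilinear_hd[OF Nil(1)]]] by simp
next
  case (Cons z zs)
  then show ?case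
    by (cases z) (auto intro!: linear_plus linear_sg Cons.IH dmultilinear_Cons
      intro: linear_comp[OF Cons.prems(2) dmultilinear_hd[OF Cons.prems(1)]])
qed

lemma dmultilinear_plug:
  assumes "dmultilinear s s g" "dmultilinear s s' h"
  shows "dmultilinear s s' (plug n g h)"
proof -
  have "Vector_Spaces.linear s s' (\<lambda>w. plug n g h (us @ (d, w) # vs))" for us d vs
    using assms
  proof (induction us arbitrary: n g h)
    case Nil
    have "Vector_Spaces.linear s s' (\<lambda>w. h ((n + d, g [(d, w)]) # vs))"
      by (rule linear_comp[OF dmultilinear_hd[OF Nil(1)] dmultilinear_hd[OF Nil(2)]])
    then show ?case using Nil
      by (auto intro!: linear_plus linear_sg linear_plug_outer linear_plug_inner dmultilinear_hd)
  next
    case (Cons u us)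
    then show ?case
      by (cases u) (auto intro!: linear_plus linear_sg Cons.IH dmultilinear_Cons
        dmultilinearD[of s s' h "_ # us", simplified])
  qed
  then show ?thesis by (simp add: dmultilinear_def)
qed

text \<open>Inserting a map of degree \<open>n\<close> shifts the total degree by \<open>n\<close>,
  so \<open>h\<close> matters only at lists of total degree \<open>total zs + n\<close>. A sign
  depending on the total degree may thus be treated as constant. The degree condition on
  \<open>g'\<close> keeps the lists that reach \<open>h\<close> homogeneous.\<close>

lemma plug_cong:
  assumes "hom_list W zs"
    and "\<And>ys. \<lbrakk>hom_list W ys; ys \<noteq> []\<rbrakk> \<Longrightarrow> g ys = g' ys \<and> g' ys \<in> W (total ys + n)"
    and "\<And>ys. \<lbrakk>hom_list W ys; ys \<noteq> []; total ys = total zs + n\<rbrakk> \<Longrightarrow> h ys = h' ys"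
  shows "plug n g h zs = plug n g' h' zs"
  using assms
proof (induction zs arbitrary: n g h g' h')
  case Nil
  then show ?case by simp
next
  case (Cons z zs)
  obtain d w where z: "z = (d, w)" by fastforce
  have gz: "g [z] = g' [z]" "g' [z] \<in> W (d + n)" using Cons.prems(1) Cons.prems(2)[of "[z]"] z by auto
  have 1: "plug n g (\<lambda>ys. h (z # ys)) zs = plug n g' (\<lambda>ys. h' (z # ys)) zs"
    using Cons.prems z by (intro Cons.IH) auto
  have 2: "plug (n + d) (\<lambda>ys. g (z # ys)) h zs = plug (n + d) (\<lambda>ys. g' (z # ys)) h' zs"
  proof (rule Cons.IH)
    fix ys assume "hom_list W ys" "ys \<noteq> []"
    then show "g (z # ys) = g' (z # ys) \<and> g' (z # ys) \<in> W (total ys + (n + d))"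
      using Cons.prems(1) Cons.prems(2)[of "z # ys"] z by (auto simp: algebra_simps)
  qed (use Cons.prems z in \<open>auto simp: algebra_simps\<close>)
  have 3: "h ((n + d, g [z]) # zs) = h' ((n + d, g [z]) # zs)"
    using Cons.prems z gz by (intro Cons.prems(3)) (auto simp: algebra_simps)
  show ?case using 1 2 3 gz z by simp
qed

lemma (in vector_space) subspace_sg: "subspace S \<Longrightarrow> v \<in> S \<Longrightarrow> sg k v \<in> S"
  by (simp add: sg_def subspace_neg)

lemma (in vector_space) plug_in_subspace:
  assumes "subspace S" "hom_list W zs"
    and "\<And>ys. \<lbrakk>hom_list W ys; ys \<noteq> []\<rbrakk> \<Longrightarrow> g ys \<in> W (total ys + n)"
    and "\<And>ys. \<lbrakk>hom_list W ys; ys \<noteq> []; total ys = total zs + n\<rbrakk> \<Longrightarrow> h ys \<in> S"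
  shows "plug n g h zs \<in> S"
  using assms(2-)
proof (induction zs arbitrary: n g h)
  case Nil
  then show ?case using assms(1) by (simp add: subspace_0)
next
  case (Cons z zs)
  obtain d w where z: "z = (d, w)" by fastforce
  have gz: "g [z] \<in> W (d + n)" using Cons.prems(1) Cons.prems(2)[of "[z]"] z by auto
  have 1: "plug n g (\<lambda>ys. h (z # ys)) zs \<in> S"
    using Cons.prems z by (intro Cons.IH) auto
  have 2: "plug (n + d) (\<lambda>ys. g (z # ys)) h zs \<in> S"
  proof (rule Cons.IH)
    fix ys assume "hom_list W ys" "ys \<noteq> []"
    then show "g (z # ys) \<in> W (total ys + (n + d))"
      using Cons.prems(1) Cons.prems(2)[of "z # ys"] z by (auto simp: algebra_simps)
  qed (use Cons.prems z in \<open>auto simp: algebra_simps\<close>)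
  have 3: "h ((n + d, g [z]) # zs) \<in> S"
    using Cons.prems z gz by (intro Cons.prems(3)) (auto simp: algebra_simps)
  show ?case using 1 2 3 z assms(1) by (simp add: subspace_add subspace_sg)
qed

text \<open>An additive map also preserves 0 and signs, the only other operations that the recursion
  performs on values of the outer map.\<close>

lemma plug_additive:
  assumes "\<And>u v. L (u + v) = L u + L v"
  shows "plug n g (\<lambda>ys. L (h ys)) zs = L (plug n g h zs)"
proof -
  have 0: "L 0 = 0" using assms[of 0 0] by simp
  then have "L (- u) = - L u" for u using assms[of u "- u"] by (simp add: eq_neg_iff_add_eq_0 add.commute)
  then have "L (sg k u) = sg k (L u)" for k u by (simp add: sg_def)
  with 0 show ?thesis by (induction zs arbitrary: n g h) (auto simp: assms)
qed

section \<open>Extension of multilinear functions from homogeneous arguments\<close>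

text \<open>
  All signs depend only on the parities of the degrees, so that it suffices to decompose each
  argument into its even and its odd part: the extension is a finite sum of fixed shape.
\<close>

abbreviation same_parity :: "(int \<times> 'w) list \<Rightarrow> (int \<times> 'w) list \<Rightarrow> bool" where
  "same_parity \<equiv> list_all2 (\<lambda>x y. even (fst x - fst y) \<and> snd x = snd y)"

definition parity_invariant :: "((int \<times> 'w) list \<Rightarrow> 'a) \<Rightarrow> bool" where
  "parity_invariant Q \<longleftrightarrow>
     (\<forall>zs zs'. same_parity zs zs' \<longrightarrow> Q zs = Q zs')"

lemma parity_invariantD: "parity_invariant Q \<Longrightarrow>
    same_parity zs zs' \<Longrightarrow> Q zs = Q zs'"
  by (simp add: parity_invariant_def)

lemma parity_invariant_Cons: "parity_invariant Q \<Longrightarrow> parity_invariant (\<lambda>zs. Q (z # zs))"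
  by (simp add: parity_invariant_def)

lemma parity_invariant_map_snd: "parity_invariant (\<lambda>zs. f (map snd zs))"
  unfolding parity_invariant_def by (auto simp: list_all2_conv_all_nth intro!: arg_cong[of _ _ f] nth_equalityI)

lemma parity_invariant_plug:
  assumes "parity_invariant g" "parity_invariant h"
  shows "parity_invariant (plug n g h)"
proof -
  \<comment> \<open>Heads with different labels yield different partial applications and different
    inner degrees, so the induction compares two families of maps at once.\<close>
  have "plug n g h zs = plug n' g' h' zs'"
    if "same_parity zs zs'" "even (n - n')"
      "\<And>ys ys'. same_parity ys ys' \<Longrightarrow> g ys = g' ys'"
      "\<And>ys ys'. same_parity ys ys' \<Longrightarrow> h ys = h' ys'"
    for zs zs' n n' and g g' :: "(int \<times> 'a) list \<Rightarrow> 'a" and h h' :: "(int \<times> 'a) list \<Rightarrow> 'b"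
    using that
  proof (induction zs zs' arbitrary: n n' g g' h h' rule: list_all2_induct)
    case Nil
    then show ?case by simp
  next
    case (Cons z zs z' zs')
    obtain d w d' where z: "z = (d, w)" "z' = (d', w)" "even (d - d')" using Cons(1) by (cases z; cases z') auto
    have 1: "plug n g (\<lambda>ys. h (z # ys)) zs = plug n' g' (\<lambda>ys. h' (z' # ys)) zs'"
      using Cons z by (intro Cons.IH) auto
    have 2: "plug (n + d) (\<lambda>ys. g (z # ys)) h zs = plug (n' + d') (\<lambda>ys. g' (z' # ys)) h' zs'"
      using Cons z by (intro Cons.IH) auto
    have "g [z] = g' [z']" using z by (intro Cons.prems) auto
    then have 3: "h ((n + d, g [z]) # zs) = h' ((n' + d', g' [z']) # zs')"
      using z Cons.hyps Cons.prems(1) by (intro Cons.prems) auto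
    have "even (n * d) \<longleftrightarrow> even (n' * d')" using Cons.prems(1) z(3) by auto
    then show ?case using 1 2 3 z by (simp add: sg_def)
  qed
  from this[of _ _ n n g g h h] assms show ?thesis
    unfolding parity_invariant_def by auto
qed

text \<open>\<open>p True\<close> and \<open>p False\<close> are meant as the even and odd
  projections, with the labels 0 and 1 representing the two parities. A list of length n contributes
  2^n terms.\<close>

primrec parity_ext :: "(bool \<Rightarrow> 'w \<Rightarrow> 'w) \<Rightarrow> ((int \<times> 'w) list \<Rightarrow> 'a::ab_group_add) \<Rightarrow> 'w list \<Rightarrow> 'a" where
  "parity_ext p Q [] = Q []"
| "parity_ext p Q (v # vs) = parity_ext p (\<lambda>zs. Q ((0, p True v) # zs)) vs +
     parity_ext p (\<lambda>zs. Q ((1, p False v) # zs)) vs"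

lemma parity_ext_0: "parity_ext p (\<lambda>zs. 0) vs = 0"
  by (induction vs) auto

lemma linear_parity_ext_outer:
  "(\<And>zs. Vector_Spaces.linear s s' (\<lambda>w. Q w zs)) \<Longrightarrow> Vector_Spaces.linear s s' (\<lambda>w. parity_ext p (Q w) vs)"
  by (induction vs arbitrary: Q) (auto intro!: linear_plus)

lemma linear_parity_ext:
  assumes "\<And>b. Vector_Spaces.linear s s (p b)" "dmultilinear s s' Q"
  shows "Vector_Spaces.linear s s' (\<lambda>w. parity_ext p Q (us @ w # vs))"
  using assms(2)
proof (induction us arbitrary: Q)
  case Nil
  have "Vector_Spaces.linear s s' (\<lambda>w. Q ((d, p b w) # zs))" for d b zs
    by (rule linear_comp[OF assms(1) dmultilinear_hd[OF Nil]])
  then show ?case by (auto intro!: linear_plus linear_parity_ext_outer)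
qed (auto intro!: linear_plus dmultilinear_Cons)

text \<open>On a homogeneous argument one of the two projections is 0 and its term vanishes by
  linearity; in the other term the label 0 or 1 may be replaced by the true degree, since
  \<open>Q\<close> sees parities only.\<close>

lemma parity_ext_eq:
  assumes "dmultilinear s s' Q" "parity_invariant Q" "hom_list W zs"
    and p: "\<And>b d v. v \<in> W d \<Longrightarrow> p b v = (if even d = b then v else 0)"
  shows "parity_ext p Q (map snd zs) = Q zs"
  using assms(1-3)
proof (induction zs arbitrary: Q)
  case (Cons z zs)
  obtain d w where z: "z = (d, w)" by fastforce
  have 0: "Q ((e, 0) # ys) = 0" for e ys using lin_zero[OF dmultilinear_hd[OF Cons.prems(1)]] .
  have IH: "parity_ext p (\<lambda>zs. Q (y # zs)) (map snd zs) = Q (y # zs)" for y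
    using Cons by (auto intro!: Cons.IH dmultilinear_Cons parity_invariant_Cons)
  have parity: "Q ((e, w) # zs) = Q ((d, w) # zs)" if "even (e - d)" for e
    using that by (intro parity_invariantD[OF Cons.prems(2)]) (simp add: list.rel_refl)
  show ?case
  proof (cases "even d")
    case True
    with Cons.prems(3) parity[of 0] z show ?thesis by (simp add: p[of w d] 0 IH parity_ext_0)
  next
    case False
    with Cons.prems(3) parity[of 1] z show ?thesis by (simp add: p[of w d] 0 IH parity_ext_0)
  qed
qed simp

section \<open>Homogeneous components, projections and the extension in a graded space\<close>

context graded_vector_space
begin

definition components :: "'v \<Rightarrow> int \<Rightarrow> 'v" where
  "components v = (THE c. (\<forall>n. c n \<in> V n) \<and> finite {n. c n \<noteq> 0} \<and> v = (\<Sum>n | c n \<noteq> 0. c n))"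

lemma components: "components v n \<in> V n" "finite {n. components v n \<noteq> 0}"
    "v = (\<Sum>n | components v n \<noteq> 0. components v n)"
  using theI'[OF direct_sum[of v]] unfolding components_def[symmetric] by auto

lemma components_eqI:
  assumes "\<And>n. c n \<in> V n" "finite A" "\<And>n. n \<notin> A \<Longrightarrow> c n = 0" "v = (\<Sum>n\<in>A. c n)"
  shows "components v = c"
proof -
  have "{n. c n \<noteq> 0} \<subseteq> A" using assms(3) by auto
  then have "(\<Sum>n | c n \<noteq> 0. c n) = v" "finite {n. c n \<noteq> 0}"
    using assms(2,4) by (auto intro!: sum.mono_neutral_left intro: finite_subset)
  then show ?thesis unfolding components_def
    using direct_sum[of v] assms(1) by (intro the1_equality) auto
qed

lemma sum_components: "finite A \<Longrightarrow> {n. components v n \<noteq> 0} \<subseteq> A \<Longrightarrow> (\<Sum>n\<in>A. components v n) = v"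
  by (subst (2) components(3), rule sum.mono_neutral_right) auto

lemma components_add: "components (u + v) = (\<lambda>n. components u n + components v n)"
proof (rule components_eqI)
  let ?A = "{n. components u n \<noteq> 0} \<union> {n. components v n \<noteq> 0}"
  show "finite ?A" using components(2) by auto
  then show "u + v = (\<Sum>n\<in>?A. components u n + components v n)"
    by (simp add: sum.distrib sum_components)
qed (auto intro: subspace_add[OF subspace_grading] components(1))

lemma components_scale: "components (scale c v) = (\<lambda>n. scale c (components v n))"
proof (rule components_eqI)
  show "scale c v = (\<Sum>n | components v n \<noteq> 0. scale c (components v n))"
    by (simp add: sum_components components(2) flip: scale_sum_right)
qed (auto intro: subspace_scale[OF subspace_grading] components)

lemma components_homogeneous: "v \<in> V n \<Longrightarrow> components v = (\<lambda>m. if m = n then v else 0)"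
  by (rule components_eqI[of _ "{n}"]) (auto intro: subspace_0[OF subspace_grading])

text \<open>The projection onto the sum of the components with index in \<open>S\<close>; it serves
  for the even part, the odd part and single degrees.\<close>

definition part :: "int set \<Rightarrow> 'v \<Rightarrow> 'v" where
  "part S v = (\<Sum>n\<in>{n. components v n \<noteq> 0} \<inter> S. components v n)"

lemma part_eq: "finite A \<Longrightarrow> {n. components v n \<noteq> 0} \<subseteq> A \<Longrightarrow> part S v = (\<Sum>n\<in>A \<inter> S. components v n)"
  unfolding part_def by (rule sum.mono_neutral_left) auto

lemma linear_part: "Vector_Spaces.linear scale scale (part S)"
  unfolding Vector_Spaces.linear_iff
proof (intro conjI allI)
  fix u v
  let ?A = "{n. components u n \<noteq> 0} \<union> {n. components v n \<noteq> 0}"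
  have A: "finite ?A" using components(2) by auto
  have sub: "{n. components (u + v) n \<noteq> 0} \<subseteq> ?A" by (auto simp: components_add)
  show "part S (u + v) = part S u + part S v"
    using part_eq[OF A sub, of S] part_eq[OF A, of u S] part_eq[OF A, of v S]
    by (simp add: components_add sum.distrib)
next
  fix c v
  have "{n. components (scale c v) n \<noteq> 0} \<subseteq> {n. components v n \<noteq> 0}" by (auto simp: components_scale)
  from part_eq[OF components(2) this] show "part S (scale c v) = scale c (part S v)"
    by (simp add: part_def components_scale scale_sum_right)
qed (rule vector_space_axioms)+

lemma part_homogeneous: "v \<in> V n \<Longrightarrow> part S v = (if n \<in> S then v else 0)"
  by (subst part_eq[of "{n}"]) (auto simp: components_homogeneous)

lemma homogeneous_induct [case_names zero homogeneous add]:
  assumes "P 0" "\<And>n v. v \<in> V n \<Longrightarrow> P v" "\<And>u v. P u \<Longrightarrow> P v \<Longrightarrow> P (u + v)"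
  shows "P v"
proof -
  have "P (\<Sum>n\<in>A. components v n)" if "finite A" for A
    using that by induction (auto intro: assms components(1))
  then show ?thesis using sum_components[of _ v] components(2)[of v] by fastforce
qed

lemma dmultilinear_multilinear:
  "multilinear scale f \<Longrightarrow> dmultilinear scale scale (\<lambda>zs. f (map snd zs))"
  by (simp add: multilinear_def dmultilinear_def)

lemma linear_eq_homogeneous:
  assumes "Vector_Spaces.linear scale s' f" "Vector_Spaces.linear scale s' g"
    and "\<And>n v. v \<in> V n \<Longrightarrow> f v = g v"
  shows "f v = g v"
  by (induction v rule: homogeneous_induct) (simp_all add: assms lin_add[OF assms(1)] lin_add[OF assms(2)]
    lin_zero[OF assms(1)] lin_zero[OF assms(2)])

lemma slotwise_linear_eq_homogeneous:
  assumes "\<And>us vs. Vector_Spaces.linear scale s' (\<lambda>w. f (us @ w # vs))"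
    and "\<And>us vs. Vector_Spaces.linear scale s' (\<lambda>w. g (us @ w # vs))"
    and eq: "\<And>zs. hom_list V zs \<Longrightarrow> f (map snd zs) = g (map snd zs)"
  shows "f = g"
proof
  \<comment> \<open>\<open>zs\<close> holds homogeneous arguments and \<open>vs\<close> arbitrary
    ones; linearity in one slot moves an argument from \<open>vs\<close> to \<open>zs\<close> in
    each induction step.\<close>
  have "f (map snd zs @ vs) = g (map snd zs @ vs)" if "hom_list V zs" for zs vs
    using that
  proof (induction vs arbitrary: zs)
    case Nil
    then show ?case using eq[of zs] by simp
  next
    case (Cons v vs)
    show ?case
    proof (rule linear_eq_homogeneous[OF assms(1,2)])
      fix n w assume "w \<in> V n"
      then show "f (map snd zs @ w # vs) = g (map snd zs @ w # vs)"
        using Cons.IH[of "zs @ [(n, w)]"] Cons.prems by simp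
    qed
  qed
  from this[of "[]"] show "f vs = g vs" for vs by simp
qed

lemma multilinear_eq_homogeneous:
  assumes "multilinear scale f" "multilinear scale g"
    and eq: "\<And>zs. hom_list V zs \<Longrightarrow> zs \<noteq> [] \<Longrightarrow> f (map snd zs) = g (map snd zs)"
  shows "f = g"
proof (rule slotwise_linear_eq_homogeneous)
  fix zs assume "hom_list V zs"
  then show "f (map snd zs) = g (map snd zs)"
    using eq assms(1,2) by (cases "zs = []") (auto simp: multilinear_def)
qed (use assms(1,2) in \<open>auto simp: multilinear_def\<close>)

definition extension :: "((int \<times> 'v) list \<Rightarrow> 'c) \<Rightarrow> 'v list \<Rightarrow> 'c::ab_group_add" where
  "extension = parity_ext (\<lambda>b. part {n. even n = b})"

lemma linear_extension:
  "dmultilinear scale s' Q \<Longrightarrow> Vector_Spaces.linear scale s' (\<lambda>w. extension Q (us @ w # vs))"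
  unfolding extension_def by (rule linear_parity_ext) (rule linear_part)

lemma extension_eq:
  "\<lbrakk>dmultilinear scale s' Q; parity_invariant Q; hom_list V zs\<rbrakk> \<Longrightarrow> extension Q (map snd zs) = Q zs"
  unfolding extension_def by (rule parity_ext_eq[where W = V]) (auto simp: part_homogeneous)

end

section \<open>Unshuffles\<close>

text \<open>
  A signed sum over the ways to split a list into two sublists; the sign is that of moving the second
  sublist, followed by an operation of degree \<open>n\<close>, to the right of the first.
\<close>

fun split_sum :: "int \<Rightarrow> ((int \<times> 'w) list \<Rightarrow> (int \<times> 'w) list \<Rightarrow> 'a) \<Rightarrow> (int \<times> 'w) list \<Rightarrow> 'a::ab_group_add" where
  "split_sum n \<Phi> [] = \<Phi> [] []"
| "split_sum n \<Phi> (z # zs) =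
     sg (n * fst z) (split_sum n (\<lambda>us vs. \<Phi> (z # us) vs) zs) + split_sum (n + fst z) (\<lambda>us vs. \<Phi> us (z # vs)) zs"

text \<open>\<open>c\<close> is the position of the last argument of the inner map: whatever follows
  is untouched, and the arguments before it are split into those left outside and those entering
  \<open>g\<close>.\<close>

lemma plug_eq_sum_split_sum:
  "plug n g h zs = (\<Sum>c<length zs.
     split_sum n (\<lambda>us vs. h (us @ (n + total vs + fst (zs ! c), g (vs @ [zs ! c])) # drop (Suc c) zs)) (take c zs))"
proof (induction zs arbitrary: n g h)
  case (Cons z zs)
  obtain d w where z: "z = (d, w)" by fastforce
  show ?case
    unfolding z by (simp add: sum.lessThan_Suc_shift Cons.IH sum.distrib sg_sum ac_simps del: sum.lessThan_Suc)
qed simp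

text \<open>The final argument cannot be an earlier argument of \<open>g\<close>, since the last
  argument of \<open>g\<close> would have to follow it; so it stays outside or is that last
  argument.\<close>

lemma plug_snoc:
  "plug n g h (zs @ [z]) = plug n g (\<lambda>ys. h (ys @ [z])) zs +
     split_sum n (\<lambda>us vs. h (us @ [(n + total vs + fst z, g (vs @ [z]))])) zs"
  unfolding plug_eq_sum_split_sum by (simp add: nth_append)

text \<open>\<open>S\<close> is the set of positions going to the second sublist. Each remaining
  position \<open>t\<close> is passed by the operation of degree \<open>n\<close> and by the chosen
  entries to its left.\<close>

definition split_exponent :: "int \<Rightarrow> nat set \<Rightarrow> int list \<Rightarrow> int" where
  "split_exponent n S ds =
     (\<Sum>t<length ds. if t \<in> S then 0 else ds ! t * (n + (\<Sum>s<t. if s \<in> S then ds ! s else 0)))"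

lemma split_exponent_Cons:
  "split_exponent n (Suc ` S) (d # ds) = n * d + split_exponent n S ds"
  "split_exponent n (insert 0 (Suc ` S)) (d # ds) = split_exponent (n + d) S ds"
  unfolding split_exponent_def
  by (simp_all add: sum.lessThan_Suc_shift image_iff algebra_simps del: sum.lessThan_Suc cong: if_cong)

lemma nths_Cons_image:
  "nths (z # zs) (Suc ` S) = nths zs S" "nths (z # zs) (insert 0 (Suc ` S)) = z # nths zs S"
  "nths (z # zs) (- Suc ` S) = z # nths zs (- S)" "nths (z # zs) (- insert 0 (Suc ` S)) = nths zs (- S)"
proof -
  have "{j. Suc j \<in> Suc ` S} = S" "{j. Suc j \<in> insert 0 (Suc ` S)} = S"
    "{j. Suc j \<in> - Suc ` S} = - S" "{j. Suc j \<in> - insert 0 (Suc ` S)} = - S" by auto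
  then show "nths (z # zs) (Suc ` S) = nths zs S" "nths (z # zs) (insert 0 (Suc ` S)) = z # nths zs S"
    "nths (z # zs) (- Suc ` S) = z # nths zs (- S)" "nths (z # zs) (- insert 0 (Suc ` S)) = nths zs (- S)"
    by (simp_all only: nths_Cons) auto
qed

lemma sum_Pow_Suc:
  fixes F :: "nat set \<Rightarrow> 'a::comm_monoid_add"
  shows "(\<Sum>S\<in>Pow {..<Suc c}. F S) = (\<Sum>S\<in>Pow {..<c}. F (Suc ` S)) + (\<Sum>S\<in>Pow {..<c}. F (insert 0 (Suc ` S)))"
proof -
  let ?P = "(`) Suc ` Pow {..<c}" and ?Q = "(\<lambda>S. insert 0 (Suc ` S)) ` Pow {..<c}"
  have inj: "inj_on ((`) Suc) (Pow {..<c})" "inj_on (\<lambda>S. insert 0 (Suc ` S)) (Pow {..<c})"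
    by (auto simp: inj_on_def inj_image_eq_iff insert_ident)
  have "Pow {..<Suc c} = Pow (insert 0 (Suc ` {..<c}))" by (simp add: lessThan_Suc_eq_insert_0)
  also have "\<dots> = ?P \<union> ?Q" unfolding Pow_insert image_Pow_surj[OF refl, symmetric] image_image ..
  finally have "(\<Sum>S\<in>Pow {..<Suc c}. F S) = sum F ?P + sum F ?Q"
    by (simp only:) (rule sum.union_disjoint; auto)
  then show ?thesis by (simp add: sum.reindex inj)
qed

lemma split_sum_eq_sum_Pow:
  "split_sum n \<Phi> zs =
     (\<Sum>S\<in>Pow {..<length zs}. sg (split_exponent n S (map fst zs)) (\<Phi> (nths zs (- S)) (nths zs S)))"
proof (induction zs arbitrary: n \<Phi>)
  case Nil
  then show ?case by (simp add: split_exponent_def)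
next
  case (Cons z zs)
  show ?case
    unfolding split_sum.simps Cons.IH length_Cons sum_Pow_Suc
    by (simp add: split_exponent_Cons nths_Cons_image sg_sum sg_sg mult.commute)
qed

lemma nths_conv_filter: "nths xs A = map ((!) xs) (filter (\<lambda>i. i \<in> A) [0..<length xs])"
proof (induction xs rule: rev_induct)
  case (snoc x xs)
  then show ?case by (auto simp: nths_append nth_append)
qed simp

text \<open>A strictly increasing list is determined by its set of entries; hence the image of the
  second block determines both blocks of an unshuffle.\<close>

lemma unshuffle_filter:
  assumes "\<sigma> \<in> unshuffles a b"
  shows "map \<sigma> [a..<a + b] = filter (\<lambda>i. i \<in> \<sigma> ` {a..<a + b}) [0..<a + b]"
    and "map \<sigma> [0..<a] = filter (\<lambda>i. i \<in> - \<sigma> ` {a..<a + b}) [0..<a + b]"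
proof -
  have perm: "\<sigma> permutes {..<a + b}"
    and mono: "strict_mono_on {..<a} \<sigma>" "strict_mono_on {a..<a + b} \<sigma>"
    using assms by (auto simp: unshuffles_def)
  have inj: "inj \<sigma>" and img: "\<sigma> ` {..<a + b} = {..<a + b}"
    using perm by (auto simp: permutes_inj permutes_image)
  have sorted: "sorted_wrt (<) (map \<sigma> [l..<u])" if "strict_mono_on {l..<u} \<sigma>" for l u
    using that by (auto simp: sorted_wrt_map strict_mono_on_def intro: sorted_wrt_mono_rel[OF _ sorted_wrt_upt])
  have filter: "sorted_wrt (<) (filter P [0..<a + b])" for P by (rule sorted_wrt_filter) simp
  have eq: "xs = ys" if "sorted_wrt (<) xs" "sorted_wrt (<) ys" "set xs = set ys" for xs ys :: "nat list"
    using that by (intro sorted_distinct_set_unique) (auto simp: strict_sorted_iff)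
  show "map \<sigma> [a..<a + b] = filter (\<lambda>i. i \<in> \<sigma> ` {a..<a + b}) [0..<a + b]"
    using img by (intro eq sorted mono filter) auto
  have "\<sigma> ` {0..<a} = \<sigma> ` ({..<a + b} - {a..<a + b})" by (rule arg_cong[of _ _ "image \<sigma>"]) auto
  also have "\<dots> = {..<a + b} - \<sigma> ` {a..<a + b}" by (simp add: image_set_diff[OF inj] img)
  finally show "map \<sigma> [0..<a] = filter (\<lambda>i. i \<in> - \<sigma> ` {a..<a + b}) [0..<a + b]"
    using mono(1) by (intro eq sorted filter) (auto simp: atLeast0LessThan)
qed

lemma unshuffle_nths:
  assumes "\<sigma> \<in> unshuffles a b" "length xs = a + b"
  shows "map (\<lambda>l. xs ! \<sigma> l) [a..<a + b] = nths xs (\<sigma> ` {a..<a + b})"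
    and "map (\<lambda>l. xs ! \<sigma> l) [0..<a] = nths xs (- \<sigma> ` {a..<a + b})"
  unfolding nths_conv_filter assms(2) unshuffle_filter[OF assms(1), symmetric] by simp_all

lemma bij_betw_unshuffles:
  "bij_betw (\<lambda>\<sigma>. \<sigma> ` {a..<a + b}) (unshuffles a b) {S \<in> Pow {..<a + b}. card S = b}"
proof (rule bij_betw_imageI)
  show "inj_on (\<lambda>\<sigma>. \<sigma> ` {a..<a + b}) (unshuffles a b)"
  proof (rule inj_onI)
    fix \<sigma> \<tau> assume *: "\<sigma> \<in> unshuffles a b" "\<tau> \<in> unshuffles a b" "\<sigma> ` {a..<a + b} = \<tau> ` {a..<a + b}"
    then have "map \<sigma> [a..<a + b] = map \<tau> [a..<a + b]" "map \<sigma> [0..<a] = map \<tau> [0..<a]"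
      by (simp_all only: unshuffle_filter)
    then have "\<sigma> i = \<tau> i" if "i < a + b" for i using that by (cases "i < a") auto
    moreover have "\<sigma> i = \<tau> i" if "\<not> i < a + b" for i
      using that *(1,2) by (auto simp: unshuffles_def permutes_not_in)
    ultimately show "\<sigma> = \<tau>" by blast
  qed
  show "(\<lambda>\<sigma>. \<sigma> ` {a..<a + b}) ` unshuffles a b = {S \<in> Pow {..<a + b}. card S = b}"
  proof (intro equalityI subsetI)
    fix S assume "S \<in> (\<lambda>\<sigma>. \<sigma> ` {a..<a + b}) ` unshuffles a b"
    then obtain \<sigma> where \<sigma>: "\<sigma> permutes {..<a + b}" "S = \<sigma> ` {a..<a + b}" by (auto simp: unshuffles_def)
    have "S \<subseteq> \<sigma> ` {..<a + b}" unfolding \<sigma>(2) by (rule image_mono) auto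
    moreover have "card S = b" unfolding \<sigma>(2) by (simp add: card_image permutes_inj_on[OF \<sigma>(1)])
    ultimately show "S \<in> {S \<in> Pow {..<a + b}. card S = b}" by (simp add: permutes_image[OF \<sigma>(1)])
  next
    fix S assume "S \<in> {S \<in> Pow {..<a + b}. card S = b}"
    then have S: "S \<subseteq> {..<a + b}" "card S = b" by auto
    \<comment> \<open>The inverse map: \<open>M\<close> enumerates the complement of
      \<open>S\<close> increasingly and then \<open>S\<close>; reading it off gives the unshuffle,
      continued by the identity from \<open>a + b\<close> on.\<close>
    define L where "L A = filter (\<lambda>i. i \<in> A) [0..<a + b]" for A
    define M where "M = L (- S) @ L S"
    define \<sigma> where "\<sigma> i = (if i < a + b then M ! i else i)" for i
    have "set (L S) = S" "distinct (L A)" for A using S by (auto simp: L_def)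
    then have len: "length (L S) = b" using S by (metis distinct_card)
    have "length (L S) + length (L (- S)) = a + b"
      using sum_length_filter_compl[of "\<lambda>i. i \<in> S" "[0..<a + b]"] by (simp add: L_def)
    with len have len': "length (L (- S)) = a" by simp
    have M: "distinct M" "set M = {..<a + b}" "length M = a + b"
      using len len' by (auto simp: M_def L_def)
    have "bij_betw \<sigma> {..<a + b} {..<a + b} \<longleftrightarrow> bij_betw ((!) M) {..<a + b} {..<a + b}"
      by (rule bij_betw_cong) (simp add: \<sigma>_def)
    then have "bij_betw \<sigma> {..<a + b} {..<a + b}" using bij_betw_nth[OF M(1), of "{..<a + b}"] M by simp
    then have "\<sigma> permutes {..<a + b}" by (rule bij_imp_permutes) (simp add: \<sigma>_def)
    moreover have sorted: "sorted_wrt (<) (L A)" for A unfolding L_def by (rule sorted_wrt_filter) simp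
    have "strict_mono_on {..<a} \<sigma>"
      using sorted[of "- S"] len' by (auto simp: strict_mono_on_def \<sigma>_def M_def nth_append sorted_wrt_iff_nth_less)
    moreover have "strict_mono_on {a..<a + b} \<sigma>"
      using sorted[of S] len len' by (auto simp: strict_mono_on_def \<sigma>_def M_def nth_append sorted_wrt_iff_nth_less)
    ultimately have unsh: "\<sigma> \<in> unshuffles a b" by (simp add: unshuffles_def)
    have "map \<sigma> [a..<a + b] = L S"
      using len len' by (intro nth_equalityI) (auto simp: \<sigma>_def M_def nth_append)
    then have "\<sigma> ` {a..<a + b} = S"
      by (metis \<open>set (L S) = S\<close> set_map set_upt)
    with unsh show "S \<in> (\<lambda>\<sigma>. \<sigma> ` {a..<a + b}) ` unshuffles a b" by blast
  qed
qed

text \<open>An inversion of an unshuffle pairs a position of the first block with one of the second.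
  Under \<open>\<sigma>\<close> these become the pairs \<open>s < t\<close> with \<open>s\<close>
  chosen and \<open>t\<close> not, whose degree products make up
  \<open>split_exponent\<close>.\<close>

lemma split_exponent_unshuffle:
  assumes \<sigma>: "\<sigma> \<in> unshuffles a b" and len: "length ds = a + b"
  shows "split_exponent n (\<sigma> ` {a..<a + b}) ds = n * (\<Sum>l<a. ds ! \<sigma> l) + koszul_exponent (a + b) \<sigma> ds"
proof -
  let ?S = "\<sigma> ` {a..<a + b}"
  have perm: "\<sigma> permutes {..<a + b}"
    and mono: "strict_mono_on {..<a} \<sigma>" "strict_mono_on {a..<a + b} \<sigma>"
    using \<sigma> by (auto simp: unshuffles_def)
  have inj: "\<sigma> x = \<sigma> y \<longleftrightarrow> x = y" for x y using permutes_inj[OF perm] by (auto dest: injD)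
  have lt: "\<sigma> x < a + b \<longleftrightarrow> x < a + b" for x using permutes_in_image[OF perm] by simp
  have mem: "\<sigma> x \<in> ?S \<longleftrightarrow> a \<le> x \<and> x < a + b" for x by (auto simp: inj)
  have ex: "\<exists>x<a + b. t = \<sigma> x" if "t < a + b" for t
    using permutes_image[OF perm] that by (metis image_iff lessThan_iff)
  have "\<sigma> ` {..<a} = \<sigma> ` ({..<a + b} - {a..<a + b})" by (rule arg_cong[of _ _ "image \<sigma>"]) auto
  then have img: "\<sigma> ` {..<a} = {..<a + b} - ?S"
    by (simp add: image_set_diff[OF permutes_inj[OF perm]] permutes_image[OF perm])
  have "(\<Sum>l<a. ds ! \<sigma> l) = (\<Sum>t\<in>{..<a + b} - ?S. ds ! t)"
    by (subst img[symmetric]) (simp add: sum.reindex permutes_inj_on[OF perm])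
  moreover have "koszul_exponent (a + b) \<sigma> ds = (\<Sum>(t, s)\<in>(SIGMA t:{..<a + b} - ?S. {..<t} \<inter> ?S). ds ! t * ds ! s)"
    unfolding koszul_exponent_def
  proof (rule sum.reindex_bij_witness[of _ "\<lambda>(t, s). (inv \<sigma> t, inv \<sigma> s)" "\<lambda>(p, q). (\<sigma> p, \<sigma> q)"])
    fix x assume "x \<in> {(p, q). p < q \<and> q < a + b \<and> \<sigma> p > \<sigma> q}"
    then obtain p q where x: "x = (p, q)" "p < q" "q < a + b" "\<sigma> q < \<sigma> p" by auto
    have "p < a"
      using strict_mono_onD[OF mono(2), of p q] x by fastforce
    moreover have "a \<le> q"
      using strict_mono_onD[OF mono(1), of p q] x by fastforce
    ultimately have "p < a" "a \<le> q" by simp_all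
    with x show "(case x of (p, q) \<Rightarrow> (\<sigma> p, \<sigma> q)) \<in> (SIGMA t:{..<a + b} - ?S. {..<t} \<inter> ?S)"
      by (simp add: lt mem)
  next
    fix x assume "x \<in> (SIGMA t:{..<a + b} - ?S. {..<t} \<inter> ?S)"
    then obtain t s where ts: "x = (t, s)" "t < a + b" "t \<notin> ?S" "s < t" "s \<in> ?S" by blast
    moreover from ts obtain p q where "t = \<sigma> p" "s = \<sigma> q" "p < a + b"
      using ex[of t] ex[of s] by (meson order_less_trans)
    ultimately have x: "x = (\<sigma> p, \<sigma> q)" "p < a + b" "\<sigma> p \<notin> ?S" "\<sigma> q < \<sigma> p" "\<sigma> q \<in> ?S" by simp_all
    then show "(case x of (t, s) \<Rightarrow> (inv \<sigma> t, inv \<sigma> s)) \<in> {(p, q). p < q \<and> q < a + b \<and> \<sigma> p > \<sigma> q}"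
      by (simp add: permutes_inverses[OF perm] mem)
    show "(case case x of (t, s) \<Rightarrow> (inv \<sigma> t, inv \<sigma> s) of (p, q) \<Rightarrow> (\<sigma> p, \<sigma> q)) = x"
      using x by (simp add: permutes_inverses[OF perm])
  qed (auto simp: permutes_inverses[OF perm])
  ultimately show ?thesis
    by (simp add: split_exponent_def len sum.If_cases sum.Sigma[symmetric] distrib_left sum.distrib
      sum_distrib_left mult.commute Diff_eq)
qed

text \<open>The sets of positions chosen for the second sublist are grouped by cardinality
  \<open>b\<close>, and each group is indexed by unshuffles.\<close>

lemma split_sum_eq_sum_unshuffles:
  "split_sum n \<Phi> zs = (\<Sum>b\<le>length zs. \<Sum>\<sigma>\<in>unshuffles (length zs - b) b.
     sg (n * (\<Sum>l<length zs - b. map fst zs ! \<sigma> l) + koszul_exponent (length zs) \<sigma> (map fst zs))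
       (\<Phi> (map (\<lambda>l. zs ! \<sigma> l) [0..<length zs - b]) (map (\<lambda>l. zs ! \<sigma> l) [length zs - b..<length zs])))"
proof -
  let ?c = "length zs"
  let ?F = "\<lambda>S. sg (split_exponent n S (map fst zs)) (\<Phi> (nths zs (- S)) (nths zs S))"
  have "split_sum n \<Phi> zs = (\<Sum>b\<le>?c. sum ?F {S \<in> Pow {..<?c}. card S = b})"
    unfolding split_sum_eq_sum_Pow
    by (rule sum.group[symmetric]) (use card_mono[of "{..<?c}"] in auto)
  also have "\<dots> = (\<Sum>b\<le>?c. \<Sum>\<sigma>\<in>unshuffles (?c - b) b. ?F (\<sigma> ` {?c - b..<?c}))"
  proof (intro sum.cong refl)
    fix b assume "b \<in> {..?c}"
    then show "sum ?F {S \<in> Pow {..<?c}. card S = b} = (\<Sum>\<sigma>\<in>unshuffles (?c - b) b. ?F (\<sigma> ` {?c - b..<?c}))"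
      using sum.reindex_bij_betw[OF bij_betw_unshuffles[of "?c - b" b], of ?F] by simp
  qed
  also have "\<dots> = (\<Sum>b\<le>length zs. \<Sum>\<sigma>\<in>unshuffles (length zs - b) b.
     sg (n * (\<Sum>l<length zs - b. map fst zs ! \<sigma> l) + koszul_exponent (length zs) \<sigma> (map fst zs))
       (\<Phi> (map (\<lambda>l. zs ! \<sigma> l) [0..<length zs - b]) (map (\<lambda>l. zs ! \<sigma> l) [length zs - b..<length zs])))"
  proof (intro sum.cong refl)
    fix b \<sigma> assume "b \<in> {..?c}" "\<sigma> \<in> unshuffles (?c - b) b"
    then show "?F (\<sigma> ` {?c - b..<?c}) =
     sg (n * (\<Sum>l<length zs - b. map fst zs ! \<sigma> l) + koszul_exponent (length zs) \<sigma> (map fst zs))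
       (\<Phi> (map (\<lambda>l. zs ! \<sigma> l) [0..<length zs - b]) (map (\<lambda>l. zs ! \<sigma> l) [length zs - b..<length zs]))"
      using split_exponent_unshuffle[of \<sigma> "?c - b" b "map fst zs" n] unshuffle_nths[of \<sigma> "?c - b" b zs]
      by simp
  qed
  finally show ?thesis .
qed

lemma (in vector_space) sum_insertion_eq_plug:
  "(\<Sum>(i, j) | 1 \<le> i \<and> 1 \<le> j \<and> i + j = length zs + 1.
      \<Sum>k = 1..i. insertion scale n f g k j (map fst zs) (map snd zs)) =
    plug n (\<lambda>ys. g (map snd ys)) (\<lambda>ys. f (map snd ys)) zs"
proof -
  let ?N = "length zs"
  let ?I = "\<lambda>k j. insertion scale n f g k j (map fst zs) (map snd zs)"
  let ?J = "{(i, j). 1 \<le> i \<and> 1 \<le> j \<and> i + j = ?N + 1}"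
  have fin: "finite ?J" by (rule finite_subset[of _ "{..?N + 1} \<times> {..?N + 1}"]) auto
  have "(\<Sum>(i, j)\<in>?J. \<Sum>k = 1..i. ?I k j) = (\<Sum>(x, k)\<in>(SIGMA x:?J. {1..fst x}). ?I k (snd x))"
    using fin by (subst sum.Sigma[symmetric]) (auto simp: split_beta)
  \<comment> \<open>Here \<open>c = k + j - 2\<close> is the zero-based position of the last
    argument of \<open>g\<close> and \<open>b = j - 1\<close> the number of its earlier arguments;
    then \<open>i = ?N - b\<close>.\<close>
  also have "\<dots> = (\<Sum>(c, b)\<in>(SIGMA c:{..<?N}. {..c}). ?I (Suc (c - b)) (Suc b))"
    by (rule sum.reindex_bij_witness[of _ "\<lambda>(c, b). ((?N - b, Suc b), Suc (c - b))"
        "\<lambda>(x, k). (k + snd x - 2, snd x - 1)"]) auto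
  also have "\<dots> = (\<Sum>c<?N. \<Sum>b\<le>c. ?I (Suc (c - b)) (Suc b))"
    by (subst sum.Sigma[symmetric]) auto
  also have "\<dots> = plug n (\<lambda>ys. g (map snd ys)) (\<lambda>ys. f (map snd ys)) zs"
    unfolding plug_eq_sum_split_sum
  proof (intro sum.cong refl)
    fix c assume "c \<in> {..<?N}"
    then have c: "c < ?N" by simp
    show "(\<Sum>b\<le>c. ?I (Suc (c - b)) (Suc b)) = split_sum n (\<lambda>us vs. f (map snd (us @
       (n + total vs + fst (zs ! c), g (map snd (vs @ [zs ! c]))) # drop (Suc c) zs))) (take c zs)"
      unfolding split_sum_eq_sum_unshuffles
    proof (intro sum.cong)
      fix b assume b: "b \<in> {..length (take c zs)}"
      show "?I (Suc (c - b)) (Suc b) = (\<Sum>\<sigma>\<in>unshuffles (length (take c zs) - b) b.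
        sg (n * (\<Sum>l<length (take c zs) - b. map fst (take c zs) ! \<sigma> l) +
            koszul_exponent (length (take c zs)) \<sigma> (map fst (take c zs)))
          (f (map snd (map (\<lambda>l. take c zs ! \<sigma> l) [0..<length (take c zs) - b] @
            (n + total (map (\<lambda>l. take c zs ! \<sigma> l) [length (take c zs) - b..<length (take c zs)]) + fst (zs ! c),
             g (map snd (map (\<lambda>l. take c zs ! \<sigma> l) [length (take c zs) - b..<length (take c zs)] @ [zs ! c]))) #
             drop (Suc c) zs))))"
        unfolding insertion_def scale_powi
      proof (rule sum.cong)
        fix \<sigma> assume "\<sigma> \<in> unshuffles (length (take c zs) - b) b"
        then have "\<sigma> permutes {..<c}" using b c by (simp add: unshuffles_def)
        then have lt: "\<sigma> l < c \<longleftrightarrow> l < c" for l using permutes_in_image by fastforce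
        have lt': "l < c \<Longrightarrow> \<sigma> l < ?N" for l using lt[of l] c by simp
        have 1: "(\<Sum>l<c - b. map fst (take c zs) ! \<sigma> l) = (\<Sum>l<c - b. map fst zs ! \<sigma> l)"
          using c by (intro sum.cong) (auto simp: lt lt')
        have 2: "koszul_exponent c \<sigma> (map fst (take c zs)) = koszul_exponent c \<sigma> (map fst zs)"
          unfolding koszul_exponent_def using c by (intro sum.cong) (auto simp: lt lt')
        have 3: "map snd (map (\<lambda>l. take c zs ! \<sigma> l) [0..<c - b]) = map (\<lambda>l. map snd zs ! \<sigma> l) [0..<c - b]"
          using c by (auto simp: lt lt')
        have 4: "map snd (map (\<lambda>l. take c zs ! \<sigma> l) [c - b..<c]) = map (\<lambda>l. map snd zs ! \<sigma> l) [c - b..<c]"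
          using c by (auto simp: lt lt')
        show "sg (n * (\<Sum>l<Suc (c - b) - 1. map fst zs ! \<sigma> l) + koszul_exponent (Suc (c - b) + Suc b - 2) \<sigma> (map fst zs))
           (f (map (\<lambda>l. map snd zs ! \<sigma> l) [0..<Suc (c - b) - 1] @
              g (map (\<lambda>l. map snd zs ! \<sigma> l) [Suc (c - b) - 1..<Suc (c - b) + Suc b - 2] @
                 [map snd zs ! (Suc (c - b) + Suc b - 2)]) #
              drop (Suc (c - b) + Suc b - 1) (map snd zs))) =
          sg (n * (\<Sum>l<length (take c zs) - b. map fst (take c zs) ! \<sigma> l) +
            koszul_exponent (length (take c zs)) \<sigma> (map fst (take c zs)))
          (f (map snd (map (\<lambda>l. take c zs ! \<sigma> l) [0..<length (take c zs) - b] @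
            (n + total (map (\<lambda>l. take c zs ! \<sigma> l) [length (take c zs) - b..<length (take c zs)]) + fst (zs ! c),
             g (map snd (map (\<lambda>l. take c zs ! \<sigma> l) [length (take c zs) - b..<length (take c zs)] @ [zs ! c]))) #
             drop (Suc c) zs)))"
          using b c by (simp add: 1 2 3 4 drop_map del: map_map)
      qed (use c in simp)
    qed (use c in simp)
  qed
  finally show ?thesis .
qed

section \<open>The graded Lie algebra of the Balavoine bracket\<close>

lemma plug_inner_scale:
  assumes "dmultilinear s s' h"
  shows "plug n (\<lambda>ys. s c (g ys)) h zs = s' c (plug n g h zs)"
proof -
  have "Vector_Spaces.linear s s' (\<lambda>w. h ((0, w) # []))" by (rule dmultilinear_hd[OF assms])
  then interpret S: vector_space s' by (simp add: Vector_Spaces.linear_iff)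
  have sg: "sg k (s' c v) = s' c (sg k v)" for k v by (simp add: sg_def)
  show ?thesis using assms
    by (induction n g h zs rule: plug.induct)
      (simp_all add: S.scale_right_distrib sg dmultilinear_Cons lin_scale[OF dmultilinear_hd])
qed

lemma vector_space_fun: "vector_space s \<Longrightarrow> vector_space (\<lambda>c F x. s c (F x))"
  by (simp add: vector_space_def fun_eq_iff)

lemma (in graded_vector_space) CL_iff:
  "f \<in> CL scale V m \<longleftrightarrow> multilinear scale f \<and>
     (\<forall>zs. hom_list V zs \<longrightarrow> zs \<noteq> [] \<longrightarrow> f (map snd zs) \<in> V (total zs + m))"
  unfolding CL_def homogeneous_iff total_def by auto

lemma multilinear_add: "multilinear s f \<Longrightarrow> multilinear s g \<Longrightarrow> multilinear s (f + g)"
  by (auto simp: multilinear_def linear_plus)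

lemma multilinear_sg: "multilinear s f \<Longrightarrow> multilinear s (sg k f)"
  by (auto simp: multilinear_def sg_fun linear_sg)

lemma multilinear_diff: "multilinear s f \<Longrightarrow> multilinear s g \<Longrightarrow> multilinear s (f - g)"
  using multilinear_add[OF _ multilinear_sg[where k = 1], of s f g] by (simp add: sg_def)

lemma multilinear_scale: "multilinear s f \<Longrightarrow> multilinear s (\<lambda>vs. s c (f vs))"
  unfolding multilinear_def Vector_Spaces.linear_iff
  by (auto simp: vector_space.vector_space_assms module.scale_zero_right module_iff_vector_space mult.commute)

context graded_vector_space
begin

lemma CL_multilinear: "f \<in> CL scale V m \<Longrightarrow> multilinear scale f"
  and CL_dmultilinear: "f \<in> CL scale V m \<Longrightarrow> dmultilinear scale scale (\<lambda>zs. f (map snd zs))"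
  and CL_degree: "f \<in> CL scale V m \<Longrightarrow> hom_list V zs \<Longrightarrow> zs \<noteq> [] \<Longrightarrow> f (map snd zs) \<in> V (total zs + m)"
  by (auto simp: CL_iff dmultilinear_multilinear)

text \<open>The definite description is justified by extending \<open>plug\<close>, which is
  multilinear and parity invariant; uniqueness holds because a multilinear map is determined by its
  values on homogeneous lists.\<close>

lemma
  assumes f: "multilinear scale f" and g: "multilinear scale g"
  shows multilinear_balavoine_circ: "multilinear scale (balavoine_circ scale V n f g)"
    and balavoine_circ_eq_plug: "hom_list V zs \<Longrightarrow> balavoine_circ scale V n f g (map snd zs) =
      plug n (\<lambda>ys. g (map snd ys)) (\<lambda>ys. f (map snd ys)) zs"
proof -
  let ?p = "plug n (\<lambda>ys. g (map snd ys)) (\<lambda>ys. f (map snd ys))"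
  let ?P = "\<lambda>h. multilinear scale h \<and> (\<forall>zs. hom_list V zs \<longrightarrow> h (map snd zs) = ?p zs)"
  have dm: "dmultilinear scale scale ?p"
    by (intro dmultilinear_plug dmultilinear_multilinear f g)
  have "?P (extension ?p)"
    using linear_extension[OF dm]
      extension_eq[OF dm parity_invariant_plug[OF parity_invariant_map_snd parity_invariant_map_snd]]
      extension_eq[OF dm parity_invariant_plug[OF parity_invariant_map_snd parity_invariant_map_snd], of "[]"]
    by (auto simp: multilinear_def)
  moreover have "h = h'" if "?P h" "?P h'" for h h'
    using that by (intro multilinear_eq_homogeneous) auto
  ultimately have "\<exists>!h. ?P h" by blast
  from theI'[OF this] have "?P (THE h. ?P h)" .
  moreover have all_hom_list: "(\<forall>ds vs. (\<exists>zs. hom_list V zs \<and> ds = map fst zs \<and> vs = map snd zs) \<longrightarrow> Q ds vs) \<longleftrightarrow>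
      (\<forall>zs. hom_list V zs \<longrightarrow> Q (map fst zs) (map snd zs))" for Q :: "int list \<Rightarrow> 'v list \<Rightarrow> bool"
    by blast
  have "balavoine_circ scale V n f g = (THE h. ?P h)"
    unfolding balavoine_circ_def homogeneous_iff all_hom_list length_map sum_insertion_eq_plug ..
  ultimately show "multilinear scale (balavoine_circ scale V n f g)"
    "hom_list V zs \<Longrightarrow> balavoine_circ scale V n f g (map snd zs) = ?p zs" by auto
qed

lemma balavoine_circ_CL:
  assumes f: "f \<in> CL scale V m" and g: "g \<in> CL scale V n"
  shows "balavoine_circ scale V n f g \<in> CL scale V (m + n)"
  unfolding CL_iff
proof (intro conjI allI impI)
  fix zs assume zs: "hom_list V zs" "zs \<noteq> []"
  show "balavoine_circ scale V n f g (map snd zs) \<in> V (total zs + (m + n))"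
    unfolding balavoine_circ_eq_plug[OF CL_multilinear[OF f] CL_multilinear[OF g] zs(1)]
  proof (rule plug_in_subspace[OF subspace_grading zs(1)])
    fix ys assume "hom_list V ys" "ys \<noteq> []" "total ys = total zs + n"
    then show "f (map snd ys) \<in> V (total zs + (m + n))"
      using CL_degree[OF f, of ys] by (simp add: algebra_simps)
  qed (rule CL_degree[OF g])
qed (intro multilinear_balavoine_circ CL_multilinear[OF f] CL_multilinear[OF g])

lemma balavoine_circ_add_left:
  assumes "multilinear scale f" "multilinear scale f'" "multilinear scale g"
  shows "balavoine_circ scale V n (f + f') g = balavoine_circ scale V n f g + balavoine_circ scale V n f' g"
  using assms
  by (intro multilinear_eq_homogeneous)
    (auto simp: balavoine_circ_eq_plug multilinear_add plug_outer_add intro!: multilinear_add multilinear_balavoine_circ)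

lemma balavoine_circ_add_right:
  assumes "multilinear scale f" "multilinear scale g" "multilinear scale g'"
  shows "balavoine_circ scale V n f (g + g') = balavoine_circ scale V n f g + balavoine_circ scale V n f g'"
  using assms
  by (intro multilinear_eq_homogeneous)
    (auto simp: balavoine_circ_eq_plug multilinear_add plug_inner_add[OF dmultilinear_multilinear[OF assms(1)]]
      intro!: multilinear_add multilinear_balavoine_circ)

lemma balavoine_circ_scale_left:
  assumes "multilinear scale f" "multilinear scale g"
  shows "balavoine_circ scale V n (\<lambda>vs. scale c (f vs)) g = (\<lambda>vs. scale c (balavoine_circ scale V n f g vs))"
  using assms
  by (intro multilinear_eq_homogeneous)
    (auto simp: balavoine_circ_eq_plug multilinear_scale plug_additive[of "scale c"] scale_right_distrib
      intro!: multilinear_scale multilinear_balavoine_circ)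

lemma balavoine_circ_scale_right:
  assumes "multilinear scale f" "multilinear scale g"
  shows "balavoine_circ scale V n f (\<lambda>vs. scale c (g vs)) = (\<lambda>vs. scale c (balavoine_circ scale V n f g vs))"
  using assms
  by (intro multilinear_eq_homogeneous)
    (auto simp: balavoine_circ_eq_plug multilinear_scale plug_inner_scale[OF dmultilinear_multilinear[OF assms(1)]]
      intro!: multilinear_scale multilinear_balavoine_circ)

lemma balavoine_circ_sg_left:
  assumes "multilinear scale f" "multilinear scale g"
  shows "balavoine_circ scale V n (sg k f) g = sg k (balavoine_circ scale V n f g)"
  using balavoine_circ_scale_left[OF assms, where c = "(-1) powi k"]
  by (simp add: scale_powi flip: sg_fun)

lemma balavoine_circ_sg_right:
  assumes "multilinear scale f" "multilinear scale g"
  shows "balavoine_circ scale V n f (sg k g) = sg k (balavoine_circ scale V n f g)"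
  using balavoine_circ_scale_right[OF assms, where c = "(-1) powi k"]
  by (simp add: scale_powi flip: sg_fun)

lemma balavoine_circ_diff_left:
  assumes "multilinear scale f" "multilinear scale f'" "multilinear scale g"
  shows "balavoine_circ scale V n (f - f') g = balavoine_circ scale V n f g - balavoine_circ scale V n f' g"
  using balavoine_circ_add_left[of "f - f'" f' g n] assms by (simp add: multilinear_diff)

lemma balavoine_circ_diff_right:
  assumes "multilinear scale f" "multilinear scale g" "multilinear scale g'"
  shows "balavoine_circ scale V n f (g - g') = balavoine_circ scale V n f g - balavoine_circ scale V n f g'"
  using balavoine_circ_add_right[of f "g - g'" g' n] assms by (simp add: multilinear_diff)

text \<open>A composite agrees with \<open>plug\<close> on homogeneous lists only. Nested composites
  are therefore rewritten through \<open>plug_cong\<close>, where the degrees of the inner maps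
  ensure that only homogeneous lists are met.\<close>

lemma balavoine_circ_pre_lie:
  assumes f: "f \<in> CL scale V m" and g: "g \<in> CL scale V n" and h: "h \<in> CL scale V p"
  shows "balavoine_circ scale V p (balavoine_circ scale V n f g) h
      - balavoine_circ scale V (n + p) f (balavoine_circ scale V p g h) =
    sg (n * p) (balavoine_circ scale V n (balavoine_circ scale V p f h) g
      - balavoine_circ scale V (n + p) f (balavoine_circ scale V n h g))"
proof -
  note ml = CL_multilinear[OF f] CL_multilinear[OF g] CL_multilinear[OF h]
  have outer: "balavoine_circ scale V p (balavoine_circ scale V n f g) h (map snd zs) =
      plug p (\<lambda>ys. h (map snd ys)) (plug n (\<lambda>ys. g (map snd ys)) (\<lambda>ys. f (map snd ys))) zs"
    if "hom_list V zs" "f \<in> CL scale V m" "g \<in> CL scale V n" "h \<in> CL scale V p" for zs f g h m n p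
    unfolding balavoine_circ_eq_plug[OF multilinear_balavoine_circ[OF that(2,3)[THEN CL_multilinear]] CL_multilinear[OF that(4)] that(1)]
    by (rule plug_cong[OF that(1)])
      (auto simp: balavoine_circ_eq_plug[OF that(2,3)[THEN CL_multilinear]] CL_degree[OF that(4)])
  have inner: "balavoine_circ scale V (n + p) f (balavoine_circ scale V p g h) (map snd zs) =
      plug (n + p) (plug p (\<lambda>ys. h (map snd ys)) (\<lambda>ys. g (map snd ys))) (\<lambda>ys. f (map snd ys)) zs"
    if "hom_list V zs" "f \<in> CL scale V m" "g \<in> CL scale V n" "h \<in> CL scale V p" for zs f g h m n p
    unfolding balavoine_circ_eq_plug[OF CL_multilinear[OF that(2)] multilinear_balavoine_circ[OF that(3,4)[THEN CL_multilinear]] that(1)]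
  proof (rule plug_cong[OF that(1)])
    fix ys assume "hom_list V ys" "ys \<noteq> []"
    then show "balavoine_circ scale V p g h (map snd ys) =
        plug p (\<lambda>ys. h (map snd ys)) (\<lambda>ys. g (map snd ys)) ys \<and>
      plug p (\<lambda>ys. h (map snd ys)) (\<lambda>ys. g (map snd ys)) ys \<in> V (total ys + (n + p))"
      using CL_degree[OF balavoine_circ_CL[OF that(3,4)], of ys]
      by (simp add: balavoine_circ_eq_plug[OF that(3,4)[THEN CL_multilinear]])
  qed simp
  show ?thesis
  proof (rule multilinear_eq_homogeneous)
    fix zs assume zs: "hom_list V zs"
    show "(balavoine_circ scale V p (balavoine_circ scale V n f g) h
      - balavoine_circ scale V (n + p) f (balavoine_circ scale V p g h)) (map snd zs) =
    sg (n * p) (balavoine_circ scale V n (balavoine_circ scale V p f h) g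
      - balavoine_circ scale V (n + p) f (balavoine_circ scale V n h g)) (map snd zs)"
      using plug_pre_lie[OF dmultilinear_multilinear[OF ml(1)], of p "\<lambda>ys. h (map snd ys)" n "\<lambda>ys. g (map snd ys)" zs]
        inner[OF zs f h g]
      by (simp add: outer[OF zs f g h] outer[OF zs f h g] inner[OF zs f g h] sg_fun add.commute)
  qed (intro multilinear_diff multilinear_sg multilinear_balavoine_circ ml)+
qed

lemma balavoine_bracket_eq:
  "balavoine_bracket scale V m n f g = balavoine_circ scale V n f g - sg (m * n) (balavoine_circ scale V m g f)"
  by (simp add: balavoine_bracket_def fun_eq_iff scale_powi sg_fun)

lemma graded_lie_algebra_CL:
  "graded_lie_algebra (\<lambda>c F Ws. scale c (F Ws)) (CL scale V) (balavoine_bracket scale V)"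
proof -
  interpret F: vector_space "\<lambda>c F Ws. scale c (F Ws)" by (rule vector_space_fun) (rule vector_space_axioms)
  have subspace: "F.subspace (CL scale V n)" for n
    unfolding F.subspace_def
  proof (intro conjI ballI allI)
    show "0 \<in> CL scale V n"
      unfolding CL_iff using linear_const_zero[OF linear_part]
      by (auto simp: multilinear_def intro: subspace_0[OF subspace_grading])
  qed (auto simp: CL_iff intro!: multilinear_add multilinear_scale subspace_add[OF subspace_grading]
    subspace_scale[OF subspace_grading])
  have sg_CL: "sg k f \<in> CL scale V n" if "f \<in> CL scale V n" for k f n
    using F.subspace_neg[OF subspace that] that by (simp add: sg_def fun_Compl_def)
  have scale_sg: "scale c (sg k v) = sg k (scale c v)" for c k v by (simp add: sg_def)
  show ?thesis
  proof
    fix f g m n assume f: "f \<in> CL scale V m" and g: "g \<in> CL scale V n"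
    show "balavoine_bracket scale V m n f g \<in> CL scale V (m + n)"
      unfolding balavoine_bracket_eq
      using balavoine_circ_CL[OF f g] balavoine_circ_CL[OF g f]
      by (intro F.subspace_diff[OF subspace] sg_CL) (simp_all add: add.commute)
    show "balavoine_bracket scale V m n f g =
        - (\<lambda>Ws. scale ((-1) powi (m * n)) (balavoine_bracket scale V n m g f Ws))"
      by (simp add: balavoine_bracket_eq fun_eq_iff scale_powi sg_fun sg_diff sg_sg mult.commute[of n m])
        (simp add: sg_def)
    fix c
    show "balavoine_bracket scale V m n (\<lambda>Ws. scale c (f Ws)) g =
        (\<lambda>Ws. scale c (balavoine_bracket scale V m n f g Ws))"
      "balavoine_bracket scale V m n f (\<lambda>Ws. scale c (g Ws)) =
        (\<lambda>Ws. scale c (balavoine_bracket scale V m n f g Ws))"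
      using f g by (simp_all add: balavoine_bracket_eq balavoine_circ_scale_left balavoine_circ_scale_right
        CL_multilinear fun_eq_iff sg_fun scale_right_diff_distrib scale_sg)
  next
    fix f f' g m n assume "f \<in> CL scale V m" "f' \<in> CL scale V m" "g \<in> CL scale V n"
    then show "balavoine_bracket scale V m n (f + f') g =
        balavoine_bracket scale V m n f g + balavoine_bracket scale V m n f' g"
      "balavoine_bracket scale V n m g (f + f') =
        balavoine_bracket scale V n m g f + balavoine_bracket scale V n m g f'"
      by (simp_all add: balavoine_bracket_eq balavoine_circ_add_left balavoine_circ_add_right
        CL_multilinear sg_add)
  next
    fix f g h m n p
    assume f: "f \<in> CL scale V m" and g: "g \<in> CL scale V n" and h: "h \<in> CL scale V p"
    note ml = f[THEN CL_multilinear] g[THEN CL_multilinear] h[THEN CL_multilinear]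
    note expand = balavoine_bracket_eq balavoine_circ_add_left balavoine_circ_add_right multilinear_add balavoine_circ_diff_left balavoine_circ_diff_right
      balavoine_circ_sg_left balavoine_circ_sg_right multilinear_balavoine_circ multilinear_sg ml
    \<comment> \<open>The three double brackets expand into twelve nested compositions. Each of
      \<open>f\<close>, \<open>g\<close>, \<open>h\<close> is outermost in four of them, which form
      two associators and cancel by the pre-Lie identity.\<close>
    have "balavoine_bracket scale V m (n + p) f (balavoine_bracket scale V n p g h) =
      balavoine_bracket scale V (m + n) p (balavoine_bracket scale V m n f g) h +
      sg (m * n) (balavoine_bracket scale V n (m + p) g (balavoine_bracket scale V m p f h))"
      by (cases "even m"; cases "even n"; cases "even p")
        (simp_all add: expand sg_def algebra_simps
          balavoine_circ_pre_lie[OF f g h, unfolded diff_eq_eq] balavoine_circ_pre_lie[OF g f h, unfolded diff_eq_eq]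
          balavoine_circ_pre_lie[OF h f g, unfolded diff_eq_eq])
    then show "balavoine_bracket scale V m (n + p) f (balavoine_bracket scale V n p g h) =
      balavoine_bracket scale V (m + n) p (balavoine_bracket scale V m n f g) h +
      (\<lambda>Ws. scale ((-1) powi (m * n)) (balavoine_bracket scale V n (m + p) g (balavoine_bracket scale V m p f h) Ws))"
      by (simp add: fun_eq_iff scale_powi sg_fun)
  qed (rule subspace)
qed

end

section \<open>The grading of the tensor square\<close>

lemma graded_vector_spaceI:
  assumes s: "vector_space s" and sub: "\<And>n. module.subspace s (W n)"
    and span: "module.span s (\<Union>n. W n) = UNIV"
    and indep: "\<And>c A n. \<lbrakk>\<And>n. c n \<in> W n; finite A; (\<Sum>n\<in>A. c n) = 0; n \<in> A\<rbrakk> \<Longrightarrow> c n = 0"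
  shows "graded_vector_space s W"
proof -
  interpret vector_space s by (rule s)
  have ex: "\<exists>c A. (\<forall>n. c n \<in> W n) \<and> finite A \<and> (\<forall>n. n \<notin> A \<longrightarrow> c n = 0) \<and> v = (\<Sum>n\<in>A. c n)"
    if "v \<in> span (\<Union>n. W n)" for v
    using that
  proof (induction rule: span_induct_alt)
    case base
    show ?case by (intro exI[of _ "\<lambda>_. 0"] exI[of _ "{}"]) (auto intro: subspace_0[OF sub])
  next
    case (step r x y)
    then obtain m c A where x: "x \<in> W m" and
      c: "\<forall>n. c n \<in> W n" "finite A" "\<forall>n. n \<notin> A \<longrightarrow> c n = 0" "y = (\<Sum>n\<in>A. c n)" by blast
    have "y = (\<Sum>n\<in>insert m A. c n)" unfolding c(4)
      using c(2,3) by (intro sum.mono_neutral_left) auto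
    then have "s r x + y = (\<Sum>n\<in>insert m A. (if n = m then s r x else 0) + c n)"
      using c(2) by (simp add: sum.distrib sum.delta)
    then show ?case
      using x c by (intro exI[of _ "\<lambda>n. (if n = m then s r x else 0) + c n"] exI[of _ "insert m A"])
        (auto intro!: subspace_add[OF sub] subspace_scale[OF sub] subspace_0[OF sub])
  qed
  show ?thesis
  proof
    fix v
    from ex[of v] span obtain c A where c: "\<forall>n. c n \<in> W n" "finite A" "\<forall>n. n \<notin> A \<longrightarrow> c n = 0"
      "v = (\<Sum>n\<in>A. c n)" by auto
    show "\<exists>!c. (\<forall>n. c n \<in> W n) \<and> finite {n. c n \<noteq> 0} \<and> v = (\<Sum>n | c n \<noteq> 0. c n)"
    proof (rule ex_ex1I)
      have "{n. c n \<noteq> 0} \<subseteq> A" using c(3) by auto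
      then have "finite {n. c n \<noteq> 0}" "v = (\<Sum>n | c n \<noteq> 0. c n)"
        using c(2,4) by (auto intro: finite_subset sum.mono_neutral_right)
      then show "\<exists>c. (\<forall>n. c n \<in> W n) \<and> finite {n. c n \<noteq> 0} \<and> v = (\<Sum>n | c n \<noteq> 0. c n)"
        using c(1) by blast
    next
      fix c c'
      assume c: "(\<forall>n. c n \<in> W n) \<and> finite {n. c n \<noteq> 0} \<and> v = (\<Sum>n | c n \<noteq> 0. c n)"
        and c': "(\<forall>n. c' n \<in> W n) \<and> finite {n. c' n \<noteq> 0} \<and> v = (\<Sum>n | c' n \<noteq> 0. c' n)"
      let ?A = "{n. c n \<noteq> 0} \<union> {n. c' n \<noteq> 0}"
      have A: "finite ?A" using c c' by simp
      have "v = (\<Sum>n\<in>?A. c n)" using c by (subst conjunct2[OF conjunct2[OF c]]) (auto intro!: sum.mono_neutral_left A)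
      moreover have "v = (\<Sum>n\<in>?A. c' n)" using c' by (subst conjunct2[OF conjunct2[OF c']]) (auto intro!: sum.mono_neutral_left A)
      ultimately have 0: "(\<Sum>n\<in>?A. c n - c' n) = 0" by (simp add: sum_subtractf)
      have "c n - c' n = 0" if "n \<in> ?A" for n
        using indep[of "\<lambda>n. c n - c' n", OF _ A 0 that] c c' by (simp add: subspace_diff[OF sub])
      then have "c n = c' n" for n by (cases "n \<in> ?A") auto
      then show "c = c'" by blast
    qed
  qed (rule sub)
qed

locale graded_tensor_square = graded_vector_space scaleV V + tensor_square scaleV scaleT tens
  for scaleV :: "'k::field \<Rightarrow> 'v::ab_group_add \<Rightarrow> 'v" and V
    and scaleT :: "'k \<Rightarrow> 't::ab_group_add \<Rightarrow> 't" and tens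
begin

abbreviation "W \<equiv> suspension (tensor_grading scaleT tens V)"

lemma linear_tens_left: "Vector_Spaces.linear scaleV scaleT (\<lambda>x. tens x y)"
  and linear_tens_right: "Vector_Spaces.linear scaleV scaleT (tens x)"
  using bilinear_tens by (simp_all add: bilinear_map_def)

lemmas tens_simps = lin_add[OF linear_tens_left] lin_add[OF linear_tens_right]
  lin_diff[OF linear_tens_left] lin_diff[OF linear_tens_right]
  lin_neg[OF linear_tens_left] lin_neg[OF linear_tens_right]
  lin_zero[OF linear_tens_left] lin_zero[OF linear_tens_right]
  lin_scale[OF linear_tens_left] lin_scale[OF linear_tens_right]

lemma tens_sg: "tens (sg k x) y = sg k (tens x y)" "tens x (sg k y) = sg k (tens x y)"
  by (simp_all add: sg_def tens_simps)

definition lift :: "('v \<Rightarrow> 'v \<Rightarrow> 't) \<Rightarrow> 't \<Rightarrow> 't" where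
  "lift b = (THE l. Vector_Spaces.linear scaleT scaleT l \<and> (\<forall>x y. l (tens x y) = b x y))"

lemma
  assumes "bilinear_map scaleV scaleV scaleT b"
  shows linear_lift: "Vector_Spaces.linear scaleT scaleT (lift b)"
    and lift_tens [simp]: "lift b (tens x y) = b x y"
  using theI'[OF universal_property[OF T.vector_space_axioms assms]] by (auto simp: lift_def)

lemma linear_eq_tens:
  assumes l: "Vector_Spaces.linear scaleT s l" "Vector_Spaces.linear scaleT s l'"
    and eq: "\<And>x y. l (tens x y) = l' (tens x y)"
  shows "l = l'"
proof -
  have "bilinear_map scaleV scaleV s (\<lambda>x y. l (tens x y))"
    unfolding bilinear_map_def using linear_comp[OF linear_tens_left l(1)] linear_comp[OF linear_tens_right l(1)] by simp
  moreover have "vector_space s" using l by (simp add: Vector_Spaces.linear_iff)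
  ultimately show ?thesis using universal_property[of s "\<lambda>x y. l (tens x y)"] l eq by metis
qed

text \<open>A tensor outside the span would admit a nonzero functional vanishing on all pure
  tensors, against uniqueness in the universal property.\<close>

lemma span_tens: "T.span (range (case_prod tens)) = UNIV"
proof (rule ccontr)
  interpret K: vector_space "(*) :: 'k \<Rightarrow> 'k \<Rightarrow> 'k"
    by unfold_locales (auto simp: algebra_simps)
  interpret TK: vector_space_pair scaleT "(*) :: 'k \<Rightarrow> 'k \<Rightarrow> 'k" ..
  obtain C where C: "C \<subseteq> range (case_prod tens)" "T.independent C" "range (case_prod tens) \<subseteq> T.span C"
    using T.maximal_independent_subset by blast
  assume "T.span (range (case_prod tens)) \<noteq> UNIV"
  moreover have "T.span C = T.span (range (case_prod tens))"
    using T.span_mono[OF C(1)] T.span_minimal[OF C(3) T.subspace_span] by blast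
  ultimately obtain t where t: "t \<notin> T.span C" by blast
  then have "T.independent (insert t C)" using C(2) T.independent_insertI by blast
  then obtain m where m: "Vector_Spaces.linear scaleT (*) m" "\<forall>c\<in>insert t C. m c = (if c = t then 1 else (0::'k))"
    using TK.linear_independent_extend[of "insert t C" "\<lambda>c. if c = t then 1 else 0"] by blast
  have "m c = 0" if "c \<in> T.span C" for c
  proof (rule TK.linear_eq_0_on_span[OF m(1) _ that])
    fix c assume "c \<in> C"
    then show "m c = 0" using m(2) t T.span_base by auto
  qed
  then have "m = (\<lambda>_. 0)"
    using C(3) by (intro linear_eq_tens[OF m(1) TK.linear_zero]) auto
  then show False using m(2) by auto
qed

lemma tens_in_W: "x \<in> V a \<Longrightarrow> y \<in> V b \<Longrightarrow> tens x y \<in> W (a + b + 1)"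
  by (auto simp: suspension_def tensor_grading_def intro!: T.span_base)

text \<open>No case for scalar multiples arises because a scalar can be absorbed into the first
  tensor factor. The 1 in the degree is the suspension.\<close>

lemma W_induct [consumes 1, case_names zero tens add]:
  assumes "t \<in> W n" and "P 0"
    and "\<And>a b x y. \<lbrakk>x \<in> V a; y \<in> V b; a + b + 1 = n\<rbrakk> \<Longrightarrow> P (tens x y)"
    and "\<And>u v. P u \<Longrightarrow> P v \<Longrightarrow> P (u + v)"
  shows "P t"
proof -
  have "t \<in> T.span {tens x y | x y a b. x \<in> V a \<and> y \<in> V b \<and> a + b = n - 1}"
    using assms(1) by (simp add: suspension_def tensor_grading_def)
  then show ?thesis
  proof (induction rule: T.span_induct_alt)
    case (step c t u)
    then obtain x y a b where *: "t = tens x y" "x \<in> V a" "y \<in> V b" "a + b = n - 1" by blast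
    then have "P (tens (scaleV c x) y)"
      by (intro assms(3)) (auto intro: subspace_scale[OF subspace_grading])
    with step * show ?case by (simp add: tens_simps assms(4))
  qed (rule assms(2))
qed

lemma subspace_W: "T.subspace (W n)"
  by (simp add: suspension_def tensor_grading_def)

text \<open>Independence of the components is detected by the bihomogeneous projections
  \<open>p (a, b)\<close>: each kills the components of degree other than \<open>a + b + 1\<close>,
  and every tensor is a finite sum of its projections.\<close>

lemma graded_W: "graded_vector_space scaleT W"
proof (rule graded_vector_spaceI)
  have "tens x y \<in> T.span (\<Union>n. W n)" for x y
  proof (induction x rule: homogeneous_induct)
    case (homogeneous a x)
    show ?case
    proof (induction y rule: homogeneous_induct)
      case (homogeneous b y)
      then show ?case using tens_in_W[OF \<open>x \<in> V a\<close> homogeneous] by (auto intro: T.span_base)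
    qed (simp_all add: tens_simps T.span_zero T.span_add)
  qed (simp_all add: tens_simps T.span_zero T.span_add)
  then have "T.span (range (case_prod tens)) \<subseteq> T.span (\<Union>n. W n)"
    by (intro T.span_minimal T.subspace_span) auto
  then show "T.span (\<Union>n. W n) = UNIV" using span_tens by blast
next
  fix c A n assume c: "\<And>n. c n \<in> W n" "finite A" "(\<Sum>n\<in>A. c n) = 0" "n \<in> (A :: int set)"
  define p where "p = (\<lambda>(a, b). lift (\<lambda>x y. tens (part {a} x) (part {b} y)))"
  have bilinear: "bilinear_map scaleV scaleV scaleT (\<lambda>x y. tens (part {a} x) (part {b} y))" for a b
    unfolding bilinear_map_def
    using linear_comp[OF linear_part linear_tens_left] linear_comp[OF linear_part linear_tens_right] by auto
  have lin_p: "Vector_Spaces.linear scaleT scaleT (p ab)" for ab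
    using linear_lift[OF bilinear] by (simp add: p_def split: prod.split)
  have p_tens: "p (a, b) (tens x y) = tens (part {a} x) (part {b} y)" for a b x y
    by (simp add: p_def lift_tens[OF bilinear])
  have p_W: "p (a, b) t = 0" if "t \<in> W m" "a + b + 1 \<noteq> m" for a b t m
    using that(1)
  proof (induction rule: W_induct)
    case (tens a' b' x y)
    with that(2) show ?case by (auto simp: p_tens part_homogeneous tens_simps)
  qed (simp_all add: lin_zero[OF lin_p] lin_add[OF lin_p])
  have p_c: "p (a, b) (c n) = 0" for a b
  proof (cases "a + b + 1 = n")
    case True
    have "0 = (\<Sum>m\<in>A. p (a, b) (c m))"
      using c(3) by (simp add: lin_zero[OF lin_p] flip: lin_sum[OF lin_p])
    also have "\<dots> = (\<Sum>m\<in>A. if m = n then p (a, b) (c n) else 0)"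
      using p_W[OF c(1)] True by (intro sum.cong) auto
    finally show ?thesis using c(2,4) by simp
  qed (rule p_W[OF c(1)])
  \<comment> \<open>Claiming the identity for every larger finite set \<open>B'\<close> makes it
    stable under sums in the span induction, where two tensors need a common index set.\<close>
  have "\<exists>B. finite B \<and> (\<forall>B'. finite B' \<longrightarrow> B \<subseteq> B' \<longrightarrow> t = (\<Sum>ab\<in>B'. p ab t))" for t
  proof -
    have "t \<in> T.span (range (case_prod tens))" by (simp add: span_tens)
    then show ?thesis
    proof (induction rule: T.span_induct_alt)
      case base
      show ?case by (auto simp: lin_zero[OF lin_p] intro: exI[of _ "{}"])
    next
      case (step r t u)
      then obtain x y B where t: "t = tens x y" and B: "finite B"
        "\<And>B'. finite B' \<Longrightarrow> B \<subseteq> B' \<Longrightarrow> u = (\<Sum>ab\<in>B'. p ab u)" by auto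
      let ?X = "{n. components x n \<noteq> 0}" and ?Y = "{n. components y n \<noteq> 0}"
      have part: "part {a} v = components v a" for a v
      proof -
        have "{n. components v n \<noteq> 0} \<inter> {a} = (if components v a = 0 then {} else {a})" by auto
        then show ?thesis by (simp add: part_def)
      qed
      have tens_sum: "tens (sum F X) (sum G Y) = (\<Sum>(a, b)\<in>X \<times> Y. tens (F a) (G b))" for F G X Y
        by (subst lin_sum[OF linear_tens_left], subst lin_sum[OF linear_tens_right])
          (simp add: sum.cartesian_product)
      have XY: "tens x y = (\<Sum>(a, b)\<in>?X \<times> ?Y. p (a, b) (tens x y))"
        unfolding p_tens part tens_sum[symmetric] components(3)[symmetric] ..
      have "tens x y = (\<Sum>ab\<in>B'. p ab (tens x y))" if "finite B'" "?X \<times> ?Y \<subseteq> B'" for B'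
        by (subst XY, rule sum.mono_neutral_cong_left) (use that in \<open>auto simp: p_tens part tens_simps\<close>)
      then have "scaleT r t + u = (\<Sum>ab\<in>B'. p ab (scaleT r t + u))" if "finite B'" "?X \<times> ?Y \<union> B \<subseteq> B'" for B'
        using that B(2)[of B'] t
        by (simp add: lin_add[OF lin_p] lin_scale[OF lin_p] sum.distrib flip: T.scale_sum_right)
      then show ?case using B(1) components(2) by (intro exI[of _ "?X \<times> ?Y \<union> B"]) auto
    qed
  qed
  then obtain B where "c n = (\<Sum>ab\<in>B. p ab (c n))" by blast
  moreover have "p ab (c n) = 0" for ab using p_c by (cases ab) simp
  ultimately show "c n = 0" by simp
qed (rule T.vector_space_axioms subspace_W)+

sublocale W: graded_vector_space scaleT W
  by (rule graded_W)

end

section \<open>The map \<open>\<Psi>\<close>\<close>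

lemma split_sum_diff:
  "split_sum n (\<lambda>us vs. \<Phi> us vs - \<Phi>' us vs) zs = split_sum n \<Phi> zs - split_sum n \<Phi>' zs"
  by (induction n \<Phi> zs arbitrary: \<Phi>' rule: split_sum.induct) (simp_all add: sg_diff)

lemma split_sum_additive:
  assumes "\<And>u v. L (u + v) = L u + L v"
  shows "split_sum n (\<lambda>us vs. L (\<Phi> us vs)) zs = L (split_sum n \<Phi> zs)"
proof -
  have 0: "L 0 = 0" using assms[of 0 0] by simp
  then have "L (- u) = - L u" for u using assms[of u "- u"] by (simp add: eq_neg_iff_add_eq_0 add.commute)
  then have "L (sg k u) = sg k (L u)" for k u by (simp add: sg_def)
  then show ?thesis by (induction zs arbitrary: n \<Phi>) (simp_all add: assms)
qed

lemma split_sum_add: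
  "split_sum n (\<lambda>us vs. \<Phi> us vs + \<Phi>' us vs) zs = split_sum n \<Phi> zs + split_sum n \<Phi>' zs"
  by (induction n \<Phi> zs arbitrary: \<Phi>' rule: split_sum.induct) (simp_all add: sg_add)

lemma split_sum_cong:
  assumes "hom_list W zs"
    and "\<And>us vs. \<lbrakk>hom_list W us; hom_list W vs; total us + total vs = total zs\<rbrakk> \<Longrightarrow> \<Phi> us vs = \<Phi>' us vs"
  shows "split_sum n \<Phi> zs = split_sum n \<Phi>' zs"
  using assms
proof (induction zs arbitrary: n \<Phi> \<Phi>')
  case (Cons z zs)
  have "split_sum n (\<lambda>us vs. \<Phi> (z # us) vs) zs = split_sum n (\<lambda>us vs. \<Phi>' (z # us) vs) zs" for n
    using Cons.prems by (intro Cons.IH) auto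
  moreover have "split_sum n (\<lambda>us vs. \<Phi> us (z # vs)) zs = split_sum n (\<lambda>us vs. \<Phi>' us (z # vs)) zs" for n
    using Cons.prems by (intro Cons.IH) auto
  ultimately show ?case by simp
qed simp

lemma (in vector_space) split_sum_in_subspace:
  assumes "subspace S" "hom_list W zs"
    and "\<And>us vs. \<lbrakk>hom_list W us; hom_list W vs; total us + total vs = total zs\<rbrakk> \<Longrightarrow> \<Phi> us vs \<in> S"
  shows "split_sum n \<Phi> zs \<in> S"
  using assms(2-)
proof (induction zs arbitrary: n \<Phi>)
  case (Cons z zs)
  have "split_sum n (\<lambda>us vs. \<Phi> (z # us) vs) zs \<in> S" for n
    using Cons.prems by (intro Cons.IH) auto
  moreover have "split_sum n (\<lambda>us vs. \<Phi> us (z # vs)) zs \<in> S" for n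
    using Cons.prems by (intro Cons.IH) auto
  ultimately show ?case by (simp add: subspace_add[OF assms(1)] subspace_sg[OF assms(1)])
qed simp

lemma linear_split_sum:
  "(\<And>us vs. Vector_Spaces.linear s s' (\<lambda>w. \<Phi> w us vs)) \<Longrightarrow> Vector_Spaces.linear s s' (\<lambda>w. split_sum n (\<Phi> w) zs)"
  by (induction zs arbitrary: n \<Phi>) (auto intro!: linear_plus linear_sg)

lemma dmultilinear_split_sum:
  assumes "\<And>us d us' vs. Vector_Spaces.linear s s' (\<lambda>w. \<Phi> (us @ (d, w) # us') vs)"
    and "\<And>us vs d vs'. Vector_Spaces.linear s s' (\<lambda>w. \<Phi> us (vs @ (d, w) # vs'))"
  shows "dmultilinear s s' (split_sum n \<Phi>)"
proof -
  have "Vector_Spaces.linear s s' (\<lambda>w. split_sum n \<Phi> (us @ (d, w) # vs))" for us d vs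
    using assms
  proof (induction us arbitrary: n \<Phi>)
    case Nil
    show ?case
      using Nil(1)[where us = "[]"] Nil(2)[where vs = "[]"]
      by (auto intro!: linear_plus linear_sg linear_split_sum)
  next
    case (Cons u us)
    have "Vector_Spaces.linear s s' (\<lambda>w. \<Phi> (u # us @ (d, w) # us') vs)" for us d us' vs
      using Cons.prems(1)[of "u # us"] by simp
    moreover have "Vector_Spaces.linear s s' (\<lambda>w. \<Phi> us (u # vs @ (d, w) # vs'))" for us vs d vs'
      using Cons.prems(2)[of us "u # vs"] by simp
    ultimately show ?case
      using Cons.prems by (auto intro!: linear_plus linear_sg Cons.IH)
  qed
  then show ?thesis by (simp add: dmultilinear_def)
qed

lemma parity_invariant_split_sum:
  assumes "\<And>us us' vs vs'. \<lbrakk>same_parity us us';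
      same_parity vs vs'\<rbrakk> \<Longrightarrow> \<Phi> us vs = \<Phi> us' vs'"
  shows "parity_invariant (split_sum n \<Phi>)"
proof -
  have "split_sum n \<Phi> zs = split_sum n' \<Phi>' zs'"
    if "same_parity zs zs'" "even (n - n')"
      "\<And>us us' vs vs'. \<lbrakk>same_parity us us';
        same_parity vs vs'\<rbrakk> \<Longrightarrow> \<Phi> us vs = \<Phi>' us' vs'"
    for zs zs' n n' \<Phi> and \<Phi>' :: "(int \<times> 'a) list \<Rightarrow> (int \<times> 'a) list \<Rightarrow> 'b"
    using that
  proof (induction zs zs' arbitrary: n n' \<Phi> \<Phi>' rule: list_all2_induct)
    case Nil
    then show ?case by simp
  next
    case (Cons z zs z' zs')
    have "split_sum n (\<lambda>us vs. \<Phi> (z # us) vs) zs = split_sum n' (\<lambda>us vs. \<Phi>' (z' # us) vs) zs'"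
      using Cons.prems Cons.hyps by (intro Cons.IH) auto
    moreover have "split_sum (n + fst z) (\<lambda>us vs. \<Phi> us (z # vs)) zs =
        split_sum (n' + fst z') (\<lambda>us vs. \<Phi>' us (z' # vs)) zs'"
      using Cons.prems Cons.hyps by (intro Cons.IH) auto
    moreover have "even (n * fst z) \<longleftrightarrow> even (n' * fst z')" using Cons.prems Cons.hyps by auto
    ultimately show ?case by (simp add: sg_def)
  qed
  from this[of _ _ n n \<Phi> \<Phi>] assms show ?thesis unfolding parity_invariant_def by auto
qed

lemma total_parity:
  "same_parity us us' \<Longrightarrow> even (total us) \<longleftrightarrow> even (total us')"
  by (induction rule: list_all2_induct) auto

lemma map_snd_parity:
  "same_parity us us' \<Longrightarrow> map snd us = map snd us'"
  by (induction rule: list_all2_induct) auto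

text \<open>Let operations of degrees \<open>m\<close> and \<open>n\<close> precede
  \<open>zs\<close>. Attaching a sublist to each of them directly, or exchanging the operations,
  attaching the sublists and exchanging the resulting blocks back, gives the same Koszul sign. The
  degree of a block is that of its operation plus the total of its sublist.\<close>

lemma split_sum_swap:
  "split_sum n \<Phi> zs =
     sg (m * n) (split_sum m (\<lambda>us vs. sg ((m + total vs) * (n + total us)) (\<Phi> vs us)) zs)"
proof (induction zs arbitrary: m n \<Phi>)
  case Nil
  then show ?case by (simp add: sg_sg) (simp add: sg_def)
next
  case (Cons z zs)
  have sg: "split_sum m (\<lambda>us vs. sg k (\<Phi> us vs)) zs = sg k (split_sum m \<Phi> zs)" for m k \<Phi>
    by (rule split_sum_additive) (rule sg_add)
  have 1: "split_sum n (\<lambda>us vs. \<Phi> (z # us) vs) zs = sg ((m + fst z) * n) (split_sum (m + fst z)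
      (\<lambda>us vs. sg ((m + fst z + total vs) * (n + total us)) (\<Phi> (z # vs) us)) zs)"
    by (rule Cons.IH)
  have 2: "split_sum (n + fst z) (\<lambda>us vs. \<Phi> us (z # vs)) zs = sg (m * (n + fst z)) (split_sum m
      (\<lambda>us vs. sg ((m + total vs) * (n + fst z + total us)) (\<Phi> vs (z # us))) zs)"
    by (rule Cons.IH)
  show ?case
    unfolding split_sum.simps(2) 1 2 by (simp add: sg_add sg_sg algebra_simps) (simp add: sg_def)
qed

section \<open>Elements of \<open>Cn\<close> and their derivation extensions in suspended
  degrees\<close>

context graded_tensor_square
begin

lemma homogeneous_tensor_grading:
  "homogeneous (tensor_grading scaleT tens V) ds Xs \<longleftrightarrow>
     (\<exists>zs. hom_list W zs \<and> Xs = map snd zs \<and> ds = map (\<lambda>z. fst z - 1) zs)"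
proof -
  have "homogeneous (tensor_grading scaleT tens V) ds Xs \<longleftrightarrow> homogeneous W (map (\<lambda>d. d + 1) ds) Xs"
    by (simp add: homogeneous_def suspension_def list.rel_map)
  moreover have "map (\<lambda>d. d + 1) ds = map fst zs \<longleftrightarrow> ds = map (\<lambda>z. fst z - 1) zs" for zs :: "(int \<times> 't) list"
    by (auto simp: list_eq_iff_nth_eq)
  ultimately show ?thesis unfolding homogeneous_iff by auto
qed

lemma sum_list_shift: "sum_list (map (\<lambda>z. fst z - 1) zs) = total zs - int (length zs)"
  by (induction zs) auto

text \<open>Suspension raises the degree sum by one for each tensor argument, which absorbs the term
  \<open>int (length Xs)\<close> of the degree.\<close>

lemma Cn_iff:
  "f \<in> Cn scaleV scaleT tens V n \<longleftrightarrow>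
     (\<forall>Xs Ys x. Vector_Spaces.linear scaleT scaleV (\<lambda>X. f (Xs @ X # Ys) x)) \<and>
     (\<forall>Xs. Vector_Spaces.linear scaleV scaleV (f Xs)) \<and>
     (\<forall>zs a x. hom_list W zs \<longrightarrow> x \<in> V a \<longrightarrow> f (map snd zs) x \<in> V (total zs + a + n))"
proof -
  have all_homogeneous: "(\<forall>ds Xs a x. homogeneous (tensor_grading scaleT tens V) ds Xs \<longrightarrow> Q ds Xs a x) \<longleftrightarrow>
      (\<forall>zs a x. hom_list W zs \<longrightarrow> Q (map (\<lambda>z. fst z - 1) zs) (map snd zs) a x)" for Q
    unfolding homogeneous_tensor_grading by blast
  have "sum_list (map (\<lambda>z. fst z - 1) zs) + a + n + int (length (map snd zs)) = total zs + a + n"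
    for zs :: "(int \<times> 't) list" and a
    by (simp add: sum_list_shift)
  then show ?thesis unfolding Cn_def all_homogeneous by (simp only: mem_Collect_eq)
qed

lemma Cn_linear_list: "f \<in> Cn scaleV scaleT tens V n \<Longrightarrow> Vector_Spaces.linear scaleT scaleV (\<lambda>X. f (Xs @ X # Ys) x)"
  and Cn_linear: "f \<in> Cn scaleV scaleT tens V n \<Longrightarrow> Vector_Spaces.linear scaleV scaleV (f Xs)"
  and Cn_degree: "f \<in> Cn scaleV scaleT tens V n \<Longrightarrow> hom_list W zs \<Longrightarrow> x \<in> V a \<Longrightarrow> f (map snd zs) x \<in> V (total zs + a + n)"
  by (auto simp: Cn_iff)

text \<open>In terms of the suspended degrees, \<open>f Xs\<close> is an operator of degree \<open>total zs + n\<close> on \<open>V\<close>, and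
  \<open>F\<close> extends it to the tensor square as a graded derivation.\<close>

definition derivation_ext :: "int \<Rightarrow> ('t list \<Rightarrow> 'v \<Rightarrow> 'v) \<Rightarrow> ('t list \<Rightarrow> 't) \<Rightarrow> bool" where
  "derivation_ext n f F \<longleftrightarrow> multilinear scaleT F \<and>
     (\<forall>zs a x b y. hom_list W zs \<longrightarrow> x \<in> V a \<longrightarrow> y \<in> V b \<longrightarrow>
        F (map snd zs @ [tens x y]) =
          tens (f (map snd zs) x) y + sg (a * (total zs + n)) (tens x (f (map snd zs) y)))"

text \<open>Absorbs the sign \<open>(-1)\<^bsup>p(p-1)/2\<^esup>\<close> of \<open>\<Psi>\<close>, where \<open>p = length Xs + 1\<close>.\<close>

definition twist :: "('t list \<Rightarrow> 'v \<Rightarrow> 'v) \<Rightarrow> 't list \<Rightarrow> 'v \<Rightarrow> 'v" where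
  "twist f Xs x = sg (int (Suc (length Xs) * length Xs div 2)) (f Xs x)"

lemma twist_twist [simp]: "twist (twist f) = f"
  by (simp add: twist_def fun_eq_iff sg_def)

lemma twist_Cn: "f \<in> Cn scaleV scaleT tens V n \<Longrightarrow> twist f \<in> Cn scaleV scaleT tens V n"
  unfolding Cn_iff twist_def by (auto intro!: linear_sg subspace_sg[OF subspace_grading])

text \<open>In suspended degrees the exponent \<open>sum_list ds + n + int p - 1\<close> becomes
  \<open>total zs + n\<close>, since \<open>p - 1\<close> is the number of tensor arguments before
  the last; the prefactor moves into \<open>twist\<close>.\<close>

lemma Psi_eq_The: "Psi scaleT tens V n f = (THE F. derivation_ext n (twist f) F)"
proof -
  have pow: "scaleT ((-1) ^ k) v = sg (int k) v" for k v
    using T.scale_powi[of "int k" v] by simp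
  have all_homogeneous: "(\<forall>ds Xs a x b y. homogeneous (tensor_grading scaleT tens V) ds Xs \<longrightarrow> Q ds Xs a x b y) \<longleftrightarrow>
      (\<forall>zs a x b y. hom_list W zs \<longrightarrow> Q (map (\<lambda>z. fst z - 1) zs) (map snd zs) a x b y)" for Q
    unfolding homogeneous_tensor_grading by blast
  show ?thesis
    unfolding Psi_def derivation_ext_def all_homogeneous Let_def pow T.scale_powi twist_def tens_sg
    by (simp add: sum_list_shift sg_add sg_sg add.commute)
qed

text \<open>A homogeneous last argument is a sum of pure tensors of homogeneous vectors, and on
  these the derivation formula fixes the value.\<close>

lemma derivation_ext_unique:
  assumes "derivation_ext n f F" "derivation_ext n f F'"
  shows "F = F'"
proof (rule W.multilinear_eq_homogeneous)
  fix zs assume zs: "hom_list W zs" "zs \<noteq> []"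
  then obtain ys d t where ys: "zs = ys @ [(d, t)]" by (metis surj_pair rev_exhaust)
  then have hom: "hom_list W ys" "t \<in> W d" using zs by auto
  have lin: "Vector_Spaces.linear scaleT scaleT (\<lambda>t. F (map snd ys @ [t]))"
    "Vector_Spaces.linear scaleT scaleT (\<lambda>t. F' (map snd ys @ [t]))"
    using assms by (auto simp: derivation_ext_def multilinear_def)
  from hom(2) have "F (map snd ys @ [t]) = F' (map snd ys @ [t])"
  proof (induction rule: W_induct)
    case (tens a b x y)
    then show ?case using assms hom(1) by (simp add: derivation_ext_def)
  qed (simp_all add: lin_zero[OF lin(1)] lin_zero[OF lin(2)] lin_add[OF lin(1)] lin_add[OF lin(2)])
  then show "F (map snd zs) = F' (map snd zs)" by (simp add: ys)
qed (use assms in \<open>simp_all add: derivation_ext_def\<close>)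

text \<open>The sign involves the degree of \<open>x\<close> but not that of \<open>y\<close>, so
  both sides are linear in \<open>y\<close> and agree for arbitrary \<open>y\<close>. When
  derivations are composed, no degree has to be tracked in the second tensor factor.\<close>

lemma derivation_ext_tens:
  assumes F: "derivation_ext n f F" and lin: "\<And>Xs. Vector_Spaces.linear scaleV scaleV (f Xs)"
    and "hom_list W zs" "x \<in> V a"
  shows "F (map snd zs @ [tens x y]) =
    tens (f (map snd zs) x) y + sg (a * (total zs + n)) (tens x (f (map snd zs) y))"
proof (rule linear_eq_homogeneous[where f = "\<lambda>y. F (map snd zs @ [tens x y])"
      and g = "\<lambda>y. tens (f (map snd zs) x) y + sg (a * (total zs + n)) (tens x (f (map snd zs) y))"])
  have "Vector_Spaces.linear scaleT scaleT (\<lambda>t. F (map snd zs @ [t]))"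
    using F by (auto simp: derivation_ext_def multilinear_def)
  from linear_comp[OF linear_tens_right this]
  show "Vector_Spaces.linear scaleV scaleT (\<lambda>y. F (map snd zs @ [tens x y]))" .
  show "Vector_Spaces.linear scaleV scaleT
      (\<lambda>y. tens (f (map snd zs) x) y + sg (a * (total zs + n)) (tens x (f (map snd zs) y)))"
    by (intro linear_plus linear_sg linear_tens_right linear_comp[OF lin linear_tens_right])
qed (use assms in \<open>auto simp: derivation_ext_def\<close>)

text \<open>For a fixed operator the sign depends on the parity of \<open>x\<close>, so splitting
  \<open>x\<close> into even and odd parts turns the formula into a bilinear map \<open>b\<close>,
  to which the universal property applies. The dependence of the sign on the earlier arguments is
  left to the parity extension of \<open>Q\<close>.\<close>

lemma derivation_ext_exists:
  assumes f: "f \<in> Cn scaleV scaleT tens V n"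
  shows "\<exists>F. derivation_ext n f F"
proof -
  define b where "b e A = (\<lambda>x y. tens (A x) y + tens (part {n. even n} x) (A y) +
    sg e (tens (part {n. odd n} x) (A y)))" for e :: int and A :: "'v \<Rightarrow> 'v"
  define Q where "Q zs = (if zs = [] then 0
    else lift (b (total (butlast zs) + n) (f (map snd (butlast zs)))) (snd (last zs)))" for zs
  have b: "bilinear_map scaleV scaleV scaleT (b e A)" if A: "Vector_Spaces.linear scaleV scaleV A" for e A
    unfolding bilinear_map_def b_def
    using linear_comp[OF A linear_tens_left] linear_comp[OF A linear_tens_right]
      linear_comp[OF linear_part linear_tens_left]
    by (auto intro!: linear_plus linear_sg linear_tens_right)
  note bf = b[OF Cn_linear[OF f]]
  \<comment> \<open>Linearity of \<open>lift\<close> in the operator is obtained by comparing lifts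
    on pure tensors.\<close>
  have lift_f: "Vector_Spaces.linear scaleT scaleT (\<lambda>X. lift (b e (f (Xs @ X # Ys))) t)" for e Xs Ys t
  proof -
    have add: "lift (b e (f (Xs @ (X + X') # Ys))) = (\<lambda>t. lift (b e (f (Xs @ X # Ys))) t + lift (b e (f (Xs @ X' # Ys))) t)" for X X'
      by (rule linear_eq_tens[OF linear_lift[OF bf] linear_plus[OF linear_lift[OF bf] linear_lift[OF bf]]])
        (simp add: lift_tens[OF bf], simp add: b_def lin_add[OF Cn_linear_list[OF f]] tens_simps sg_add)
    have scale: "lift (b e (f (Xs @ scaleT c X # Ys))) = (\<lambda>t. scaleT c (lift (b e (f (Xs @ X # Ys))) t))" for c X
      by (rule linear_eq_tens[OF linear_lift[OF bf] linear_comp[OF linear_lift[OF bf] T.linear_scale_self]])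
        (simp add: lift_tens[OF bf], simp add: b_def lin_scale[OF Cn_linear_list[OF f]] tens_simps T.scale_right_distrib sg_def)
    show ?thesis
      by (simp add: Vector_Spaces.linear_iff T.vector_space_axioms add scale)
  qed
  have dm: "dmultilinear scaleT scaleT Q"
    unfolding dmultilinear_def
  proof (intro allI)
    fix us d vs
    show "Vector_Spaces.linear scaleT scaleT (\<lambda>w. Q (us @ (d, w) # vs))"
    proof (cases "vs = []")
      case True
      then show ?thesis by (simp add: Q_def linear_lift[OF bf])
    next
      case False
      then show ?thesis by (simp add: Q_def butlast_append lift_f)
    qed
  qed
  have par: "parity_invariant Q"
    unfolding parity_invariant_def
  proof (intro allI impI)
    fix zs zs' :: "(int \<times> 't) list"
    assume *: "same_parity zs zs'"
    show "Q zs = Q zs'"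
    proof (cases zs rule: rev_cases)
      case (snoc ys z)
      with * obtain ys' z' where zs': "zs' = ys' @ [z']" "snd z = snd z'"
        "same_parity ys ys'"
        by (auto simp: list_all2_append1 list_all2_Cons1)
      have "b (total ys + n) = b (total ys' + n)"
        using total_parity[OF zs'(3)] by (simp add: b_def sg_def fun_eq_iff)
      then show ?thesis using zs' map_snd_parity[OF zs'(3)] by (simp add: snoc Q_def)
    qed (use * in simp)
  qed
  have "derivation_ext n f (W.extension Q)"
    unfolding derivation_ext_def
  proof (intro conjI allI impI)
    have "W.extension Q [] = 0" using W.extension_eq[OF dm par, of "[]"] by (simp add: Q_def)
    then show "multilinear scaleT (W.extension Q)"
      using W.linear_extension[OF dm] by (simp add: multilinear_def)
    fix zs a x c y
    assume *: "hom_list W zs" "x \<in> V a" "y \<in> V c"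
    have "W.extension Q (map snd (zs @ [(a + c + 1, tens x y)])) = Q (zs @ [(a + c + 1, tens x y)])"
      using * tens_in_W[OF *(2,3)] by (intro W.extension_eq[OF dm par]) simp
    then show "W.extension Q (map snd zs @ [tens x y]) =
       tens (f (map snd zs) x) y + sg (a * (total zs + n)) (tens x (f (map snd zs) y))"
      using part_homogeneous[OF *(2)]
      by (simp add: Q_def lift_tens[OF bf]) (simp add: b_def tens_simps sg_def)
  qed
  then show ?thesis by blast
qed

lemma Psi_eqI: "derivation_ext n (twist f) F \<Longrightarrow> Psi scaleT tens V n f = F"
  unfolding Psi_eq_The using derivation_ext_unique by blast

lemma derivation_ext_Psi: "f \<in> Cn scaleV scaleT tens V n \<Longrightarrow> derivation_ext n (twist f) (Psi scaleT tens V n f)"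
  using derivation_ext_exists[OF twist_Cn] Psi_eqI by metis

lemma derivation_ext_CL:
  assumes f: "f \<in> Cn scaleV scaleT tens V n" and F: "derivation_ext n f F"
  shows "F \<in> CL scaleT W n"
  unfolding W.CL_iff
proof (intro conjI allI impI)
  show "multilinear scaleT F" using F by (simp add: derivation_ext_def)
  fix zs assume zs: "hom_list W zs" "zs \<noteq> []"
  then obtain ys d t where ys: "zs = ys @ [(d, t)]" by (metis surj_pair rev_exhaust)
  then have hom: "hom_list W ys" "t \<in> W d" using zs by auto
  have lin: "Vector_Spaces.linear scaleT scaleT (\<lambda>t. F (map snd ys @ [t]))"
    using F by (auto simp: derivation_ext_def multilinear_def)
  from hom(2) have "F (map snd ys @ [t]) \<in> W (total ys + d + n)"
  proof (induction rule: W_induct)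
    case (tens a b x y)
    have "tens (f (map snd ys) x) y \<in> W (total ys + d + n)"
      using tens_in_W[OF Cn_degree[OF f hom(1) tens(1)] tens(2)] by (simp add: algebra_simps flip: tens(3))
    moreover have "tens x (f (map snd ys) y) \<in> W (total ys + d + n)"
      using tens_in_W[OF tens(1) Cn_degree[OF f hom(1) tens(2)]] by (simp add: algebra_simps flip: tens(3))
    ultimately show ?case
      using F hom(1) tens(1,2)
      by (auto simp: derivation_ext_def intro!: T.subspace_add[OF subspace_W] T.subspace_sg[OF subspace_W])
  qed (simp_all add: lin_zero[OF lin] lin_add[OF lin] T.subspace_0[OF subspace_W] T.subspace_add[OF subspace_W])
  then show "F (map snd zs) \<in> W (total zs + n)" by (simp add: ys algebra_simps)
qed

end

text \<open>Each algebraic law is an equation in some \<open>L n\<close>, so by injectivity it may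
  be tested after applying \<open>\<phi>\<close>, where it becomes the corresponding law of the
  target.\<close>

lemma graded_lie_algebra_hom_transport:
  assumes target: "graded_lie_algebra s' L' br'"
    and s: "vector_space s" and sub: "\<And>n. module.subspace s (L n)"
    and degree: "\<And>n f. f \<in> L n \<Longrightarrow> \<phi> n f \<in> L' n"
    and add: "\<And>n f g. \<lbrakk>f \<in> L n; g \<in> L n\<rbrakk> \<Longrightarrow> \<phi> n (f + g) = \<phi> n f + \<phi> n g"
    and scale: "\<And>n c f. f \<in> L n \<Longrightarrow> \<phi> n (s c f) = s' c (\<phi> n f)"
    and inj: "\<And>n. inj_on (\<phi> n) (L n)"
    and closed: "\<And>m n f g. \<lbrakk>f \<in> L m; g \<in> L n\<rbrakk> \<Longrightarrow> br' m n (\<phi> m f) (\<phi> n g) \<in> \<phi> (m + n) ` L (m + n)"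
  shows "graded_lie_algebra_hom s L (\<lambda>m n f g. the_inv_into (L (m + n)) (\<phi> (m + n)) (br' m n (\<phi> m f) (\<phi> n g))) s' L' br' \<phi>"
proof -
  interpret target: graded_lie_algebra s' L' br' by (rule target)
  interpret vector_space s by (rule s)
  define br where "br = (\<lambda>m n f g. the_inv_into (L (m + n)) (\<phi> (m + n)) (br' m n (\<phi> m f) (\<phi> n g)))"
  have br: "br m n f g \<in> L (m + n)" "\<phi> (m + n) (br m n f g) = br' m n (\<phi> m f) (\<phi> n g)"
    if "f \<in> L m" "g \<in> L n" for f g m n
    unfolding br_def using closed[OF that] by (auto intro: the_inv_into_into[OF inj] f_the_inv_into_f[OF inj])
  have eqI: "f = g" if "\<phi> n f = \<phi> n g" "f \<in> L n" "g \<in> L n" for f g n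
    using inj_onD[OF inj that] .
  note mem = subspace_add[OF sub] subspace_scale[OF sub] subspace_neg[OF sub]
  have neg: "\<phi> n (- f) = - \<phi> n f" if "f \<in> L n" for n f
    using scale[OF that, of "-1"] by simp
  have "graded_lie_algebra_hom s L br s' L' br' \<phi>"
  proof
    fix f g m n c
    assume f: "f \<in> L m" and g: "g \<in> L n"
    show "br m n f g \<in> L (m + n)" by (rule br[OF f g])
    show "\<phi> (m + n) (br m n f g) = br' m n (\<phi> m f) (\<phi> n g)" by (rule br[OF f g])
    show "br m n (s c f) g = s c (br m n f g)"
      by (rule eqI[of "m + n"]) (simp_all add: f g br mem scale degree target.scale_left)
    show "br m n f (s c g) = s c (br m n f g)"
      by (rule eqI[of "m + n"]) (simp_all add: f g br mem scale degree target.scale_right)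
    have gf: "br n m g f \<in> L (m + n)" "\<phi> (m + n) (br n m g f) = br' n m (\<phi> n g) (\<phi> m f)"
      using br[OF g f] by (simp_all add: add.commute)
    show "br m n f g = - s ((-1) powi (m * n)) (br n m g f)"
      by (rule eqI[of "m + n"])
        (simp_all add: f g br gf mem scale degree neg target.antisymmetry[OF degree[OF f] degree[OF g]])
  next
    fix f f' g m n assume f: "f \<in> L m" "f' \<in> L m" "g \<in> L n"
    show "br m n (f + f') g = br m n f g + br m n f' g"
      by (rule eqI[of "m + n"]) (simp_all add: f br mem add degree target.add_left)
  next
    fix f g g' m n assume f: "f \<in> L m" "g \<in> L n" "g' \<in> L n"
    show "br m n f (g + g') = br m n f g + br m n f g'"
      by (rule eqI[of "m + n"]) (simp_all add: f br mem add degree target.add_right)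
  next
    fix f g h m n p assume f: "f \<in> L m" and g: "g \<in> L n" and h: "h \<in> L p"
    \<comment> \<open>\<open>\<phi>\<close> is a separate map in each degree, so all three terms of
      the Jacobi identity are placed in the one component \<open>L (m + n + p)\<close>.\<close>
    have 1: "br m (n + p) f (br n p g h) \<in> L (m + n + p)"
      "\<phi> (m + n + p) (br m (n + p) f (br n p g h)) = br' m (n + p) (\<phi> m f) (br' n p (\<phi> n g) (\<phi> p h))"
      using br[OF f br(1)[OF g h]] br(2)[OF g h] by (simp_all add: add.assoc)
    have 2: "br (m + n) p (br m n f g) h \<in> L (m + n + p)"
      "\<phi> (m + n + p) (br (m + n) p (br m n f g) h) = br' (m + n) p (br' m n (\<phi> m f) (\<phi> n g)) (\<phi> p h)"
      using br[OF br(1)[OF f g] h] br(2)[OF f g] by simp_all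
    have 3: "br n (m + p) g (br m p f h) \<in> L (m + n + p)"
      "\<phi> (m + n + p) (br n (m + p) g (br m p f h)) = br' n (m + p) (\<phi> n g) (br' m p (\<phi> m f) (\<phi> p h))"
      using br[OF g br(1)[OF f h]] br(2)[OF f h] by (simp_all add: add.left_commute add.assoc)
    show "br m (n + p) f (br n p g h) =
      br (m + n) p (br m n f g) h + s ((-1) powi (m * n)) (br n (m + p) g (br m p f h))"
      by (rule eqI[of "m + n + p"])
        (simp_all add: 1 2 3 mem add scale target.jacobi[OF degree[OF f] degree[OF g] degree[OF h]])
  qed (auto intro: sub degree add scale)
  then show ?thesis by (simp add: br_def)
qed

context graded_tensor_square
begin

section \<open>The image of \<open>\<Psi>\<close>\<close>

text \<open>
  \<open>K\<close> is the bracket of \<open>f\<close> and \<open>g\<close>. Its first two summands collect the insertions before the last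
  argument; \<open>S\<close> is the graded commutator of the operators \<open>f us\<close> and \<open>g vs\<close>, which arises because
  \<open>split_sum_swap\<close> turns both sums of insertions at the last argument into sums over the same splittings.
\<close>

lemma derivation_ext_bracket:
  assumes f: "f \<in> Cn scaleV scaleT tens V m" and g: "g \<in> Cn scaleV scaleT tens V n"
    and F: "derivation_ext m f F" and G: "derivation_ext n g G"
  shows "\<exists>k\<in>Cn scaleV scaleT tens V (m + n). derivation_ext (m + n) k (balavoine_bracket scaleT W m n F G)"
proof -
  note FC = derivation_ext_CL[OF f F] and GC = derivation_ext_CL[OF g G]
  note lin_f = Cn_linear[OF f] Cn_linear_list[OF f] and lin_g = Cn_linear[OF g] Cn_linear_list[OF g]
  define S where "S x us vs = f (map snd us) (g (map snd vs) x) -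
    sg ((m + total us) * (n + total vs)) (g (map snd vs) (f (map snd us) x))" for x us vs
  define K where "K x zs = plug n (\<lambda>ys. G (map snd ys)) (\<lambda>ys. f (map snd ys) x) zs -
      sg (m * n) (plug m (\<lambda>ys. F (map snd ys)) (\<lambda>ys. g (map snd ys) x) zs) +
      split_sum n (S x) zs" for x zs
  define k where "k Xs x = W.extension (K x) Xs" for Xs x
  have dm_f: "dmultilinear scaleT scaleV (\<lambda>ys. f (map snd ys) x)"
    and dm_g: "dmultilinear scaleT scaleV (\<lambda>ys. g (map snd ys) x)" for x
    by (simp_all add: dmultilinear_def lin_f lin_g)
  have dm_K: "dmultilinear scaleT scaleV (K x)" for x
  proof -
    have "dmultilinear scaleT scaleV (split_sum n (S x))"
    proof (rule dmultilinear_split_sum)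
      fix us d us' and vs :: "(int \<times> 't) list"
      show "Vector_Spaces.linear scaleT scaleV (\<lambda>w. S x (us @ (d, w) # us') vs)"
        by (auto simp: S_def intro!: linear_minus linear_sg lin_f linear_comp[OF lin_f(2) lin_g(1)])
      show "Vector_Spaces.linear scaleT scaleV (\<lambda>w. S x vs (us @ (d, w) # us'))"
        by (auto simp: S_def intro!: linear_minus linear_sg lin_g linear_comp[OF lin_g(2) lin_f(1)])
    qed
    then show ?thesis
      using dmultilinear_plug[OF W.CL_dmultilinear[OF GC] dm_f] dmultilinear_plug[OF W.CL_dmultilinear[OF FC] dm_g]
      unfolding dmultilinear_def K_def by (intro allI linear_plus linear_minus linear_sg) blast+
  qed
  have par_K: "parity_invariant (K x)" for x
  proof -
    have "S x us vs = S x us' vs'"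
      if "same_parity us us'"
        "same_parity vs vs'" for us us' vs vs'
      using that[THEN total_parity] that[THEN map_snd_parity] by (simp add: S_def sg_def)
    then have "parity_invariant (split_sum n (S x))" by (rule parity_invariant_split_sum)
    moreover have "parity_invariant (plug n (\<lambda>ys. G (map snd ys)) (\<lambda>ys. f (map snd ys) x))"
      "parity_invariant (plug m (\<lambda>ys. F (map snd ys)) (\<lambda>ys. g (map snd ys) x))"
      by (intro parity_invariant_plug parity_invariant_map_snd)+
    ultimately show ?thesis
      unfolding K_def parity_invariant_def by (intro allI impI) presburger
  qed
  have lin_K: "Vector_Spaces.linear scaleV scaleV (\<lambda>x. K x zs)" for zs
    unfolding K_def S_def
    by (intro linear_plus linear_minus linear_sg linear_split_sum linear_plug_outer
      lin_f lin_g linear_comp[OF lin_g(1) lin_f(1)] linear_comp[OF lin_f(1) lin_g(1)])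
  have k_eq: "k (map snd zs) x = K x zs" if "hom_list W zs" for zs x
    unfolding k_def by (rule W.extension_eq[OF dm_K par_K that])
  have F_tens: "F (map snd us @ [tens x y]) =
      tens (f (map snd us) x) y + sg (a * (total us + m)) (tens x (f (map snd us) y))"
    if "hom_list W us" "x \<in> V a" for us x a y
    by (rule derivation_ext_tens[OF F lin_f(1) that])
  have G_tens: "G (map snd us @ [tens x y]) =
      tens (g (map snd us) x) y + sg (a * (total us + n)) (tens x (g (map snd us) y))"
    if "hom_list W us" "x \<in> V a" for us x a y
    by (rule derivation_ext_tens[OF G lin_g(1) that])
  have linF: "Vector_Spaces.linear scaleT scaleT (\<lambda>t. F (Xs @ [t]))"
    and linG: "Vector_Spaces.linear scaleT scaleT (\<lambda>t. G (Xs @ [t]))" for Xs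
    using F G by (auto simp: derivation_ext_def multilinear_def)
  have sgF: "F (Xs @ [sg j t]) = sg j (F (Xs @ [t]))" and sgG: "G (Xs @ [sg j t]) = sg j (G (Xs @ [t]))" for Xs j t
    using lin_neg[OF linF] lin_neg[OF linG] by (simp_all add: sg_def)
  \<comment> \<open>Every list reaching \<open>H'\<close> has total degree
    \<open>total zs + q\<close>, so the sign of the second tensor term is the same throughout and
    can be taken out.\<close>
  have plug_tens: "plug q (\<lambda>ys. H (map snd ys)) (\<lambda>ys. H' (map snd ys @ [tens x y])) zs =
      tens (plug q (\<lambda>ys. H (map snd ys)) (\<lambda>ys. h (map snd ys) x) zs) y +
      sg (a * (total zs + q + r)) (tens x (plug q (\<lambda>ys. H (map snd ys)) (\<lambda>ys. h (map snd ys) y) zs))"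
    if H: "H \<in> CL scaleT W q" and zs: "hom_list W zs" and x: "x \<in> V a"
      and H': "\<And>us. hom_list W us \<Longrightarrow> H' (map snd us @ [tens x y]) =
        tens (h (map snd us) x) y + sg (a * (total us + r)) (tens x (h (map snd us) y))"
    for q r H H' h a x y zs
  proof -
    have "plug q (\<lambda>ys. H (map snd ys)) (\<lambda>ys. H' (map snd ys @ [tens x y])) zs =
      plug q (\<lambda>ys. H (map snd ys)) (\<lambda>ys. tens (h (map snd ys) x) y +
        sg (a * (total zs + q + r)) (tens x (h (map snd ys) y))) zs"
      by (rule plug_cong[OF zs]) (simp_all add: W.CL_degree[OF H] H')
    also have "\<dots> = tens (plug q (\<lambda>ys. H (map snd ys)) (\<lambda>ys. h (map snd ys) x) zs) y +
      sg (a * (total zs + q + r)) (tens x (plug q (\<lambda>ys. H (map snd ys)) (\<lambda>ys. h (map snd ys) y) zs))"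
      by (simp add: plug_outer_add plug_outer_sg plug_additive[of "\<lambda>v. tens v y"] plug_additive[of "tens x"] tens_simps)
    finally show ?thesis .
  qed
  \<comment> \<open>The mixed terms, with \<open>f\<close> on one tensor factor and \<open>g\<close>
    on the other, occur in both compositions and cancel; what survives acts on a single
    factor.\<close>
  have commutator: "F (map snd us @ [G (map snd vs @ [tens x y])]) -
      sg ((m + total us) * (n + total vs)) (G (map snd vs @ [F (map snd us @ [tens x y])])) =
      tens (S x us vs) y + sg (a * (total us + total vs + (m + n))) (tens x (S y us vs))"
    if us: "hom_list W us" and vs: "hom_list W vs" and x: "x \<in> V a" for us vs x a y
  proof -
    have FG: "F (map snd us @ [G (map snd vs @ [tens x y])]) =
        tens (f (map snd us) (g (map snd vs) x)) y +
        sg ((total vs + a + n) * (total us + m)) (tens (g (map snd vs) x) (f (map snd us) y)) +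
        sg (a * (total vs + n)) (tens (f (map snd us) x) (g (map snd vs) y) +
          sg (a * (total us + m)) (tens x (f (map snd us) (g (map snd vs) y))))"
      unfolding G_tens[OF vs x] lin_add[OF linF] sgF F_tens[OF us x] F_tens[OF us Cn_degree[OF g vs x]] ..
    have GF: "G (map snd vs @ [F (map snd us @ [tens x y])]) =
        tens (g (map snd vs) (f (map snd us) x)) y +
        sg ((total us + a + m) * (total vs + n)) (tens (f (map snd us) x) (g (map snd vs) y)) +
        sg (a * (total us + m)) (tens (g (map snd vs) x) (f (map snd us) y) +
          sg (a * (total vs + n)) (tens x (g (map snd vs) (f (map snd us) y))))"
      unfolding F_tens[OF us x] lin_add[OF linG] sgG G_tens[OF vs x] G_tens[OF vs Cn_degree[OF f us x]] ..
    show ?thesis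
      unfolding FG GF S_def tens_simps tens_sg
      by (cases "even a"; cases "even m"; cases "even n"; cases "even (total us)"; cases "even (total vs)")
        (simp_all add: sg_def)
  qed
  have "derivation_ext (m + n) k (balavoine_bracket scaleT W m n F G)"
    unfolding derivation_ext_def
  proof (intro conjI allI impI)
    show "multilinear scaleT (balavoine_bracket scaleT W m n F G)"
      by (rule W.CL_multilinear[OF graded_lie_algebra.closed[OF W.graded_lie_algebra_CL FC GC]])
    fix zs a x b y
    assume zs: "hom_list W zs" and x: "x \<in> V a" and y: "y \<in> V b"
    let ?d = "a + b + 1" and ?t = "tens x y"
    let ?F = "\<lambda>ys. F (map snd ys)" and ?G = "\<lambda>ys. G (map snd ys)"
    have 1: "plug n ?G (\<lambda>ys. F (map snd ys @ [?t])) zs =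
        tens (plug n ?G (\<lambda>ys. f (map snd ys) x) zs) y +
        sg (a * (total zs + n + m)) (tens x (plug n ?G (\<lambda>ys. f (map snd ys) y) zs))"
      by (rule plug_tens[OF GC zs x]) (rule F_tens[OF _ x])
    have 2: "plug m ?F (\<lambda>ys. G (map snd ys @ [?t])) zs =
        tens (plug m ?F (\<lambda>ys. g (map snd ys) x) zs) y +
        sg (a * (total zs + m + n)) (tens x (plug m ?F (\<lambda>ys. g (map snd ys) y) zs))"
      by (rule plug_tens[OF FC zs x]) (rule G_tens[OF _ x])
    have hom: "hom_list W (zs @ [(?d, ?t)])" using zs tens_in_W[OF x y] by simp
    have "balavoine_bracket scaleT W m n F G (map snd (zs @ [(?d, ?t)])) =
        plug n ?G ?F (zs @ [(?d, ?t)]) - sg (m * n) (plug m ?F ?G (zs @ [(?d, ?t)]))"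
      unfolding W.balavoine_bracket_eq
      using W.balavoine_circ_eq_plug[OF FC[THEN W.CL_multilinear] GC[THEN W.CL_multilinear] hom]
        W.balavoine_circ_eq_plug[OF GC[THEN W.CL_multilinear] FC[THEN W.CL_multilinear] hom]
      by (simp add: sg_fun)
    \<comment> \<open>\<open>plug_snoc\<close> separates the insertions that leave \<open>?t\<close>
      outside from those that take it as the last argument of the inner map.\<close>
    also have "\<dots> = plug n ?G (\<lambda>ys. F (map snd ys @ [?t])) zs - sg (m * n) (plug m ?F (\<lambda>ys. G (map snd ys @ [?t])) zs) +
        (split_sum n (\<lambda>us vs. F (map snd us @ [G (map snd vs @ [?t])])) zs -
        sg (m * n) (split_sum m (\<lambda>us vs. G (map snd us @ [F (map snd vs @ [?t])])) zs))"
      unfolding plug_snoc by (simp add: sg_add)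
    also have "split_sum n (\<lambda>us vs. F (map snd us @ [G (map snd vs @ [?t])])) zs -
        sg (m * n) (split_sum m (\<lambda>us vs. G (map snd us @ [F (map snd vs @ [?t])])) zs) =
        split_sum n (\<lambda>us vs. F (map snd us @ [G (map snd vs @ [?t])]) -
          sg ((m + total us) * (n + total vs)) (G (map snd vs @ [F (map snd us @ [?t])]))) zs"
    proof -
      have "sg (m * n + n * m) v = v" for v :: 't by (simp add: sg_def mult.commute)
      then show ?thesis
        unfolding split_sum_diff split_sum_swap[of m "\<lambda>us vs. G (map snd us @ [F (map snd vs @ [?t])])" zs n] sg_sg
        by (simp only: mult.commute)
    qed
    \<comment> \<open>The totals of the two sublists add up to \<open>total zs\<close>, so the
      derivation sign no longer depends on the splitting.\<close>
    also have "\<dots> = split_sum n (\<lambda>us vs. tens (S x us vs) y +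
        sg (a * (total zs + (m + n))) (tens x (S y us vs))) zs"
      using commutator[OF _ _ x] by (intro split_sum_cong[OF zs]) simp
    also have "\<dots> = tens (split_sum n (S x) zs) y + sg (a * (total zs + (m + n))) (tens x (split_sum n (S y) zs))"
      by (simp add: split_sum_add split_sum_additive[of "sg _"] sg_add split_sum_additive[of "\<lambda>v. tens v y"]
        split_sum_additive[of "tens x"] tens_simps)
    finally show "balavoine_bracket scaleT W m n F G (map snd zs @ [tens x y]) =
        tens (k (map snd zs) x) y + sg (a * (total zs + (m + n))) (tens x (k (map snd zs) y))"
      unfolding 1 2 k_eq[OF zs] K_def
      by (simp add: tens_simps tens_sg sg_add sg_diff sg_sg ac_simps)
  qed
  moreover have "k \<in> Cn scaleV scaleT tens V (m + n)"
    unfolding Cn_iff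
  proof (intro conjI allI impI)
    show "Vector_Spaces.linear scaleT scaleV (\<lambda>X. k (Xs @ X # Ys) x)" for Xs Ys x
      unfolding k_def by (rule W.linear_extension[OF dm_K])
    show "Vector_Spaces.linear scaleV scaleV (k Xs)" for Xs
      unfolding k_def W.extension_def by (rule linear_parity_ext_outer[OF lin_K])
    fix zs a x assume zs: "hom_list W zs" and x: "x \<in> V a"
    have "plug n (\<lambda>ys. G (map snd ys)) (\<lambda>ys. f (map snd ys) x) zs \<in> V (total zs + a + (m + n))"
      using Cn_degree[OF f _ x]
      by (intro plug_in_subspace[OF subspace_grading zs] W.CL_degree[OF GC]) (fastforce simp: algebra_simps)+
    moreover have "plug m (\<lambda>ys. F (map snd ys)) (\<lambda>ys. g (map snd ys) x) zs \<in> V (total zs + a + (m + n))"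
      using Cn_degree[OF g _ x]
      by (intro plug_in_subspace[OF subspace_grading zs] W.CL_degree[OF FC]) (fastforce simp: algebra_simps)+
    moreover have "S x us vs \<in> V (total zs + a + (m + n))"
      if "hom_list W us" "hom_list W vs" "total us + total vs = total zs" for us vs
    proof -
      have eq: "total us + (total vs + a + n) + m = total zs + a + (m + n)"
        "total vs + (total us + a + m) + n = total zs + a + (m + n)" using that(3) by simp_all
      show ?thesis
        unfolding S_def
        by (intro subspace_diff[OF subspace_grading] subspace_sg[OF subspace_grading]
          Cn_degree[OF f that(1) Cn_degree[OF g that(2) x], unfolded eq]
          Cn_degree[OF g that(2) Cn_degree[OF f that(1) x], unfolded eq])
    qed
    ultimately show "k (map snd zs) x \<in> V (total zs + a + (m + n))"
      unfolding k_eq[OF zs] K_def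
      by (intro subspace_add[OF subspace_grading] subspace_diff[OF subspace_grading] subspace_sg[OF subspace_grading]
        split_sum_in_subspace[OF subspace_grading zs])
  qed
  ultimately show ?thesis by blast
qed

section \<open>Injectivity of \<open>Psi\<close> and transport of the bracket\<close>

lemma tens_functional:
  fixes \<phi> \<psi> :: "'v \<Rightarrow> 'k"
  assumes "Vector_Spaces.linear scaleV (*) \<phi>" "Vector_Spaces.linear scaleV (*) \<psi>"
  shows "\<exists>l. Vector_Spaces.linear scaleT (*) l \<and> (\<forall>x y. l (tens x y) = \<phi> x * \<psi> y)"
proof -
  have "bilinear_map scaleV scaleV (*) (\<lambda>x y. \<phi> x * \<psi> y)"
    using assms unfolding bilinear_map_def Vector_Spaces.linear_iff by (auto simp: algebra_simps)
  from universal[OF this] show ?thesis by blast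
qed

text \<open>For u the value at \<open>x\<close>, setting \<open>y = x\<close> makes u tensor x plus
  or minus x tensor u vanish. Product functionals show that u and x are dependent; then the sign is
  plus, and the relation carries a factor 2.\<close>

lemma derivation_ext_inj:
  assumes char: "(2::'k) \<noteq> 0" and f: "f \<in> Cn scaleV scaleT tens V n" and F: "derivation_ext n f 0"
  shows "f = 0"
proof -
  interpret K: vector_space "(*) :: 'k \<Rightarrow> 'k \<Rightarrow> 'k"
    by unfold_locales (auto simp: algebra_simps)
  interpret VK: vector_space_pair scaleV "(*) :: 'k \<Rightarrow> 'k \<Rightarrow> 'k" ..
  have hom: "f (map snd zs) x = 0" if zs: "hom_list W zs" and x: "x \<in> V a" for zs x a
  proof (rule ccontr)
    let ?u = "f (map snd zs) x" and ?e = "total zs + n"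
    assume u: "?u \<noteq> 0"
    then have x0: "x \<noteq> 0" using lin_zero[OF Cn_linear[OF f]] by auto
    have eq: "tens ?u x + sg (a * ?e) (tens x ?u) = 0"
      using F zs x unfolding derivation_ext_def by (metis zero_fun_apply)
    have functional: "\<phi> ?u * \<psi> x + sg (a * ?e) (\<phi> x * \<psi> ?u) = 0"
      if lin: "Vector_Spaces.linear scaleV (*) \<phi>" "Vector_Spaces.linear scaleV (*) \<psi>" for \<phi> \<psi> :: "'v \<Rightarrow> 'k"
    proof -
      obtain l where l: "Vector_Spaces.linear scaleT (*) l" "\<And>x y. l (tens x y) = \<phi> x * \<psi> y"
        using tens_functional[OF lin] by blast
      have "l (tens ?u x + sg (a * ?e) (tens x ?u)) = \<phi> ?u * \<psi> x + sg (a * ?e) (\<phi> x * \<psi> ?u)"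
        using lin_neg[OF l(1)] by (simp add: lin_add[OF l(1)] sg_def l(2))
      then show ?thesis using lin_zero[OF l(1)] by (simp add: eq)
    qed
    show False
    proof (cases "?u \<in> span {x}")
      case True
      then obtain c where c: "?u = scaleV c x" by (auto simp: span_singleton)
      with u have "c \<noteq> 0" by auto
      have "?u \<in> V a" "?u \<in> V (total zs + a + n)"
        using c x subspace_scale[OF subspace_grading] Cn_degree[OF f zs x] by auto
      \<comment> \<open>A nonzero vector lies in at most one component, so the operator has degree 0
        here and the sign is plus.\<close>
      then have "?e = 0" using u components_homogeneous[of ?u] by (metis add.assoc add.commute add_cancel_right_right)
      obtain \<phi> where \<phi>: "Vector_Spaces.linear scaleV (*) \<phi>" "\<phi> x = (1::'k)"
        using VK.linear_independent_extend[of "{x}" "\<lambda>_. 1"] x0 by auto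
      have "2 * c = 0" using functional[OF \<phi>(1) \<phi>(1)] \<open>?e = 0\<close> lin_scale[OF \<phi>(1)] by (simp add: c \<phi>(2))
      then show False using \<open>c \<noteq> 0\<close> char by simp
    next
      case False
      then have "independent {?u, x}" using x0 by (simp add: independent_insert)
      moreover have "?u \<noteq> x" using False span_base by auto
      ultimately obtain \<phi> where \<phi>: "Vector_Spaces.linear scaleV (*) \<phi>" "\<phi> ?u = (1::'k)" "\<phi> x = 0"
        using VK.linear_independent_extend[of "{?u, x}" "\<lambda>v. if v = x then 0 else 1"] by auto
      obtain \<psi> where \<psi>: "Vector_Spaces.linear scaleV (*) \<psi>" "\<psi> x = (1::'k)"
        using VK.linear_independent_extend[of "{x}" "\<lambda>_. 1"] x0 by auto
      show False using functional[OF \<phi>(1) \<psi>(1)] by (simp add: \<phi> \<psi>)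
    qed
  qed
  have "f Xs x = 0" for Xs x
  proof (induction x rule: homogeneous_induct)
    case (homogeneous a x)
    have "(\<lambda>Xs. f Xs x) = (\<lambda>Xs. 0)"
      using hom[OF _ homogeneous] linear_const_zero[OF Cn_linear_list[OF f]]
      by (intro W.slotwise_linear_eq_homogeneous[where s' = scaleV] Cn_linear_list[OF f]) auto
    then show ?case by metis
  qed (simp_all add: lin_zero[OF Cn_linear[OF f]] lin_add[OF Cn_linear[OF f]])
  then show ?thesis by (simp add: fun_eq_iff)
qed

lemma subspace_Cn: "module.subspace (\<lambda>c f Xs x. scaleV c (f Xs x)) (Cn scaleV scaleT tens V n)"
proof -
  interpret F: vector_space "\<lambda>c f Xs x. scaleV c (f Xs x)"
    by (rule vector_space_fun vector_space_axioms)+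
  show ?thesis
  proof (rule F.subspaceI)
    show "0 \<in> Cn scaleV scaleT tens V n"
      by (simp add: Cn_iff Vector_Spaces.linear_iff vector_space_axioms T.vector_space_axioms subspace_0[OF subspace_grading])
  next
    fix f g assume f: "f \<in> Cn scaleV scaleT tens V n" and g: "g \<in> Cn scaleV scaleT tens V n"
    have "(\<lambda>Xs x. f Xs x + g Xs x) \<in> Cn scaleV scaleT tens V n"
      unfolding Cn_iff
      by (intro conjI allI impI linear_plus subspace_add[OF subspace_grading])
        (simp_all add: Cn_linear_list[OF f] Cn_linear_list[OF g] Cn_linear[OF f] Cn_linear[OF g]
          Cn_degree[OF f] Cn_degree[OF g])
    then show "f + g \<in> Cn scaleV scaleT tens V n" by (simp add: plus_fun_def)
  next
    fix c f assume f: "f \<in> Cn scaleV scaleT tens V n"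
    show "(\<lambda>Xs x. scaleV c (f Xs x)) \<in> Cn scaleV scaleT tens V n"
      unfolding Cn_iff
      by (auto intro!: linear_comp[OF _ linear_scale_self] subspace_scale[OF subspace_grading]
        Cn_linear_list[OF f] Cn_linear[OF f] Cn_degree[OF f])
  qed
qed

lemma Psi_add:
  assumes f: "f \<in> Cn scaleV scaleT tens V n" and g: "g \<in> Cn scaleV scaleT tens V n"
  shows "Psi scaleT tens V n (f + g) = Psi scaleT tens V n f + Psi scaleT tens V n g"
  using derivation_ext_Psi[OF f] derivation_ext_Psi[OF g]
  by (intro Psi_eqI) (simp add: derivation_ext_def multilinear_add twist_def sg_add tens_simps)

lemma Psi_scale:
  assumes f: "f \<in> Cn scaleV scaleT tens V n"
  shows "Psi scaleT tens V n (\<lambda>Xs x. scaleV c (f Xs x)) = (\<lambda>Ws. scaleT c (Psi scaleT tens V n f Ws))"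
proof -
  have sg: "sg k (scaleV c v) = scaleV c (sg k v)" "sg k (scaleT c t) = scaleT c (sg k t)" for k v t
    by (simp_all add: sg_def)
  show ?thesis
    using derivation_ext_Psi[OF f]
    by (intro Psi_eqI) (simp add: derivation_ext_def multilinear_scale twist_def sg tens_simps T.scale_right_distrib)
qed

lemma inj_on_Psi:
  assumes char: "(2::'k) \<noteq> 0"
  shows "inj_on (Psi scaleT tens V n) (Cn scaleV scaleT tens V n)"
proof (rule inj_onI)
  interpret F: vector_space "\<lambda>c f Xs x. scaleV c (f Xs x)"
    by (rule vector_space_fun vector_space_axioms)+
  fix f g assume f: "f \<in> Cn scaleV scaleT tens V n" and g: "g \<in> Cn scaleV scaleT tens V n"
    and eq: "Psi scaleT tens V n f = Psi scaleT tens V n g"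
  have fg: "f - g \<in> Cn scaleV scaleT tens V n" by (rule F.subspace_diff[OF subspace_Cn f g])
  have "Psi scaleT tens V n (f - g) = 0" using Psi_add[OF fg g] eq by simp
  then have "derivation_ext n (twist (f - g)) 0" using derivation_ext_Psi[OF fg] by simp
  then have "twist (f - g) = 0" by (rule derivation_ext_inj[OF char twist_Cn[OF fg]])
  then have "twist (twist (f - g)) = twist 0" by simp
  then have "f - g = twist 0" by simp
  then show "f = g" by (simp add: twist_def fun_eq_iff)
qed

lemma graded_lie_algebra_hom_Psi:
  assumes char: "(2::'k) \<noteq> 0"
  shows "graded_lie_algebra_hom (\<lambda>c f Xs x. scaleV c (f Xs x)) (Cn scaleV scaleT tens V)
     (nambu_bracket scaleV scaleT tens V) (\<lambda>c F Ws. scaleT c (F Ws)) (CL scaleT W)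
     (balavoine_bracket scaleT W) (Psi scaleT tens V)"
proof -
  have closed: "balavoine_bracket scaleT W m n (Psi scaleT tens V m f) (Psi scaleT tens V n g)
      \<in> Psi scaleT tens V (m + n) ` Cn scaleV scaleT tens V (m + n)"
    if f: "f \<in> Cn scaleV scaleT tens V m" and g: "g \<in> Cn scaleV scaleT tens V n" for f g m n
  proof -
    obtain k where k: "k \<in> Cn scaleV scaleT tens V (m + n)" and
      ext: "derivation_ext (m + n) k
        (balavoine_bracket scaleT W m n (Psi scaleT tens V m f) (Psi scaleT tens V n g))"
      using derivation_ext_bracket[OF f[THEN twist_Cn] g[THEN twist_Cn] f[THEN derivation_ext_Psi] g[THEN derivation_ext_Psi]]
      by blast
    \<comment> \<open>\<open>Psi\<close> is the derivation extension of the twisted map, and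
      \<open>twist\<close> is its own inverse; hence the preimage of the bracket is
      \<open>twist k\<close>.\<close>
    show ?thesis
      using Psi_eqI[of "m + n" "twist k"] ext twist_Cn[OF k] by (intro image_eqI[of _ _ "twist k"]) simp_all
  qed
  have nambu: "nambu_bracket scaleV scaleT tens V = (\<lambda>m n f g. the_inv_into (Cn scaleV scaleT tens V (m + n))
      (Psi scaleT tens V (m + n))
      (balavoine_bracket scaleT W m n (Psi scaleT tens V m f) (Psi scaleT tens V n g)))"
    by (intro ext) (simp add: nambu_bracket_def)
  show ?thesis
    unfolding nambu
  proof (rule graded_lie_algebra_hom_transport)
    show "vector_space (\<lambda>c f Xs x. scaleV c (f Xs x))"
      by (intro vector_space_fun vector_space_axioms)
    show "Psi scaleT tens V n f \<in> CL scaleT W n" if "f \<in> Cn scaleV scaleT tens V n" for n f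
      by (rule derivation_ext_CL[OF twist_Cn[OF that] derivation_ext_Psi[OF that]])
  qed (fact W.graded_lie_algebra_CL subspace_Cn Psi_add Psi_scale inj_on_Psi[OF char] closed)+
qed

end

text \<open>A homomorphism preserves the degree and the equation of a Maurer-Cartan element, so
  \<open>Psi\<close> turns each \<open>\<Theta>\<close> into a Leibniz structure. Characteristic
  different from 2 makes \<open>Psi\<close> injective and thereby the transported bracket
  meaningful.\<close>

theorem corollary3p5:
  fixes scaleV :: "'k::field \<Rightarrow> 'v::ab_group_add \<Rightarrow> 'v"
    and scaleT :: "'k \<Rightarrow> 't::ab_group_add \<Rightarrow> 't"
    and tens :: "'v \<Rightarrow> 'v \<Rightarrow> 't"
    and V :: "int \<Rightarrow> 'v set"
  assumes char_not_2: "(2::'k) \<noteq> 0"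
    and V: "graded_vector_space scaleV V"
    and T: "tensor_square scaleV scaleT tens"
  shows "graded_lie_algebra_hom
           (\<lambda>c f Xs x. scaleV c (f Xs x))
           (Cn scaleV scaleT tens V)
           (nambu_bracket scaleV scaleT tens V)
           (\<lambda>c F Ws. scaleT c (F Ws))
           (CL scaleT (suspension (tensor_grading scaleT tens V)))
           (balavoine_bracket scaleT (suspension (tensor_grading scaleT tens V)))
           (Psi scaleT tens V) \<and>
         (\<forall>\<Theta>. homotopy_nambu scaleV scaleT tens V \<Theta> \<longrightarrow>
           (\<exists>!\<theta>. suspended scaleT \<theta> = Psi scaleT tens V 1 \<Theta> \<and>
              leibniz_infinity scaleT (suspension (tensor_grading scaleT tens V)) (suspended scaleT \<theta>) \<and>
              (\<forall>ds Xs a x b y.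
                 homogeneous (tensor_grading scaleT tens V) ds Xs \<longrightarrow> x \<in> V a \<longrightarrow> y \<in> V b \<longrightarrow>
                 (let i = length Xs + 1 in
                  \<theta> (Xs @ [tens x y]) =
                    tens (\<Theta> Xs x) y +
                    scaleT ((-1) powi (a * (sum_list ds + int i))) (tens x (\<Theta> Xs y))))))"
proof -
  interpret graded_tensor_square scaleV V scaleT tens
    using V T by (rule graded_tensor_square.intro)
  interpret Psi: graded_lie_algebra_hom "\<lambda>c f Xs x. scaleV c (f Xs x)" "Cn scaleV scaleT tens V"
    "nambu_bracket scaleV scaleT tens V" "\<lambda>c F Ws. scaleT c (F Ws)" "CL scaleT W"
    "balavoine_bracket scaleT W" "Psi scaleT tens V"
    by (rule graded_lie_algebra_hom_Psi[OF char_not_2])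
  have pow: "scaleT ((-1) ^ k) v = sg (int k) v" for k v
    using T.scale_powi[of "int k" v] by simp
  have suspended: "suspended scaleT \<theta> ws = sg (int (length ws * (length ws - 1) div 2)) (\<theta> ws)" for \<theta> ws
    unfolding suspended_def Let_def pow ..
  have involution: "suspended scaleT (suspended scaleT \<theta>) = \<theta>" for \<theta>
    by (simp add: fun_eq_iff suspended sg_def)
  have "\<exists>!\<theta>. suspended scaleT \<theta> = Psi scaleT tens V 1 \<Theta> \<and>
      leibniz_infinity scaleT W (suspended scaleT \<theta>) \<and>
      (\<forall>ds Xs a x b y.
         homogeneous (tensor_grading scaleT tens V) ds Xs \<longrightarrow> x \<in> V a \<longrightarrow> y \<in> V b \<longrightarrow>
         (let i = length Xs + 1 in
          \<theta> (Xs @ [tens x y]) =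
            tens (\<Theta> Xs x) y + scaleT ((-1) powi (a * (sum_list ds + int i))) (tens x (\<Theta> Xs y))))"
    if "homotopy_nambu scaleV scaleT tens V \<Theta>" for \<Theta>
  \<comment> \<open>\<open>suspended\<close> is its own inverse, so the first conjunct determines
    the witness and gives its uniqueness.\<close>
  proof (rule ex1I[of _ "suspended scaleT (Psi scaleT tens V 1 \<Theta>)"], intro conjI allI impI)
    have \<Theta>: "\<Theta> \<in> Cn scaleV scaleT tens V 1" "nambu_bracket scaleV scaleT tens V 1 1 \<Theta> \<Theta> = 0"
      using that by (auto simp: homotopy_nambu_def maurer_cartan_def)
    \<comment> \<open>The bracket of two elements of degree 1 lies in degree 2; additivity there
      gives that its vanishing passes to the image.\<close>
    have "Psi scaleT tens V 2 0 = 0"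
      using Psi.add[of 0 2 0] Psi.source.subspace_0[OF Psi.source.subspace_component] by simp
    then have "balavoine_bracket scaleT W 1 1 (Psi scaleT tens V 1 \<Theta>) (Psi scaleT tens V 1 \<Theta>) = 0"
      using Psi.bracket[OF \<Theta>(1) \<Theta>(1)] \<Theta>(2) by simp
    then show "leibniz_infinity scaleT W (suspended scaleT (suspended scaleT (Psi scaleT tens V 1 \<Theta>)))"
      unfolding involution leibniz_infinity_def maurer_cartan_def
      using graded_W Psi.degree[OF \<Theta>(1)] by simp
    fix ds Xs a x b y
    assume hom: "homogeneous (tensor_grading scaleT tens V) ds Xs" and x: "x \<in> V a" and y: "y \<in> V b"
    from hom obtain zs where zs: "hom_list W zs" "Xs = map snd zs" "ds = map (\<lambda>z. fst z - 1) zs"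
      by (auto simp: homogeneous_tensor_grading)
    have "Psi scaleT tens V 1 \<Theta> (Xs @ [tens x y]) = sg (int (Suc (length Xs) * length Xs div 2))
        (tens (\<Theta> Xs x) y + sg (a * (total zs + 1)) (tens x (\<Theta> Xs y)))"
      using derivation_ext_Psi[OF \<Theta>(1)] zs(1) x y
      by (simp add: derivation_ext_def zs(2) twist_def tens_sg sg_add sg_sg add.commute)
    \<comment> \<open>On \<open>length Xs + 1\<close> arguments the prefactor of
      \<open>suspended\<close> equals that of \<open>Psi\<close>, and the two signs cancel.\<close>
    then have "suspended scaleT (Psi scaleT tens V 1 \<Theta>) (Xs @ [tens x y]) =
        tens (\<Theta> Xs x) y + sg (a * (total zs + 1)) (tens x (\<Theta> Xs y))"
      unfolding suspended by (simp add: sg_def)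
    \<comment> \<open>Unsuspending the arguments \<open>Xs\<close> lowers the degree sum by
      \<open>length Xs\<close>, so \<open>total zs + 1\<close> equals
      \<open>sum_list ds + int i\<close>.\<close>
    then show "let i = length Xs + 1 in
        suspended scaleT (Psi scaleT tens V 1 \<Theta>) (Xs @ [tens x y]) =
          tens (\<Theta> Xs x) y + scaleT ((-1) powi (a * (sum_list ds + int i))) (tens x (\<Theta> Xs y))"
      by (simp add: T.scale_powi zs(2,3) sum_list_shift)
  qed (auto simp: involution[of "Psi scaleT tens V 1 \<Theta>"] dest: arg_cong[of _ _ "suspended scaleT"] simp: involution)
  with Psi.graded_lie_algebra_hom_axioms show ?thesis by blast
qed

end
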